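(* Let $X(x,y)=(P(x,y),Q(x,y))$ be a planar polynomial vector field and assume all its limit cycles lie in some compact set $K\subset(-1,1)^2$. Let $p\in\mathbb{R}[x]$ have degree $m\ge 2$ and full branch intervals $I_1,\dots,I_{B(p)}$. Define $\Phi(u,v)=(p(u),p(v))$, and define a polynomial vector field $Y$ by $$\dot u=p'(v)\,P(p(u),p(v)),\qquad \dot v=p'(u)\,Q(p(u),p(v)).$$ Then: (1) $\deg(Y)\le m\deg(X)+(m-1)$. (2) For each rectangle $I_a\times I_b$ ($1\le a,b\le B(p)$), $\Phi$ restricts to a diffeomorphism of $I_a\times I_b$ onto $(-1,1)^2$, and on $I_a\times I_b$ one has $$D\Phi\cdot Y=(p'(u)p'(v))\,X\circ\Phi,$$ with $p'(u)p'(v)\ne 0$. Hence $\Phi$ maps (unparametrized) $Y$-orbits in $I_a\times I_b$ to $X$-orbits in $(-1,1)^2$, and the local Poincaré return maps along corresponding periodic orbits are conjugate via $\Phi$ (up to inversion when $p'(u)p'(v)<0$ on $I_a\times I_b$). (3) Each limit cycle of $X$ lifts to at least $B(p)^2$ pairwise disjoint limit cycles of $Y$, i.e. for each limit cycle $\gamma$ of $X$ there are at least $B(p)^2$ pairwise disjoint limit cycles of $Y$ each mapped by $\Phi$ onto $\gamma$. Consequently, for every $n\ge 1$ and every polynomial $p\in\mathbb{R}[x]$ of degree $m\ge 2$, $$H(nm+m-1)\ \ge\ B(p)^2\,H(n).$$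
   Context: A planar polynomial vector field is $X=(P,Q)$ with $P,Q\in\mathbb{R}[x,y]$, defining the system $\dot x=P(x,y)$, $\dot y=Q(x,y)$ on $\mathbb{R}^2$. Its degree is $\deg(X)=\max\{\deg P,\deg Q\}$ (total degree). A periodic orbit is a non-equilibrium closed trajectory of the flow; a limit cycle is a periodic orbit that is isolated among periodic orbits (equivalently, it corresponds to an isolated fixed point of a local Poincaré return map on a transverse section). Return maps are defined using forward time. $\pi(X)$ denotes the number of limit cycles of $X$ (possibly $+\infty$), and $$H(n)=\sup\{\pi(X): X \text{ a planar polynomial vector field with } \deg(X)\le n\}\in\{0,1,2,\dots\}\cup\{+\infty\},$$ with the convention $0\cdot(+\infty)=0$. A full branch interval for a polynomial $p\in\mathbb{R}[x]$ is an open interval $I\subset\mathbb{R}$ such that $p:I\to(-1,1)$ is a $C^1$ diffeomorphism (onto). $B(p)$ is the number of full branch intervals of $p$. *)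

theory Defs
  imports
    "HOL-Analysis.Analysis"
    "HOL-Computational_Algebra.Polynomial"
    "HOL-Library.Extended_Nat"
begin

text \<open>
  A real polynomial in two variables $x, y$ is an element of $\mathbb{R}[x][y]$: the outer
  variable is $y$ and \<open>coeff (coeff P j) i\<close> is the coefficient of $x^i y^j$.
\<close>

type_synonym poly_xy = "real poly poly"

type_synonym poly_vf = "poly_xy \<times> poly_xy"

definition eval_xy :: "poly_xy \<Rightarrow> real \<Rightarrow> real \<Rightarrow> real" where
  "eval_xy P x y = poly (poly P [:y:]) x"

text \<open>As for \<^const>\<open>degree\<close>, the zero polynomial has total degree 0.\<close>

definition total_degree :: "poly_xy \<Rightarrow> nat" where
  "total_degree P = Max (insert 0 {i + j | i j. coeff (coeff P j) i \<noteq> 0})"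

definition vf_degree :: "poly_vf \<Rightarrow> nat" where
  "vf_degree X = max (total_degree (fst X)) (total_degree (snd X))"

definition vf :: "poly_vf \<Rightarrow> real \<times> real \<Rightarrow> real \<times> real" where
  "vf X = (\<lambda>(x, y). (eval_xy (fst X) x y, eval_xy (snd X) x y))"

definition in_x :: "real poly \<Rightarrow> poly_xy" where
  "in_x p = [:p:]"

definition in_y :: "real poly \<Rightarrow> poly_xy" where
  "in_y p = map_poly (\<lambda>c. [:c:]) p"

definition subst_xy :: "poly_xy \<Rightarrow> real poly \<Rightarrow> poly_xy" where
  "subst_xy P p = pcompose (map_poly (\<lambda>c. pcompose c p) P) (in_y p)"

definition lift_vf :: "real poly \<Rightarrow> poly_vf \<Rightarrow> poly_vf" where
  "lift_vf p X =
     (in_y (pderiv p) * subst_xy (fst X) p, in_x (pderiv p) * subst_xy (snd X) p)"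

definition Phi :: "real poly \<Rightarrow> real \<times> real \<Rightarrow> real \<times> real" where
  "Phi p = (\<lambda>(u, v). (poly p u, poly p v))"

lemma eval_in_x: "eval_xy (in_x p) x y = poly p x"
  by (simp add: eval_xy_def in_x_def)

lemma poly_in_y: "poly (in_y p) [:y:] = [:poly p y:]"
  unfolding in_y_def by (induction p) (simp_all add: map_poly_pCons)

lemma eval_in_y: "eval_xy (in_y p) x y = poly p y"
  by (simp add: eval_xy_def poly_in_y)

lemma eval_mult: "eval_xy (P * Q) x y = eval_xy P x y * eval_xy Q x y"
  by (simp add: eval_xy_def)

lemma eval_subst_xy: "eval_xy (subst_xy P p) u v = eval_xy P (poly p u) (poly p v)"
  unfolding subst_xy_def eval_xy_def poly_pcompose poly_in_y
  by (induction P) (simp_all add: map_poly_pCons poly_pcompose)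

lemma vf_lift_vf:
  "vf (lift_vf p X) (u, v) =
     (poly (pderiv p) v * eval_xy (fst X) (poly p u) (poly p v),
      poly (pderiv p) u * eval_xy (snd X) (poly p u) (poly p v))"
  by (simp add: vf_def lift_vf_def eval_mult eval_in_x eval_in_y eval_subst_xy)

text \<open>
  \<open>Ck_on k f S\<close>: \<open>f\<close> is of class $C^k$ on the open set \<open>S\<close> of a
  finite-dimensional space, by iterated directional derivatives.
\<close>

fun Ck_on ::
  "nat \<Rightarrow> ('a::real_normed_vector \<Rightarrow> 'b::real_normed_vector) \<Rightarrow> 'a set \<Rightarrow> bool" where
  "Ck_on 0 f S \<longleftrightarrow> continuous_on S f"
| "Ck_on (Suc k) f S \<longleftrightarrow>
     (\<forall>x\<in>S. f differentiable (at x)) \<and>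
     (\<forall>v. Ck_on k (\<lambda>x. frechet_derivative f (at x) v) S)"

definition Ck_diffeo ::
  "nat \<Rightarrow> ('a::real_normed_vector \<Rightarrow> 'b::real_normed_vector) \<Rightarrow> 'a set \<Rightarrow> 'b set \<Rightarrow> bool"
where
  "Ck_diffeo k f S T \<longleftrightarrow>
     open S \<and> open T \<and> bij_betw f S T \<and> Ck_on k f S \<and> Ck_on k (the_inv_into S f) T"

definition smooth_diffeo ::
  "('a::real_normed_vector \<Rightarrow> 'b::real_normed_vector) \<Rightarrow> 'a set \<Rightarrow> 'b set \<Rightarrow> bool" where
  "smooth_diffeo f S T \<longleftrightarrow> (\<forall>k. Ck_diffeo k f S T)"

definition full_branch_interval :: "real poly \<Rightarrow> real set \<Rightarrow> bool" where
  "full_branch_interval p I \<longleftrightarrow> is_interval I \<and> Ck_diffeo 1 (poly p) I {-1<..<1}"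

text \<open>
  For nonconstant \<open>p\<close> the full branch intervals are disjoint and each contains a root
  of \<open>p\<close>, and a constant \<open>p\<close> has none, so the cardinality is that of a finite set.
\<close>

definition num_branches :: "real poly \<Rightarrow> nat" where
  "num_branches p = card {I. full_branch_interval p I}"

definition solution_on ::
  "(real \<times> real \<Rightarrow> real \<times> real) \<Rightarrow> (real \<Rightarrow> real \<times> real) \<Rightarrow> real set \<Rightarrow> bool" where
  "solution_on F \<phi> J \<longleftrightarrow>
     (\<forall>t\<in>J. (\<phi> has_vector_derivative F (\<phi> t)) (at t within J))"

text \<open>
  The orbit of \<open>z\<close> under \<open>F\<close> restricted to \<open>S\<close>. The union over all solutions through
  \<open>z\<close> that stay in \<open>S\<close> is the image of the maximal one.
\<close>

definition orbit_in ::
  "(real \<times> real \<Rightarrow> real \<times> real) \<Rightarrow> (real \<times> real) set \<Rightarrow> real \<times> real \<Rightarrow> (real \<times> real) set"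
where
  "orbit_in F S z =
     {\<phi> t | \<phi> t J. open J \<and> is_interval J \<and> 0 \<in> J \<and> t \<in> J \<and>
        solution_on F \<phi> J \<and> \<phi> ` J \<subseteq> S \<and> \<phi> 0 = z}"

definition periodic_orbit ::
  "(real \<times> real \<Rightarrow> real \<times> real) \<Rightarrow> (real \<times> real) set \<Rightarrow> bool" where
  "periodic_orbit F \<gamma> \<longleftrightarrow>
     (\<exists>\<phi> T. solution_on F \<phi> UNIV \<and> T > 0 \<and> (\<forall>t. \<phi> (t + T) = \<phi> t) \<and> \<gamma> = range \<phi>) \<and>
     (\<forall>z\<in>\<gamma>. F z \<noteq> 0)"

definition limit_cycle ::
  "(real \<times> real \<Rightarrow> real \<times> real) \<Rightarrow> (real \<times> real) set \<Rightarrow> bool" where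
  "limit_cycle F \<gamma> \<longleftrightarrow>
     periodic_orbit F \<gamma> \<and>
     (\<exists>U. open U \<and> \<gamma> \<subseteq> U \<and> (\<forall>\<gamma>'. periodic_orbit F \<gamma>' \<and> \<gamma>' \<subseteq> U \<longrightarrow> \<gamma>' = \<gamma>))"

definition num_limit_cycles :: "poly_vf \<Rightarrow> enat" where
  "num_limit_cycles X =
     (if finite {\<gamma>. limit_cycle (vf X) \<gamma>} then enat (card {\<gamma>. limit_cycle (vf X) \<gamma>}) else \<infinity>)"

definition hilbert_number :: "nat \<Rightarrow> enat" where
  "hilbert_number n = (SUP X\<in>{X. vf_degree X \<le> n}. num_limit_cycles X)"

text \<open>
  A section is an embedded open $C^1$ arc; the determinant says that its tangent vector and
  the field are linearly independent, so neither vanishes.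
\<close>

definition transverse_section ::
  "(real \<times> real \<Rightarrow> real \<times> real) \<Rightarrow> (real \<times> real) set \<Rightarrow> bool" where
  "transverse_section F \<Sigma> \<longleftrightarrow>
     (\<exists>\<sigma> \<sigma>' \<rho>. homeomorphism {-1<..<1} \<Sigma> \<sigma> \<rho> \<and>
        continuous_on {-1<..<1::real} \<sigma>' \<and>
        (\<forall>s\<in>{-1<..<1}. (\<sigma> has_vector_derivative \<sigma>' s) (at s) \<and>
           fst (\<sigma>' s) * snd (F (\<sigma> s)) - snd (\<sigma>' s) * fst (F (\<sigma> s)) \<noteq> 0))"

definition flows_to ::
  "(real \<times> real \<Rightarrow> real \<times> real) \<Rightarrow> real \<times> real \<Rightarrow> real \<Rightarrow> real \<times> real \<Rightarrow> bool" where
  "flows_to F z t w \<longleftrightarrow> 0 \<le> t \<and> (\<exists>\<phi>. solution_on F \<phi> {0..t} \<and> \<phi> 0 = z \<and> \<phi> t = w)"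

text \<open>
  \<open>f\<close> represents the germ at \<open>q\<close> of the return map of \<open>\<Sigma>\<close> along \<open>\<gamma>\<close>: a point \<open>z\<close> of
  \<open>\<Sigma>\<close> near \<open>q\<close> is moved forward by a continuous return time \<open>\<tau> z\<close>, where \<open>\<tau> q\<close> is the
  minimal period of \<open>\<gamma>\<close>. The values of \<open>f\<close> away from \<open>q\<close> are irrelevant.
\<close>

definition local_return_map ::
  "(real \<times> real \<Rightarrow> real \<times> real) \<Rightarrow> (real \<times> real) set \<Rightarrow> (real \<times> real) set \<Rightarrow> real \<times> real \<Rightarrow>
   (real \<times> real \<Rightarrow> real \<times> real) \<Rightarrow> bool" where
  "local_return_map F \<gamma> \<Sigma> q f \<longleftrightarrow>
     periodic_orbit F \<gamma> \<and> transverse_section F \<Sigma> \<and> q \<in> \<gamma> \<inter> \<Sigma> \<and>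
     (\<exists>S \<tau>. openin (top_of_set \<Sigma>) S \<and> q \<in> S \<and> continuous_on S \<tau> \<and>
        f q = q \<and> (\<forall>t. 0 < t \<and> t < \<tau> q \<longrightarrow> \<not> flows_to F q t q) \<and>
        (\<forall>z\<in>S. \<tau> z > 0 \<and> f z \<in> \<Sigma> \<and> flows_to F z (\<tau> z) (f z)))"

definition eventually_near :: "'a::topological_space set \<Rightarrow> 'a \<Rightarrow> ('a \<Rightarrow> bool) \<Rightarrow> bool" where
  "eventually_near \<Sigma> q P \<longleftrightarrow> (\<forall>\<^sub>F z in inf (nhds q) (principal \<Sigma>). P z)"

text \<open>Conjugacy by \<open>h\<close> of the germ of \<open>f\<close> at \<open>q\<close> with the germ of \<open>g\<close> at \<open>h q\<close>.\<close>

definition germ_conjugate ::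
  "(real \<times> real \<Rightarrow> real \<times> real) \<Rightarrow> (real \<times> real) set \<Rightarrow> real \<times> real \<Rightarrow>
   (real \<times> real \<Rightarrow> real \<times> real) \<Rightarrow> (real \<times> real \<Rightarrow> real \<times> real) \<Rightarrow> bool" where
  "germ_conjugate h \<Sigma> q f g \<longleftrightarrow> eventually_near \<Sigma> q (\<lambda>z. h (f z) = g (h z))"

text \<open>
  Conjugacy by \<open>h\<close> of the germ of \<open>f\<close> at \<open>q\<close> with the inverse of the germ of \<open>g\<close> at \<open>h q\<close>,
  where \<open>h\<close> is injective on \<open>R \<supseteq> \<Sigma>\<close>: the germs of $h \circ f \circ h^{-1}$ and \<open>g\<close> are
  inverse to each other.
\<close>

definition germ_conjugate_inverse ::
  "(real \<times> real \<Rightarrow> real \<times> real) \<Rightarrow> (real \<times> real) set \<Rightarrow> (real \<times> real) set \<Rightarrow> real \<times> real \<Rightarrow>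
   (real \<times> real \<Rightarrow> real \<times> real) \<Rightarrow> (real \<times> real \<Rightarrow> real \<times> real) \<Rightarrow> bool" where
  "germ_conjugate_inverse h R \<Sigma> q f g \<longleftrightarrow>
     (let k = h \<circ> f \<circ> the_inv_into R h in
        eventually_near (h ` \<Sigma>) (h q) (\<lambda>w. g (k w) = w \<and> k (g w) = w))"

end

theory Submission
  imports Defs
begin

text \<open>
  On a rectangle \<open>R\<close> of branches the map $\Phi$ carries \<open>Y\<close> to a nonvanishing multiple of \<open>X\<close>, so
  solutions correspond after the time change $\theta(t) = \int_0^t s$ along the orbit; when the factor
  \<open>s\<close> is negative, \<open>Y\<close> is replaced by \<open>-Y\<close>. Periodic orbits, their isolation and transverse
  sections are thereby transported. For return maps the transported return time has to be
  continuous, which follows from continuous dependence of solutions on the initial point (a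
  Gronwall estimate). Germs of return maps are unique because a transverse section cannot be met
  twice within a short time; the same fact makes a return map locally injective, hence locally
  invertible on the arc, which handles reversed time. For the bound on Hilbert numbers, \<open>p\<close> is
  scaled so that its branches cover a square containing any given finite set of limit cycles.
\<close>

section \<open>Solutions of planar vector fields\<close>

text \<open>Polynomial fields are Lipschitz on balls only, so every estimate has to keep solutions
  inside a ball. No existence theorem for solutions is invoked: solutions come with orbits, periodic
  orbits and return maps, and are transported; what has to be proved is comparison. Return times
  differ from point to point, so orbit segments are rescaled to the unit interval and the time
  becomes a factor \<open>c\<close> of the field. One estimate for \<open>c *\<^sub>R F\<close>,
  with both \<open>c\<close> and the initial point varying, then yields uniqueness, continuity of
  return maps, smallness of short segments and joint continuity of a family of segments.

  The relation between the two fields is set up symmetrically, with the inverse map, its derivative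
  and the reciprocal factor on the other side, so each transport is argued in one direction and the
  converse is an instance. Time reversal is harmless for orbits, periodic orbits and sections; a
  return map, however, turns into its inverse, and it has to be shown that this inverse is defined
  on a whole neighbourhood of the base point in the section and has a continuous return
  time.\<close>

definition lipschitz_on_balls :: "('a::real_normed_vector \<Rightarrow> 'b::real_normed_vector) \<Rightarrow> bool" where
  "lipschitz_on_balls F \<longleftrightarrow> (\<forall>r. \<exists>L. L-lipschitz_on (cball 0 r) F)"

lemma lipschitz_on_balls_continuous:
  assumes "lipschitz_on_balls F"
  shows "continuous_on S F"
proof -
  have "isCont F x" for x
  proof -
    obtain L where "L-lipschitz_on (cball 0 (norm x + 1)) F"
      using assms unfolding lipschitz_on_balls_def by blast
    then have "continuous_on (cball 0 (norm x + 1)) F"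
      by (rule lipschitz_on_continuous_on)
    moreover have "x \<in> interior (cball 0 (norm x + 1))"
      by (rule interiorI[of "ball 0 (norm x + 1)"]) auto
    ultimately show ?thesis
      by (rule continuous_on_interior)
  qed
  then show ?thesis
    by (simp add: continuous_at_imp_continuous_on)
qed

lemma lipschitz_on_balls_minus:
  "lipschitz_on_balls F \<Longrightarrow> lipschitz_on_balls (\<lambda>z. - F z)"
  unfolding lipschitz_on_balls_def lipschitz_on_def by (simp add: dist_minus)

lemma solution_on_subset:
  "solution_on F \<phi> J \<Longrightarrow> J' \<subseteq> J \<Longrightarrow> solution_on F \<phi> J'"
  unfolding solution_on_def by (meson has_vector_derivative_within_subset subsetD)

lemma solution_on_continuous:
  "solution_on F \<phi> J \<Longrightarrow> continuous_on J \<phi>"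
  unfolding solution_on_def
  by (meson continuous_on_eq_continuous_within has_vector_derivative_continuous)

text \<open>Covers the three time changes in use: shifts (\<open>c = 1\<close>), reversal
  (\<open>c = -1\<close>) and rescaling to unit time (\<open>a = 0\<close>).\<close>

lemma solution_on_affine:
  assumes "solution_on F \<phi> J" "\<And>r. r \<in> J' \<Longrightarrow> a + c * r \<in> J"
  shows "solution_on (\<lambda>z. c *\<^sub>R F z) (\<lambda>r. \<phi> (a + c * r)) J'"
  unfolding solution_on_def
proof
  fix r assume r: "r \<in> J'"
  have "((\<lambda>r. a + c * r) has_vector_derivative c) (at r within J')"
    by (auto intro!: derivative_eq_intros simp flip: has_real_derivative_iff_has_vector_derivative)
  moreover have "(\<phi> has_vector_derivative F (\<phi> (a + c * r))) (at (a + c * r) within (\<lambda>r. a + c * r) ` J')"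
    using assms r by (auto simp: solution_on_def intro: has_vector_derivative_within_subset)
  ultimately show "((\<lambda>r. \<phi> (a + c * r)) has_vector_derivative c *\<^sub>R F (\<phi> (a + c * r))) (at r within J')"
    using vector_diff_chain_within[of "\<lambda>r. a + c * r" c r J' \<phi>] by (simp add: o_def)
qed

section \<open>Continuous dependence on the initial point and on the speed\<close>

lemma nonincreasing_on_interval:
  fixes v :: "real \<Rightarrow> real"
  assumes "a \<le> b" "continuous_on {a..b} v"
    and "\<And>r. a < r \<Longrightarrow> r < b \<Longrightarrow> \<exists>d. (v has_real_derivative d) (at r) \<and> d \<le> 0"
  shows "v b \<le> v a"
proof (cases "a = b")
  case False
  then have "a < b" using assms by simp
  then obtain l z where z: "a < z" "z < b" "DERIV v z :> l" "v b - v a = (b - a) * l"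
    using MVT[of a b v] assms by (metis real_differentiable_def)
  then have "l \<le> 0"
    using assms(3) DERIV_unique by blast
  with z(4) \<open>a < b\<close> show ?thesis
    by (smt (verit) mult_nonneg_nonpos)
qed simp

text \<open>The squared distance \<open>u\<close> satisfies u' \<le> A u + K as long as both
  solutions lie in a ball on which \<open>F\<close> is Lipschitz. Since membership in the ball is
  only guaranteed while the distance is below \<epsilon>, the estimate is run up to the first time
  at which the distance reaches \<epsilon> and contradicts it there.\<close>

lemma solutions_stay_close:
  fixes F :: "real \<times> real \<Rightarrow> real \<times> real"
  assumes lip: "lipschitz_on_balls F"
    and sol0: "solution_on (\<lambda>z. c0 *\<^sub>R F z) \<phi>0 {0..1}"
    and "\<epsilon> > 0"
  obtains d where "d > 0"
    and "\<And>c \<phi> r. \<bar>c - c0\<bar> < d \<Longrightarrow> dist (\<phi> 0) (\<phi>0 0) < d \<Longrightarrow>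
           solution_on (\<lambda>z. c *\<^sub>R F z) \<phi> {0..1} \<Longrightarrow> r \<in> {0..1} \<Longrightarrow> dist (\<phi> r) (\<phi>0 r) < \<epsilon>"
proof -
  have cont0: "continuous_on {0..1} \<phi>0"
    using sol0 by (rule solution_on_continuous)
  obtain b where b: "\<And>r. r \<in> {0..1} \<Longrightarrow> norm (\<phi>0 r) \<le> b"
    using compact_imp_bounded[OF compact_continuous_image[OF cont0 compact_Icc]]
    unfolding bounded_iff ball_simps by blast
  \<comment> \<open>Contains the reference solution and every point closer than \<epsilon> to
    it.\<close>
  define B where "B = cball (0 :: real \<times> real) (b + \<epsilon>)"
  obtain L where L: "L-lipschitz_on B F"
    using lip unfolding lipschitz_on_balls_def B_def by blast
  then have L0: "L \<ge> 0"
    by (rule lipschitz_on_nonneg)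
  have "bounded (F ` B)"
    unfolding B_def
    by (intro compact_imp_bounded compact_continuous_image lipschitz_on_balls_continuous lip compact_cball)
  then obtain M where M: "\<And>z. z \<in> B \<Longrightarrow> norm (F z) \<le> M"
    by (auto simp: bounded_iff)
  \<comment> \<open>The term with \<open>L\<close> is the Lipschitz contribution, with |c| \<le>
    |c0| + 1 because the tolerance \<open>d\<close> is at most 1. The summand 1 comes from splitting
    the mixed product by 2 x y \<le> x^2 + y^2, and it also gives K \<le> A K.\<close>
  define A where "A = 2 * (\<bar>c0\<bar> + 1) * L + 1"
  have A1: "A \<ge> 1"
    using L0 unfolding A_def by simp
  \<comment> \<open>The final bound on the squared distance is exp(A) (d^2 + d^2 M^2) = N d^2, and
    \<open>d\<close> is chosen to make this smaller than the square of \<epsilon>.\<close>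
  define N where "N = exp A * (1 + M\<^sup>2)"
  have N1: "N \<ge> 1"
    using mult_mono[of 1 "exp A" 1 "1 + M\<^sup>2"] A1 unfolding N_def by simp
  define d where "d = min 1 (\<epsilon> / (2 * N))"
  have d0: "d > 0" "d \<le> 1"
    using \<open>\<epsilon> > 0\<close> N1 unfolding d_def by auto
  have Nd: "N * d\<^sup>2 < \<epsilon>\<^sup>2"
  proof -
    have "d\<^sup>2 \<le> (\<epsilon> / (2 * N))\<^sup>2"
      using d0 by (intro power_mono) (auto simp: d_def)
    then have "N * d\<^sup>2 \<le> N * (\<epsilon> / (2 * N))\<^sup>2"
      using N1 by simp
    also have "\<dots> = \<epsilon>\<^sup>2 / (4 * N)"
      using N1 by (simp add: power2_eq_square field_simps)
    also have "\<dots> < \<epsilon>\<^sup>2"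
      using N1 \<open>\<epsilon> > 0\<close> by (simp add: field_simps)
    finally show ?thesis .
  qed
  have "dist (\<phi> r) (\<phi>0 r) < \<epsilon>"
    if c: "\<bar>c - c0\<bar> < d" and init: "dist (\<phi> 0) (\<phi>0 0) < d"
      and sol: "solution_on (\<lambda>z. c *\<^sub>R F z) \<phi> {0..1}" and "r \<in> {0..1}" for c \<phi> r
  proof (rule ccontr)
    assume far: "\<not> dist (\<phi> r) (\<phi>0 r) < \<epsilon>"
    have cont: "continuous_on {0..1} \<phi>"
      using sol by (rule solution_on_continuous)
    define D where "D = {r \<in> {0..1}. \<epsilon> \<le> dist (\<phi> r) (\<phi>0 r)}"
    have "closed D"
      unfolding D_def
      by (rule continuous_on_closed_Collect_le) (auto intro!: continuous_intros cont cont0)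
    moreover have "D \<noteq> {}"
      using far \<open>r \<in> {0..1}\<close> by (auto simp: D_def)
    moreover have bd: "bdd_below D"
      by (auto simp: D_def intro!: bdd_belowI[of _ 0])
    ultimately have "Inf D \<in> D"
      by (intro closed_contains_Inf)
    \<comment> \<open>The first time at distance at least \<epsilon>; before it both solutions lie
      in \<open>B\<close>.\<close>
    define e where "e = Inf D"
    have e: "e \<in> {0..1}" "\<epsilon> \<le> dist (\<phi> e) (\<phi>0 e)"
      using \<open>Inf D \<in> D\<close> by (auto simp: D_def e_def)
    have before: "dist (\<phi> t) (\<phi>0 t) < \<epsilon>" if "0 \<le> t" "t < e" for t
    proof (rule ccontr)
      assume "\<not> ?thesis"
      then have "t \<in> D"
        using that e by (auto simp: D_def)
      then show False
        using cInf_lower[OF _ bd] that by (force simp: e_def)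
    qed
    \<comment> \<open>The square of the error made by changing the speed. Adding it to
      \<open>u\<close> makes the differential inequality homogeneous, so that the exponential weight
      in \<open>v\<close> yields a nonincreasing function.\<close>
    define K where "K = (c - c0)\<^sup>2 * M\<^sup>2"
    define u where "u t = (\<phi> t - \<phi>0 t) \<bullet> (\<phi> t - \<phi>0 t)" for t
    define v where "v t = (u t + K) * exp (- A * t)" for t
    have "v e \<le> v 0"
    proof (rule nonincreasing_on_interval[of 0 e v])
      show "0 \<le> e" using e by simp
      show "continuous_on {0..e} v"
        unfolding v_def[abs_def] u_def[abs_def] using e
        by (intro continuous_intros continuous_on_subset[OF cont] continuous_on_subset[OF cont0]) auto
    next
      fix t assume t: "0 < t" "t < e"
      then have t01: "t \<in> {0<..<1}" using e by simp
      have at: "at t within {0..1} = at t"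
        by (rule at_within_interior) (use t01 in simp)
      have d1: "(\<phi> has_vector_derivative c *\<^sub>R F (\<phi> t)) (at t)"
        using sol t01 unfolding solution_on_def at[symmetric] by auto
      have d2: "(\<phi>0 has_vector_derivative c0 *\<^sub>R F (\<phi>0 t)) (at t)"
        using sol0 t01 unfolding solution_on_def at[symmetric] by auto
      define w where "w = \<phi> t - \<phi>0 t"
      define w' where "w' = c *\<^sub>R F (\<phi> t) - c0 *\<^sub>R F (\<phi>0 t)"
      have dw: "((\<lambda>t. \<phi> t - \<phi>0 t) has_vector_derivative w') (at t)"
        unfolding w'_def by (intro derivative_intros d1 d2)
      have "(u has_derivative (\<lambda>x. w \<bullet> (x *\<^sub>R w') + (x *\<^sub>R w') \<bullet> w)) (at t)"
        unfolding u_def[abs_def] w_def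
        by (rule has_derivative_inner) (rule dw[unfolded has_vector_derivative_def])+
      then have du: "(u has_real_derivative 2 * (w \<bullet> w')) (at t)"
        unfolding has_field_derivative_def
        by (rule has_derivative_eq_rhs) (auto simp: inner_commute fun_eq_iff)
      have dv: "(v has_real_derivative 2 * (w \<bullet> w') * exp (- A * t) + (u t + K) * (exp (- A * t) * (- A))) (at t)"
        unfolding v_def[abs_def] by (auto intro!: derivative_eq_intros du)
      have wlt: "norm w < \<epsilon>"
        using before[of t] t by (simp add: w_def dist_norm)
      have nb: "norm (\<phi>0 t) \<le> b" using b t01 by auto
      have inB: "\<phi> t \<in> B" "\<phi>0 t \<in> B"
        using nb wlt \<open>\<epsilon> > 0\<close> norm_triangle_ineq[of "\<phi>0 t" w] by (auto simp: B_def w_def)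
      have lipw: "norm (F (\<phi> t) - F (\<phi>0 t)) \<le> L * norm w"
        using lipschitz_onD[OF L inB] by (simp add: dist_norm w_def)
      have w': "w' = c *\<^sub>R (F (\<phi> t) - F (\<phi>0 t)) + (c - c0) *\<^sub>R F (\<phi>0 t)"
        by (simp add: w'_def algebra_simps)
      have "w \<bullet> w' \<le> norm w * norm w'"
        by (rule norm_cauchy_schwarz)
      also have "norm w' \<le> \<bar>c\<bar> * (L * norm w) + \<bar>c - c0\<bar> * M"
        unfolding w'
        by (rule order_trans[OF norm_triangle_ineq])
           (auto intro!: add_mono mult_left_mono lipw M inB)
      also have "\<bar>c\<bar> * (L * norm w) \<le> (\<bar>c0\<bar> + 1) * (L * norm w)"
        using c d0 L0 by (intro mult_right_mono) auto
      finally have "w \<bullet> w' \<le> norm w * ((\<bar>c0\<bar> + 1) * (L * norm w) + \<bar>c - c0\<bar> * M)"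
        by (simp add: mult_left_mono)
      then have "2 * (w \<bullet> w') \<le> 2 * (\<bar>c0\<bar> + 1) * L * (norm w)\<^sup>2 + 2 * norm w * (\<bar>c - c0\<bar> * M)"
        by (simp add: power2_eq_square algebra_simps)
      also have "2 * norm w * (\<bar>c - c0\<bar> * M) \<le> (norm w)\<^sup>2 + (\<bar>c - c0\<bar> * M)\<^sup>2"
        by (rule sum_squares_bound)
      also have "(\<bar>c - c0\<bar> * M)\<^sup>2 = K"
        by (simp add: K_def power_mult_distrib)
      finally have ineq: "2 * (w \<bullet> w') \<le> A * u t + K"
        by (simp add: A_def u_def w_def[symmetric] algebra_simps dot_square_norm)
      also have "A * u t + K \<le> A * (u t + K)"
        using A1 mult_right_mono[of 1 A K] by (simp add: K_def algebra_simps)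
      finally have "exp (- A * t) * (2 * (w \<bullet> w') - A * (u t + K)) \<le> 0"
        by (intro mult_nonneg_nonpos) auto
      with dv show "\<exists>d. (v has_real_derivative d) (at t) \<and> d \<le> 0"
        by (intro exI[of _ "2 * (w \<bullet> w') * exp (- A * t) + (u t + K) * (exp (- A * t) * (- A))"])
           (auto simp: algebra_simps)
    qed
    then have "u e + K \<le> exp (A * e) * (u 0 + K)"
      by (simp add: v_def exp_minus field_simps)
    also have "\<dots> \<le> exp A * (u 0 + K)"
      using e A1 by (intro mult_right_mono) (auto simp: u_def K_def)
    also have "\<dots> \<le> exp A * (d\<^sup>2 + d\<^sup>2 * M\<^sup>2)"
    proof -
      have "u 0 \<le> d\<^sup>2"
        using init by (auto simp: u_def dot_square_norm dist_norm intro!: power_mono)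
      moreover have "(c - c0)\<^sup>2 \<le> d\<^sup>2"
        using c by (metis abs_ge_zero less_imp_le power2_abs power_mono)
      ultimately show ?thesis
        by (intro mult_left_mono add_mono) (auto simp: K_def intro!: mult_right_mono)
    qed
    also have "\<dots> = N * d\<^sup>2"
      by (simp add: N_def algebra_simps)
    also have "\<dots> < \<epsilon>\<^sup>2"
      by (rule Nd)
    finally have "u e + K < \<epsilon>\<^sup>2" .
    moreover have "K \<ge> 0"
      by (simp add: K_def)
    ultimately have "u e < \<epsilon>\<^sup>2"
      by simp
    then have "(dist (\<phi> e) (\<phi>0 e))\<^sup>2 < \<epsilon>\<^sup>2"
      by (simp add: u_def dot_square_norm dist_norm)
    then show False
      using e(2) \<open>\<epsilon> > 0\<close> by (meson power_mono less_imp_le not_less)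
  qed
  with d0 show thesis
    by (intro that[of d]) auto
qed

lemma solution_on_rescale:
  assumes "solution_on F \<phi> {0..t}" "0 \<le> t"
  shows "solution_on (\<lambda>z. t *\<^sub>R F z) (\<lambda>r. \<phi> (t * r)) {0..1}"
  using solution_on_affine[OF assms(1), of "{0..1}" 0 t] assms(2)
  by (simp add: mult_left_le)

text \<open>Continuous dependence with equal speeds and equal initial points bounds the distance by
  every positive \<epsilon>. Passing to unit time divides by \<open>t\<close>, which is why
  \<open>t = 0\<close> stands apart.\<close>

lemma solution_on_unique:
  fixes F :: "real \<times> real \<Rightarrow> real \<times> real"
  assumes "lipschitz_on_balls F" "solution_on F \<phi> {0..t}" "solution_on F \<psi> {0..t}"
    and "\<phi> 0 = \<psi> 0" "r \<in> {0..t}"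
  shows "\<phi> r = \<psi> r"
proof (cases "t = 0")
  case False
  with assms have t: "t > 0" by simp
  have "dist (\<phi> (t * (r / t))) (\<psi> (t * (r / t))) < \<epsilon>" if \<epsilon>: "\<epsilon> > 0" for \<epsilon>
  proof -
    obtain d where d: "d > 0"
      "\<And>c \<phi> r. \<bar>c - t\<bar> < d \<Longrightarrow> dist (\<phi> 0) (\<psi> (t * 0)) < d \<Longrightarrow>
         solution_on (\<lambda>z. c *\<^sub>R F z) \<phi> {0..1} \<Longrightarrow> r \<in> {0..1} \<Longrightarrow> dist (\<phi> r) (\<psi> (t * r)) < \<epsilon>"
      using solutions_stay_close[OF assms(1) solution_on_rescale[OF assms(3)] \<epsilon>] t by auto
    show ?thesis
      by (rule d(2)[of t "\<lambda>r. \<phi> (t * r)"])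
         (use d(1) t assms(4,5) solution_on_rescale[OF assms(2)] in auto)
  qed
  then have "\<phi> (t * (r / t)) = \<psi> (t * (r / t))"
    using zero_less_dist_iff less_irrefl by blast
  then show ?thesis
    using t by simp
qed (use assms in auto)

section \<open>Flow segments: splitting, reversing, cancelling\<close>

lemma flows_to_rescale:
  assumes "flows_to F z t w"
  obtains \<psi> where "solution_on (\<lambda>z. t *\<^sub>R F z) \<psi> {0..1}" "\<psi> 0 = z" "\<psi> 1 = w"
proof -
  from assms obtain \<phi> where "0 \<le> t" "solution_on F \<phi> {0..t}" "\<phi> 0 = z" "\<phi> t = w"
    unfolding flows_to_def by blast
  then show thesis
    by (intro that[of "\<lambda>r. \<phi> (t * r)"] solution_on_rescale) auto
qed

lemma flows_to_unique:
  assumes "lipschitz_on_balls F" "flows_to F z t w1" "flows_to F z t w2"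
  shows "w1 = w2"
proof -
  obtain \<phi> \<psi> where "0 \<le> t" "solution_on F \<phi> {0..t}" "\<phi> 0 = z" "\<phi> t = w1"
      "solution_on F \<psi> {0..t}" "\<psi> 0 = z" "\<psi> t = w2"
    using assms(2,3) unfolding flows_to_def by blast
  then show ?thesis
    using solution_on_unique[OF assms(1), of \<phi> t \<psi> t] by simp
qed

text \<open>By uniqueness the long solution passes through \<open>u\<close> at time
  \<open>a\<close>, so its tail is a solution from \<open>u\<close> to \<open>w\<close>.\<close>

lemma flows_to_split:
  assumes lip: "lipschitz_on_balls F"
    and "flows_to F z (a + b) w" "flows_to F z a u" "0 \<le> b"
  shows "flows_to F u b w"
proof -
  obtain \<phi> where \<phi>: "solution_on F \<phi> {0..a + b}" "\<phi> 0 = z" "\<phi> (a + b) = w"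
    using assms(2) unfolding flows_to_def by blast
  have "0 \<le> a"
    using assms(3) unfolding flows_to_def by blast
  then have "flows_to F z a (\<phi> a)"
    using \<phi> \<open>0 \<le> b\<close> solution_on_subset[OF \<phi>(1), of "{0..a}"] unfolding flows_to_def by auto
  then have "\<phi> a = u"
    using flows_to_unique[OF lip] assms(3) by blast
  moreover have "solution_on F (\<lambda>r. \<phi> (a + r)) {0..b}"
    using solution_on_affine[OF \<phi>(1), of "{0..b}" a 1] \<open>0 \<le> a\<close> by simp
  ultimately show ?thesis
    using \<phi> \<open>0 \<le> b\<close> unfolding flows_to_def by (intro conjI exI[of _ "\<lambda>r. \<phi> (a + r)"]) auto
qed

lemma flows_to_reverse:
  assumes "flows_to F z t w"
  shows "flows_to (\<lambda>z. - F z) w t z"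
proof -
  obtain \<phi> where \<phi>: "0 \<le> t" "solution_on F \<phi> {0..t}" "\<phi> 0 = z" "\<phi> t = w"
    using assms unfolding flows_to_def by blast
  have "solution_on (\<lambda>z. - F z) (\<lambda>r. \<phi> (t - r)) {0..t}"
    using solution_on_affine[OF \<phi>(2), of "{0..t}" t "-1"] by simp
  then show ?thesis
    using \<phi> unfolding flows_to_def by (intro conjI exI[of _ "\<lambda>r. \<phi> (t - r)"]) auto
qed

text \<open>In reversed time the common end point becomes a common initial point, where segments can
  be split. This is the source of injectivity of return maps.\<close>

lemma flows_to_cancel:
  assumes "lipschitz_on_balls F" "flows_to F z1 t1 w" "flows_to F z2 t2 w" "t2 \<le> t1"
  shows "flows_to F z1 (t1 - t2) z2"
proof -
  have "flows_to (\<lambda>z. - F z) z2 (t1 - t2) z1"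
    using flows_to_split[OF lipschitz_on_balls_minus[OF assms(1)], of w t2 "t1 - t2" z1 z2]
      flows_to_reverse[OF assms(2)] flows_to_reverse[OF assms(3)] assms(4) by simp
  from flows_to_reverse[OF this] show ?thesis
    by simp
qed

text \<open>Stated without an order between \<open>a\<close> and \<open>b\<close>, since the
  parameters of two points of a section come in no particular order.\<close>

lemma mvt_on_ball:
  fixes f f' :: "real \<Rightarrow> real"
  assumes "\<And>x. x \<in> ball c r \<Longrightarrow> (f has_real_derivative f' x) (at x)" "a \<in> ball c r" "b \<in> ball c r"
  shows "\<exists>x\<in>ball c r. f b - f a = (b - a) * f' x"
proof -
  have *: "\<exists>x\<in>ball c r. f b - f a = (b - a) * f' x" if "a < b" "a \<in> ball c r" "b \<in> ball c r" for a b
  proof -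
    have "x \<in> ball c r" if "a \<le> x" "x \<le> b" for x
      using that \<open>a \<in> ball c r\<close> \<open>b \<in> ball c r\<close> by (auto simp: dist_real_def)
    then show ?thesis
      using MVT2[of a b f f'] \<open>a < b\<close> assms(1) by (meson less_imp_le)
  qed
  show ?thesis
  proof (cases a b rule: linorder_cases)
    case greater
    then obtain x where "x \<in> ball c r" "f a - f b = (a - b) * f' x"
      using * assms by blast
    then show ?thesis
      by (intro bexI[of _ x]) (auto simp: algebra_simps)
  qed (use * assms in auto)
qed

lemma has_vector_derivative_components:
  fixes f :: "real \<Rightarrow> real \<times> real"
  assumes "(f has_vector_derivative d) F"
  shows "((\<lambda>x. fst (f x)) has_real_derivative fst d) F"
    and "((\<lambda>x. snd (f x)) has_real_derivative snd d) F"
  using has_derivative_fst[OF assms[unfolded has_vector_derivative_def]]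
    has_derivative_snd[OF assms[unfolded has_vector_derivative_def]]
  by (simp_all add: has_field_derivative_def mult_commute_abs)

text \<open>
  Two nearby points of the section joined by a short orbit segment would give, by the mean value
  theorem, a direction of the field that is parallel to a tangent direction of the section.
\<close>

lemma transverse_section_no_quick_return:
  fixes F :: "real \<times> real \<Rightarrow> real \<times> real"
  assumes lip: "lipschitz_on_balls F" and "transverse_section F \<Sigma>" and "q \<in> \<Sigma>"
  obtains e where "e > 0"
    and "\<And>z w t. z \<in> \<Sigma> \<Longrightarrow> w \<in> \<Sigma> \<Longrightarrow> dist z q < e \<Longrightarrow> dist w q < e \<Longrightarrow> t < e \<Longrightarrow>
           flows_to F z t w \<Longrightarrow> z = w"
proof -
  obtain \<sigma> \<sigma>' \<rho> where hom: "homeomorphism {-1<..<1} \<Sigma> \<sigma> \<rho>"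
    and cont': "continuous_on {-1<..<1::real} \<sigma>'"
    and der: "\<And>s. s \<in> {-1<..<1} \<Longrightarrow> (\<sigma> has_vector_derivative \<sigma>' s) (at s)"
    and det: "\<And>s. s \<in> {-1<..<1} \<Longrightarrow> fst (\<sigma>' s) * snd (F (\<sigma> s)) - snd (\<sigma>' s) * fst (F (\<sigma> s)) \<noteq> 0"
    using assms(2) unfolding transverse_section_def by blast
  have contF: "continuous_on S F" for S
    using lip by (rule lipschitz_on_balls_continuous)
  define s0 where "s0 = \<rho> q"
  have s0: "s0 \<in> {-1<..<1}" "\<sigma> s0 = q"
    using hom \<open>q \<in> \<Sigma>\<close> by (auto simp: homeomorphism_def s0_def)
  \<comment> \<open>The transversality determinant with its four entries evaluated at independent
    arguments: the mean value theorem is applied to each component separately and produces a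
    different intermediate point each time. Being continuous and nonzero at the diagonal point over
    \<open>q\<close>, it is nonzero for all arguments nearby.\<close>
  define D where "D x = fst (\<sigma>' (fst (snd (snd x)))) * snd (F (fst (snd x))) -
      snd (\<sigma>' (snd (snd (snd x)))) * fst (F (fst x))" for x
  define W where "W = (UNIV :: (real \<times> real) set) \<times> (UNIV :: (real \<times> real) set) \<times>
      {-1<..<1::real} \<times> {-1<..<1::real}"
  have "continuous_on W D"
    unfolding D_def[abs_def] W_def
    by (intro continuous_intros continuous_on_compose2[OF cont'] continuous_on_compose2[OF contF[of UNIV]]) auto
  moreover have "open W"
    unfolding W_def by (intro open_Times) auto
  ultimately have "open (W \<inter> D -` (- {0}))"
    by (intro continuous_open_preimage) auto
  moreover have "(q, q, s0, s0) \<in> W \<inter> D -` (- {0})"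
    using det[OF s0(1)] s0 by (auto simp: D_def W_def)
  ultimately obtain A1 A' where 1: "open A1" "open A'" "(q, q, s0, s0) \<in> A1 \<times> A'"
      "A1 \<times> A' \<subseteq> W \<inter> D -` (- {0})"
    by (rule open_prod_elim)
  then have "(q, s0, s0) \<in> A'" by simp
  with 1(2) obtain A2 A'' where 2: "open A2" "open A''" "(q, s0, s0) \<in> A2 \<times> A''" "A2 \<times> A'' \<subseteq> A'"
    by (rule open_prod_elim)
  then have "(s0, s0) \<in> A''" by simp
  with 2(2) obtain A3 A4 where 3: "open A3" "open A4" "(s0, s0) \<in> A3 \<times> A4" "A3 \<times> A4 \<subseteq> A''"
    by (rule open_prod_elim)
  have "open (A1 \<inter> A2)" "q \<in> A1 \<inter> A2" "open (A3 \<inter> A4)" "s0 \<in> A3 \<inter> A4"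
    using 1 2 3 by auto
  then obtain \<epsilon>1 \<epsilon>2 where \<epsilon>: "\<epsilon>1 > 0" "ball q \<epsilon>1 \<subseteq> A1 \<inter> A2" "\<epsilon>2 > 0" "ball s0 \<epsilon>2 \<subseteq> A3 \<inter> A4"
    using openE by metis
  have nz: "D (z1, z2, s1, s2) \<noteq> 0" and s1_dom: "s1 \<in> {-1<..<1}"
    if "z1 \<in> ball q \<epsilon>1" "z2 \<in> ball q \<epsilon>1" "s1 \<in> ball s0 \<epsilon>2" "s2 \<in> ball s0 \<epsilon>2" for z1 z2 s1 s2
  proof -
    have mem: "z1 \<in> A1" "z2 \<in> A2" "s1 \<in> A3" "s2 \<in> A4"
      using subsetD[OF \<epsilon>(2) that(1)] subsetD[OF \<epsilon>(2) that(2)]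
        subsetD[OF \<epsilon>(4) that(3)] subsetD[OF \<epsilon>(4) that(4)] by auto
    have "(s1, s2) \<in> A''"
      by (rule subsetD[OF 3(4)]) (use mem in simp)
    then have "(z2, s1, s2) \<in> A'"
      by (intro subsetD[OF 2(4)]) (use mem in simp)
    then have "(z1, z2, s1, s2) \<in> W \<inter> D -` (- {0})"
      by (intro subsetD[OF 1(4)]) (use mem in simp)
    then show "D (z1, z2, s1, s2) \<noteq> 0" "s1 \<in> {-1<..<1}"
      by (auto simp: W_def)
  qed
  have "continuous_on \<Sigma> \<rho>"
    using hom by (simp add: homeomorphism_def)
  then obtain d1 where d1: "d1 > 0" "\<And>z. z \<in> \<Sigma> \<Longrightarrow> dist z q < d1 \<Longrightarrow> \<rho> z \<in> ball s0 \<epsilon>2"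
    using \<open>q \<in> \<Sigma>\<close> \<open>\<epsilon>2 > 0\<close> unfolding continuous_on_iff s0_def mem_ball dist_commute[of "\<rho> q"] by blast
  \<comment> \<open>The resting solution at speed 0. Closeness to it says that orbit segments of
    short duration starting near \<open>q\<close> remain near \<open>q\<close>.\<close>
  have "solution_on (\<lambda>z. 0 *\<^sub>R F z) (\<lambda>_. q) {0..1}"
    by (simp add: solution_on_def)
  then obtain d2 where d2: "d2 > 0"
    "\<And>c \<phi> r. \<bar>c - 0\<bar> < d2 \<Longrightarrow> dist (\<phi> 0) q < d2 \<Longrightarrow> solution_on (\<lambda>z. c *\<^sub>R F z) \<phi> {0..1} \<Longrightarrow>
       r \<in> {0..1} \<Longrightarrow> dist (\<phi> r) q < \<epsilon>1"
    by (rule solutions_stay_close[OF lip _ \<open>\<epsilon>1 > 0\<close>]) blast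
  show thesis
  proof (rule that[of "min d1 d2"])
    show "min d1 d2 > 0"
      using d1 d2 by simp
    fix z w t
    assume zw: "z \<in> \<Sigma>" "w \<in> \<Sigma>" "dist z q < min d1 d2" "dist w q < min d1 d2" "t < min d1 d2"
      and fl: "flows_to F z t w"
    have "0 \<le> t"
      using fl by (simp add: flows_to_def)
    show "z = w"
    proof (cases "t = 0")
      case True
      with fl show ?thesis
        by (auto simp: flows_to_def)
    next
      case False
      obtain \<psi> where \<psi>: "solution_on (\<lambda>z. t *\<^sub>R F z) \<psi> {0..1}" "\<psi> 0 = z" "\<psi> 1 = w"
        using fl by (rule flows_to_rescale)
      have near: "\<psi> r \<in> ball q \<epsilon>1" if "r \<in> {0..1}" for r
        using d2(2)[of t \<psi> r] \<psi> zw \<open>0 \<le> t\<close> that by (auto simp: dist_commute)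
      have d\<psi>: "(\<psi> has_vector_derivative t *\<^sub>R F (\<psi> r)) (at r within {0..1})" if "r \<in> {0..1}" for r
        using \<psi>(1) that unfolding solution_on_def by blast
      have "\<exists>r\<in>{0<..<1}. fst (\<psi> 1) - fst (\<psi> 0) = (*) (t * fst (F (\<psi> r))) (1 - 0)"
        by (rule mvt_simple[where f = "\<lambda>r. fst (\<psi> r)"])
           (use has_vector_derivative_components(1)[OF d\<psi>] in \<open>auto simp: has_field_derivative_def\<close>)
      then obtain r1 where "r1 \<in> {0<..<1}" "fst (\<psi> 1) - fst (\<psi> 0) = (*) (t * fst (F (\<psi> r1))) (1 - 0)"
        by blast
      then have r1: "r1 \<in> {0..1}" "fst w - fst z = t * fst (F (\<psi> r1))"
        using \<psi> by auto
      have "\<exists>r\<in>{0<..<1}. snd (\<psi> 1) - snd (\<psi> 0) = (*) (t * snd (F (\<psi> r))) (1 - 0)"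
        by (rule mvt_simple[where f = "\<lambda>r. snd (\<psi> r)"])
           (use has_vector_derivative_components(2)[OF d\<psi>] in \<open>auto simp: has_field_derivative_def\<close>)
      then obtain r2 where "r2 \<in> {0<..<1}" "snd (\<psi> 1) - snd (\<psi> 0) = (*) (t * snd (F (\<psi> r2))) (1 - 0)"
        by blast
      then have r2: "r2 \<in> {0..1}" "snd w - snd z = t * snd (F (\<psi> r2))"
        using \<psi> by auto
      define c where "c = \<rho> w - \<rho> z"
      have \<rho>: "\<rho> z \<in> ball s0 \<epsilon>2" "\<rho> w \<in> ball s0 \<epsilon>2" "\<sigma> (\<rho> z) = z" "\<sigma> (\<rho> w) = w"
        using d1 zw hom by (auto simp: homeomorphism_def)
      have d\<sigma>: "(\<sigma> has_vector_derivative \<sigma>' s) (at s)" if "s \<in> ball s0 \<epsilon>2" for s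
        using s1_dom[of q q s s] that \<epsilon> by (intro der) auto
      obtain s1 where s1: "s1 \<in> ball s0 \<epsilon>2" "fst w - fst z = c * fst (\<sigma>' s1)"
        using mvt_on_ball[OF has_vector_derivative_components(1)[OF d\<sigma>] \<rho>(1,2)] \<rho>(3,4)
        unfolding c_def by auto
      obtain s2 where s2: "s2 \<in> ball s0 \<epsilon>2" "snd w - snd z = c * snd (\<sigma>' s2)"
        using mvt_on_ball[OF has_vector_derivative_components(2)[OF d\<sigma>] \<rho>(1,2)] \<rho>(3,4)
        unfolding c_def by auto
      \<comment> \<open>Componentwise, w - z is \<open>t\<close> times a value of the field and also
        \<open>c\<close> times a tangent of the section, so the two products cancel.\<close>
      have "t * D (\<psi> r1, \<psi> r2, s1, s2) =
          fst (\<sigma>' s1) * (t * snd (F (\<psi> r2))) - snd (\<sigma>' s2) * (t * fst (F (\<psi> r1)))"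
        by (simp add: D_def algebra_simps)
      also have "\<dots> = fst (\<sigma>' s1) * (c * snd (\<sigma>' s2)) - snd (\<sigma>' s2) * (c * fst (\<sigma>' s1))"
        using r1 r2 s1 s2 by simp
      also have "\<dots> = 0"
        by simp
      finally show ?thesis
        using nz[OF near[OF r1(1)] near[OF r2(1)] s1(1) s2(1)] False by simp
    qed
  qed
qed

section \<open>Local return maps\<close>

text \<open>\<open>\<Psi> z\<close> is the segment from \<open>z\<close> of duration
  \<open>\<tau> z\<close> in unit time. The bound is uniform in \<open>r\<close>, so a whole segment
  stays close to its neighbour.\<close>

lemma flow_family_close:
  fixes F :: "real \<times> real \<Rightarrow> real \<times> real"
  assumes lip: "lipschitz_on_balls F" and cont: "continuous_on S \<tau>"
    and sol: "\<And>z. z \<in> S \<Longrightarrow> solution_on (\<lambda>x. \<tau> z *\<^sub>R F x) (\<Psi> z) {0..1}"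
    and init: "\<And>z. z \<in> S \<Longrightarrow> \<Psi> z 0 = z"
    and "z0 \<in> S" "\<epsilon> > 0"
  obtains d where "d > 0"
    and "\<And>z r. z \<in> S \<Longrightarrow> dist z z0 < d \<Longrightarrow> r \<in> {0..1} \<Longrightarrow> dist (\<Psi> z r) (\<Psi> z0 r) < \<epsilon>"
proof -
  obtain d1 where d1: "d1 > 0"
    "\<And>c \<phi> r. \<bar>c - \<tau> z0\<bar> < d1 \<Longrightarrow> dist (\<phi> 0) (\<Psi> z0 0) < d1 \<Longrightarrow>
       solution_on (\<lambda>x. c *\<^sub>R F x) \<phi> {0..1} \<Longrightarrow> r \<in> {0..1} \<Longrightarrow> dist (\<phi> r) (\<Psi> z0 r) < \<epsilon>"
    by (rule solutions_stay_close[OF lip sol[OF \<open>z0 \<in> S\<close>] \<open>\<epsilon> > 0\<close>]) blast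
  obtain d2 where d2: "d2 > 0" "\<And>z. z \<in> S \<Longrightarrow> dist z z0 < d2 \<Longrightarrow> dist (\<tau> z) (\<tau> z0) < d1"
    using cont \<open>z0 \<in> S\<close> \<open>d1 > 0\<close> unfolding continuous_on_iff by blast
  show thesis
  proof (rule that[of "min d1 d2"])
    show "min d1 d2 > 0"
      using d1 d2 by simp
    show "dist (\<Psi> z r) (\<Psi> z0 r) < \<epsilon>" if "z \<in> S" "dist z z0 < min d1 d2" "r \<in> {0..1}" for z r
      by (rule d1(2)[of "\<tau> z"])
         (use that d2(2)[OF \<open>z \<in> S\<close>] sol init \<open>z0 \<in> S\<close> in \<open>auto simp: dist_real_def\<close>)
  qed
qed

text \<open>Joint continuity serves two ends: continuity of the end point at \<open>r = 1\<close>,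
  and continuity in \<open>z\<close> of integrals over \<open>r\<close> along the segments.\<close>

lemma flow_family_jointly_continuous:
  fixes F :: "real \<times> real \<Rightarrow> real \<times> real"
  assumes lip: "lipschitz_on_balls F" and cont: "continuous_on S \<tau>"
    and sol: "\<And>z. z \<in> S \<Longrightarrow> solution_on (\<lambda>x. \<tau> z *\<^sub>R F x) (\<Psi> z) {0..1}"
    and init: "\<And>z. z \<in> S \<Longrightarrow> \<Psi> z 0 = z"
  shows "continuous_on (S \<times> {0..1}) (\<lambda>(z, r). \<Psi> z r)"
  unfolding continuous_on_iff
proof (intro ballI allI impI)
  fix p0 \<epsilon> assume p0: "p0 \<in> S \<times> {0..1::real}" and \<epsilon>: "(\<epsilon>::real) > 0"
  obtain z0 r0 where [simp]: "p0 = (z0, r0)" by fastforce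
  have z0: "z0 \<in> S" "r0 \<in> {0..1}" using p0 by auto
  obtain d1 where d1: "d1 > 0"
    "\<And>z r. z \<in> S \<Longrightarrow> dist z z0 < d1 \<Longrightarrow> r \<in> {0..1} \<Longrightarrow> dist (\<Psi> z r) (\<Psi> z0 r) < \<epsilon> / 2"
    by (rule flow_family_close[OF assms z0(1), of "\<epsilon> / 2"]) (use \<epsilon> in auto)
  have "continuous_on {0..1} (\<Psi> z0)"
    using sol[OF z0(1)] by (rule solution_on_continuous)
  then obtain d2 where d2: "d2 > 0"
    "\<And>r. r \<in> {0..1} \<Longrightarrow> dist r r0 < d2 \<Longrightarrow> dist (\<Psi> z0 r) (\<Psi> z0 r0) < \<epsilon> / 2"
    using z0(2) half_gt_zero[OF \<epsilon>] unfolding continuous_on_iff by blast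
  have "dist (\<Psi> z r) (\<Psi> z0 r0) < \<epsilon>"
    if "z \<in> S" "r \<in> {0..1}" "dist (z, r) (z0, r0) < min d1 d2" for z r
  proof -
    have "dist z z0 < d1" "dist r r0 < d2"
      using that(3) dist_fst_le[of "(z, r)" "(z0, r0)"] dist_snd_le[of "(z, r)" "(z0, r0)"] by auto
    then have "dist (\<Psi> z r) (\<Psi> z0 r) < \<epsilon> / 2" "dist (\<Psi> z0 r) (\<Psi> z0 r0) < \<epsilon> / 2"
      using that d1(2) d2(2) by auto
    then show ?thesis
      using dist_triangle_half_l dist_commute dist_triangle_less_add[of "\<Psi> z r" "\<Psi> z0 r" "\<epsilon> / 2" "\<Psi> z0 r0" "\<epsilon> / 2"]
      by (metis field_sum_of_halves)
  qed
  then show "\<exists>d>0. \<forall>p\<in>S \<times> {0..1}. dist p p0 < d \<longrightarrow>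
      dist (case p of (z, r) \<Rightarrow> \<Psi> z r) (case p0 of (z, r) \<Rightarrow> \<Psi> z r) < \<epsilon>"
    using d1(1) d2(1) by (intro exI[of _ "min d1 d2"]) auto
qed

lemma flows_to_continuous:
  fixes F :: "real \<times> real \<Rightarrow> real \<times> real"
  assumes lip: "lipschitz_on_balls F" and cont: "continuous_on S \<tau>"
    and fl: "\<And>z. z \<in> S \<Longrightarrow> flows_to F z (\<tau> z) (f z)"
  shows "continuous_on S f"
proof -
  have "\<exists>\<psi>. solution_on (\<lambda>x. \<tau> z *\<^sub>R F x) \<psi> {0..1} \<and> \<psi> 0 = z \<and> \<psi> 1 = f z" if "z \<in> S" for z
    using flows_to_rescale[OF fl[OF that]] by metis
  then obtain \<Psi> where \<Psi>: "\<And>z. z \<in> S \<Longrightarrow> solution_on (\<lambda>x. \<tau> z *\<^sub>R F x) (\<Psi> z) {0..1}"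
      "\<And>z. z \<in> S \<Longrightarrow> \<Psi> z 0 = z" "\<And>z. z \<in> S \<Longrightarrow> \<Psi> z 1 = f z"
    by metis
  have "continuous_on S (\<lambda>z. case (z, 1) of (z, r) \<Rightarrow> \<Psi> z r)"
    by (rule continuous_on_compose2[OF flow_family_jointly_continuous[OF lip cont \<Psi>(1,2)]])
       (auto intro!: continuous_intros)
  then show ?thesis
    by (rule continuous_on_eq) (simp add: \<Psi>(3))
qed

section \<open>Germs of return maps along a section\<close>

lemma eventually_near_iff:
  fixes q :: "'a::metric_space"
  shows "eventually_near \<Sigma> q P \<longleftrightarrow> (\<exists>e>0. \<forall>z\<in>\<Sigma>. dist z q < e \<longrightarrow> P z)"
  unfolding eventually_near_def eventually_inf_principal eventually_nhds_metric by blast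

lemma eventually_near_conj:
  "eventually_near \<Sigma> q P \<Longrightarrow> eventually_near \<Sigma> q P' \<Longrightarrow> eventually_near \<Sigma> q (\<lambda>z. P z \<and> P' z)"
  unfolding eventually_near_def by (rule eventually_conj)

lemma eventually_near_mono:
  "eventually_near \<Sigma> q P \<Longrightarrow> (\<And>z. z \<in> \<Sigma> \<Longrightarrow> P z \<Longrightarrow> P' z) \<Longrightarrow> eventually_near \<Sigma> q P'"
  unfolding eventually_near_def eventually_inf_principal by (auto elim: eventually_mono)

lemma eventually_near_openin:
  fixes q :: "'a::metric_space"
  assumes "openin (top_of_set \<Sigma>) S" "q \<in> S"
  shows "eventually_near \<Sigma> q (\<lambda>z. z \<in> S)"
  using assms unfolding eventually_near_iff openin_euclidean_subtopology_iff by blast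

lemma eventually_near_continuous:
  fixes f :: "'a::metric_space \<Rightarrow> 'b::metric_space"
  assumes "continuous_on S f" "openin (top_of_set \<Sigma>) S" "q \<in> S" "\<And>z. z \<in> S \<Longrightarrow> f z \<in> \<Sigma>'"
    and "eventually_near \<Sigma>' (f q) P"
  shows "eventually_near \<Sigma> q (\<lambda>z. P (f z))"
proof -
  obtain e where e: "e > 0" "\<And>w. w \<in> \<Sigma>' \<Longrightarrow> dist w (f q) < e \<Longrightarrow> P w"
    using assms(5) unfolding eventually_near_iff by blast
  obtain d where d: "d > 0" "\<And>z. z \<in> S \<Longrightarrow> dist z q < d \<Longrightarrow> dist (f z) (f q) < e"
    using assms(1,3) e(1) unfolding continuous_on_iff by blast
  have "eventually_near \<Sigma> q (\<lambda>z. dist z q < d)"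
    using d unfolding eventually_near_iff by blast
  from eventually_near_conj[OF this eventually_near_openin[OF assms(2,3)]] show ?thesis
    by (rule eventually_near_mono) (use assms(4) d e in blast)
qed

text \<open>A return map moves points by a continuous time, hence is continuous, and it fixes
  \<open>q\<close>; so it keeps points near \<open>q\<close> near \<open>q\<close>.\<close>

lemma local_return_map_eventually:
  assumes lip: "lipschitz_on_balls F" and ret: "local_return_map F \<gamma> \<Sigma> q f"
    and "eventually_near \<Sigma> q P"
  shows "eventually_near \<Sigma> q (\<lambda>z. P (f z))"
proof -
  obtain S \<tau> where S: "openin (top_of_set \<Sigma>) S" "q \<in> S" "continuous_on S \<tau>" "f q = q"
      "\<And>z. z \<in> S \<Longrightarrow> f z \<in> \<Sigma>" "\<And>z. z \<in> S \<Longrightarrow> flows_to F z (\<tau> z) (f z)"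
    using ret unfolding local_return_map_def by blast
  show ?thesis
    by (rule eventually_near_continuous[OF flows_to_continuous[OF lip S(3,6)] S(1,2,5)])
       (use S(4) assms(3) in auto)
qed

text \<open>
  Two return maps have the same return time at \<open>q\<close>, so near \<open>q\<close> their values are joined by a
  short orbit segment.
\<close>

lemma local_return_map_unique:
  assumes lip: "lipschitz_on_balls F"
    and ret: "local_return_map F \<gamma> \<Sigma> q f" "local_return_map F \<gamma> \<Sigma> q g"
  shows "eventually_near \<Sigma> q (\<lambda>z. f z = g z)"
proof -
  obtain S \<tau> where S: "openin (top_of_set \<Sigma>) S" "q \<in> S" "continuous_on S \<tau>" "f q = q"
      "\<And>t. 0 < t \<Longrightarrow> t < \<tau> q \<Longrightarrow> \<not> flows_to F q t q"
      "\<And>z. z \<in> S \<Longrightarrow> \<tau> z > 0" "\<And>z. z \<in> S \<Longrightarrow> f z \<in> \<Sigma>" "\<And>z. z \<in> S \<Longrightarrow> flows_to F z (\<tau> z) (f z)"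
    using ret(1) unfolding local_return_map_def by blast
  obtain S' \<tau>' where S': "openin (top_of_set \<Sigma>) S'" "q \<in> S'" "continuous_on S' \<tau>'" "g q = q"
      "\<And>t. 0 < t \<Longrightarrow> t < \<tau>' q \<Longrightarrow> \<not> flows_to F q t q"
      "\<And>z. z \<in> S' \<Longrightarrow> \<tau>' z > 0" "\<And>z. z \<in> S' \<Longrightarrow> g z \<in> \<Sigma>"
      "\<And>z. z \<in> S' \<Longrightarrow> flows_to F z (\<tau>' z) (g z)"
    using ret(2) unfolding local_return_map_def by blast
  have "flows_to F q (\<tau> q) q" "flows_to F q (\<tau>' q) q"
    using S(8)[OF S(2)] S'(8)[OF S'(2)] S(4) S'(4) by auto
  \<comment> \<open>Each of the two times brings \<open>q\<close> back to itself, and by minimality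
    neither can come before the other.\<close>
  then have \<tau>q: "\<tau> q = \<tau>' q"
    using S(5)[of "\<tau>' q"] S'(5)[of "\<tau> q"] S(6)[OF S(2)] S'(6)[OF S'(2)] by force
  have trans: "transverse_section F \<Sigma>" "q \<in> \<Sigma>"
    using ret(1) by (auto simp: local_return_map_def)
  obtain e where e: "e > 0" "\<And>z w t. z \<in> \<Sigma> \<Longrightarrow> w \<in> \<Sigma> \<Longrightarrow> dist z q < e \<Longrightarrow> dist w q < e \<Longrightarrow> t < e \<Longrightarrow>
           flows_to F z t w \<Longrightarrow> z = w"
    by (rule transverse_section_no_quick_return[OF lip trans]) blast
  have near: "eventually_near \<Sigma> q (\<lambda>z. dist z q < e)"
    using e(1) unfolding eventually_near_iff by blast
  \<comment> \<open>Half of \<open>e\<close> for each return time, so that the two times differ by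
    less than \<open>e\<close>.\<close>
  have time: "eventually_near UNIV (\<tau> q) (\<lambda>t. \<bar>t - \<tau> q\<bar> < e / 2)"
    using e(1) unfolding eventually_near_iff by (auto simp: dist_real_def intro!: exI[of _ "e / 2"])
  have "eventually_near \<Sigma> q (\<lambda>z. ((z \<in> S \<and> z \<in> S') \<and> (dist (f z) q < e \<and> dist (g z) q < e)) \<and>
      (\<bar>\<tau> z - \<tau> q\<bar> < e / 2 \<and> \<bar>\<tau>' z - \<tau> q\<bar> < e / 2))"
    by (intro eventually_near_conj eventually_near_openin S(1,2) S'(1,2)
        local_return_map_eventually[OF lip ret(1) near] local_return_map_eventually[OF lip ret(2) near]
        eventually_near_continuous[OF S(3,1,2) UNIV_I time]
        eventually_near_continuous[OF S'(3,1,2) UNIV_I time[unfolded \<tau>q], folded \<tau>q])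
  then show ?thesis
  proof (rule eventually_near_mono)
    fix z assume z: "((z \<in> S \<and> z \<in> S') \<and> (dist (f z) q < e \<and> dist (g z) q < e)) \<and>
      (\<bar>\<tau> z - \<tau> q\<bar> < e / 2 \<and> \<bar>\<tau>' z - \<tau> q\<bar> < e / 2)"
    then have fl: "flows_to F z (\<tau> z) (f z)" "flows_to F z (\<tau>' z) (g z)" and mem: "f z \<in> \<Sigma>" "g z \<in> \<Sigma>"
      using S(7,8) S'(7,8) by auto
    have close: "dist (f z) q < e" "dist (g z) q < e" "\<tau>' z - \<tau> z < e" "\<tau> z - \<tau>' z < e"
      using z by linarith+
    show "f z = g z"
    \<comment> \<open>Whichever value is reached first flows to the other one in the difference of
      the times.\<close>
    proof (cases "\<tau> z \<le> \<tau>' z")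
      case True
      have "flows_to F (f z) (\<tau>' z - \<tau> z) (g z)"
        by (rule flows_to_split[OF lip _ fl(1)]) (use fl True in auto)
      then show ?thesis
        using e(2)[OF mem close(1,2,3)] by blast
    next
      case False
      have "flows_to F (g z) (\<tau> z - \<tau>' z) (f z)"
        by (rule flows_to_split[OF lip _ fl(2)]) (use fl False in auto)
      then show ?thesis
        using e(2)[OF mem(2,1) close(2,1,4)] by simp
    qed
  qed
qed

section \<open>Time reversal\<close>

lemma solution_on_reverse:
  assumes "solution_on F \<phi> J"
  shows "solution_on (\<lambda>z. - F z) (\<lambda>t. \<phi> (- t)) (uminus ` J)"
  using solution_on_affine[OF assms, of "uminus ` J" 0 "-1"] by force

lemma periodic_orbit_reverse:
  assumes "periodic_orbit F \<gamma>"
  shows "periodic_orbit (\<lambda>z. - F z) \<gamma>"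
proof -
  obtain \<phi> T where \<phi>: "solution_on F \<phi> UNIV" "T > 0" "\<And>t. \<phi> (t + T) = \<phi> t" "\<gamma> = range \<phi>"
    and nz: "\<forall>z\<in>\<gamma>. F z \<noteq> 0"
    using assms unfolding periodic_orbit_def by blast
  have "solution_on (\<lambda>z. - F z) (\<lambda>t. \<phi> (- t)) UNIV"
    using solution_on_reverse[OF \<phi>(1)] by simp
  moreover have "\<phi> (- (t + T)) = \<phi> (- t)" for t
    using \<phi>(3)[of "- (t + T)"] by simp
  moreover have "range (\<lambda>t. \<phi> (- t)) = \<gamma>"
    unfolding \<phi>(4) by (auto simp: image_iff) (metis minus_minus)
  ultimately show ?thesis
    using \<phi>(2) nz unfolding periodic_orbit_def by (intro conjI exI[of _ "\<lambda>t. \<phi> (- t)"] exI[of _ T]) auto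
qed

lemma transverse_section_reverse:
  "transverse_section F \<Sigma> \<Longrightarrow> transverse_section (\<lambda>z. - F z) \<Sigma>"
proof -
  have "a * - b - c * - d \<noteq> 0 \<longleftrightarrow> a * b - c * d \<noteq> 0" for a b c d :: real
    by auto
  then show "transverse_section F \<Sigma> \<Longrightarrow> transverse_section (\<lambda>z. - F z) \<Sigma>"
    unfolding transverse_section_def by (simp only: fst_uminus snd_uminus)
qed

lemma orbit_in_reverse_subset:
  "orbit_in F S z \<subseteq> orbit_in (\<lambda>z. - F z) S z"
proof
  fix w assume "w \<in> orbit_in F S z"
  then obtain \<phi> t J where \<phi>: "w = \<phi> t" "open J" "is_interval J" "0 \<in> J" "t \<in> J"
      "solution_on F \<phi> J" "\<phi> ` J \<subseteq> S" "\<phi> 0 = z"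
    unfolding orbit_in_def by blast
  have "open (uminus ` J)" "is_interval (uminus ` J)" "0 \<in> uminus ` J" "- t \<in> uminus ` J"
    using \<phi>(2-5) by (auto simp: open_negations)
  then show "w \<in> orbit_in (\<lambda>z. - F z) S z"
    using \<phi> solution_on_reverse[OF \<phi>(6)] unfolding orbit_in_def
    by (intro CollectI exI[of _ "\<lambda>t. \<phi> (- t)"] exI[of _ "- t"] exI[of _ "uminus ` J"]) auto
qed

lemma orbit_in_reverse: "orbit_in (\<lambda>z. - F z) S z = orbit_in F S z"
  using orbit_in_reverse_subset[of F S z] orbit_in_reverse_subset[of "\<lambda>z. - F z" S z] by auto


text \<open>
  Near \<open>q\<close> the return map \<open>f\<close> is injective, since two points with the same image are joined by
  a short orbit segment. As a continuous injective map between arcs it has an open image and a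
  continuous inverse, which is the return map in reversed time.
\<close>

lemma local_return_map_reverse:
  assumes lip: "lipschitz_on_balls F" and ret: "local_return_map F \<gamma> \<Sigma> q f"
  obtains f' where "local_return_map (\<lambda>z. - F z) \<gamma> \<Sigma> q f'"
    and "eventually_near \<Sigma> q (\<lambda>z. f' (f z) = z \<and> f (f' z) = z)"
proof -
  obtain S \<tau> where S: "openin (top_of_set \<Sigma>) S" "q \<in> S" "continuous_on S \<tau>" and fq: "f q = q"
      and early: "\<And>t. 0 < t \<Longrightarrow> t < \<tau> q \<Longrightarrow> \<not> flows_to F q t q"
      and pos: "\<And>z. z \<in> S \<Longrightarrow> \<tau> z > 0" and f\<Sigma>: "\<And>z. z \<in> S \<Longrightarrow> f z \<in> \<Sigma>"
      and fl: "\<And>z. z \<in> S \<Longrightarrow> flows_to F z (\<tau> z) (f z)"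
    using ret unfolding local_return_map_def by blast
  have q: "q \<in> \<Sigma>" "q \<in> \<gamma>" "periodic_orbit F \<gamma>" "transverse_section F \<Sigma>"
    using ret by (auto simp: local_return_map_def)
  obtain \<sigma> \<rho> where hom: "homeomorphism {-1<..<1::real} \<Sigma> \<sigma> \<rho>"
    using q(4) unfolding transverse_section_def by blast
  have \<rho>\<sigma>: "\<And>s. s \<in> {-1<..<1} \<Longrightarrow> \<rho> (\<sigma> s) = s" "\<And>z. z \<in> \<Sigma> \<Longrightarrow> \<sigma> (\<rho> z) = z"
    and img: "\<And>s. s \<in> {-1<..<1} \<Longrightarrow> \<sigma> s \<in> \<Sigma>" "\<And>z. z \<in> \<Sigma> \<Longrightarrow> \<rho> z \<in> {-1<..<1}"
    and cont: "continuous_on {-1<..<1} \<sigma>" "continuous_on \<Sigma> \<rho>"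
    using hom unfolding homeomorphism_def by (blast intro: imageI)+
  obtain e where e: "e > 0" "\<And>z w t. z \<in> \<Sigma> \<Longrightarrow> w \<in> \<Sigma> \<Longrightarrow> dist z q < e \<Longrightarrow> dist w q < e \<Longrightarrow> t < e \<Longrightarrow>
           flows_to F z t w \<Longrightarrow> z = w"
    by (rule transverse_section_no_quick_return[OF lip q(4,1)]) blast
  have near: "eventually_near \<Sigma> q (\<lambda>z. dist z q < e)"
    using e(1) unfolding eventually_near_iff by blast
  have time: "eventually_near UNIV (\<tau> q) (\<lambda>t. \<bar>t - \<tau> q\<bar> < e / 2)"
    using e(1) unfolding eventually_near_iff by (auto simp: dist_real_def intro!: exI[of _ "e / 2"])
  define P where "P z \<longleftrightarrow> z \<in> S \<and> dist z q < e \<and> \<bar>\<tau> z - \<tau> q\<bar> < e / 2" for z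
  have "eventually_near \<Sigma> q P"
    unfolding P_def[abs_def]
    by (intro eventually_near_conj eventually_near_openin S near
        eventually_near_continuous[OF S(3,1,2) UNIV_I time])
  have "openin (top_of_set {-1<..<1::real}) {-1<..<1}"
    by simp
  then have "eventually_near {-1<..<1} (\<rho> q) (\<lambda>s. P (\<sigma> s))"
    by (rule eventually_near_continuous[OF cont(1)])
       (use img \<rho>\<sigma> q(1) \<open>eventually_near \<Sigma> q P\<close> in auto)
  then obtain d0 where d0: "d0 > 0" "\<And>s. s \<in> {-1<..<1} \<Longrightarrow> dist s (\<rho> q) < d0 \<Longrightarrow> P (\<sigma> s)"
    unfolding eventually_near_iff by blast
  obtain d1 where d1: "d1 > 0" "ball (\<rho> q) d1 \<subseteq> {-1<..<1}"
    using img(2)[OF q(1)] openE[OF open_greaterThanLessThan] by metis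
  \<comment> \<open>An interval of section parameters around that of \<open>q\<close>, small enough
    for every point over it to satisfy \<open>P\<close>.\<close>
  define J where "J = ball (\<rho> q) (min d0 d1)"
  have J: "\<rho> q \<in> J" "J \<subseteq> {-1<..<1}" "\<And>s. s \<in> J \<Longrightarrow> P (\<sigma> s)" "open J" "path_connected J"
    using d0(1) d1 d0(2)[OF subsetD[OF d1(2)]]
    by (auto simp: J_def dist_commute intro: convex_imp_path_connected)
  have JS: "\<sigma> s \<in> S" if "s \<in> J" for s
    using J(3)[OF that] by (simp add: P_def)
  \<comment> \<open>The order of the two return times is assumed here; the other order is the same
    statement with the points exchanged.\<close>
  have inj: "s1 = s2" if s: "s1 \<in> J" "s2 \<in> J" "f (\<sigma> s1) = f (\<sigma> s2)" and le: "\<tau> (\<sigma> s2) \<le> \<tau> (\<sigma> s1)" for s1 s2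
  proof -
    have "flows_to F (\<sigma> s1) (\<tau> (\<sigma> s1) - \<tau> (\<sigma> s2)) (\<sigma> s2)"
      by (rule flows_to_cancel[OF lip fl[OF JS[OF s(1)], unfolded s(3)] fl[OF JS[OF s(2)]] le])
    moreover have "\<tau> (\<sigma> s1) - \<tau> (\<sigma> s2) < e"
      using J(3)[OF s(1)] J(3)[OF s(2)] unfolding P_def by linarith
    ultimately have "\<sigma> s1 = \<sigma> s2"
      using e(2)[of "\<sigma> s1" "\<sigma> s2"] J(3)[OF s(1)] J(3)[OF s(2)] img(1) J(2) s unfolding P_def by blast
    then show ?thesis
      using \<rho>\<sigma>(1) J(2) s by (metis subsetD)
  qed
  \<comment> \<open>The return map read in the section parameter. As an injective continuous map
    from an open interval to the line it has an open image and a continuous inverse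
    \<open>H\<close>.\<close>
  define G where "G s = \<rho> (f (\<sigma> s))" for s
  have \<sigma>G: "\<sigma> (G s) = f (\<sigma> s)" and G: "G s \<in> {-1<..<1}" if "s \<in> J" for s
    using f\<Sigma>[OF JS[OF that]] \<rho>\<sigma> img by (auto simp: G_def)
  have "inj_on G J"
  proof (rule inj_onI)
    fix s1 s2 assume s: "s1 \<in> J" "s2 \<in> J" "G s1 = G s2"
    then have "f (\<sigma> s1) = f (\<sigma> s2)"
      using \<sigma>G by metis
    then show "s1 = s2"
      using inj[of s1 s2] inj[of s2 s1] s by (metis linear)
  qed
  have contf: "continuous_on S f"
    by (rule flows_to_continuous[OF lip S(3) fl])
  have contG: "continuous_on J G"
    unfolding G_def
    by (intro continuous_on_compose2[OF cont(2)] continuous_on_compose2[OF contf]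
        continuous_on_subset[OF cont(1)])
       (use J(2) JS f\<Sigma>[OF JS] in auto)
  obtain H where H: "homeomorphism J (G ` J) G H"
    using injective_into_1d_eq_homeomorphism[OF contG J(5)] \<open>inj_on G J\<close> by blast
  have HG: "\<And>s. s \<in> J \<Longrightarrow> H (G s) = s" "continuous_on (G ` J) H"
    using H by (auto simp: homeomorphism_def)
  have "open (G ` J)"
    by (rule invariance_of_domain[OF contG J(4) \<open>inj_on G J\<close>])
  define V where "V = \<Sigma> \<inter> \<rho> -` (G ` J)"
  have V: "openin (top_of_set \<Sigma>) V"
    unfolding V_def by (rule continuous_openin_preimage_gen[OF cont(2) \<open>open (G ` J)\<close>])
  define f' where "f' w = \<sigma> (H (\<rho> w))" for w
  have contf': "continuous_on V f'"
    unfolding f'_def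
    by (intro continuous_on_compose2[OF cont(1)] continuous_on_compose2[OF HG(2)]
        continuous_on_subset[OF cont(2)])
       (use J HG in \<open>auto simp: V_def\<close>)
  have Vcases: "\<exists>s\<in>J. w = f (\<sigma> s) \<and> f' w = \<sigma> s" if "w \<in> V" for w
  proof -
    obtain s where "s \<in> J" "\<rho> w = G s" "w \<in> \<Sigma>"
      using \<open>w \<in> V\<close> by (auto simp: V_def)
    moreover from this have "f' w = \<sigma> s"
      by (simp add: f'_def HG(1))
    moreover have "w = f (\<sigma> s)"
      using \<rho>\<sigma>(2)[of w] \<sigma>G[of s] calculation by simp
    ultimately show ?thesis
      by blast
  qed
  have f'f: "f (\<sigma> s) \<in> V" "f' (f (\<sigma> s)) = \<sigma> s" if "s \<in> J" for s
    using that f\<Sigma>[OF JS[OF that]] HG(1)[OF that] unfolding V_def f'_def G_def by auto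
  have \<sigma>q: "\<sigma> (\<rho> q) = q"
    using \<rho>\<sigma> q by simp
  then have qV: "q \<in> V" "f' q = q"
    using f'f[OF J(1)] fq by auto
  show thesis
  proof (rule that)
    show "local_return_map (\<lambda>z. - F z) \<gamma> \<Sigma> q f'"
      unfolding local_return_map_def
    \<comment> \<open>The point \<open>w\<close> is \<open>f (f' w)\<close>, so in reversed time it
      takes \<open>\<tau> (f' w)\<close> to get back to \<open>f' w\<close>.\<close>
    proof (intro conjI exI[of _ V] exI[of _ "\<lambda>w. \<tau> (f' w)"] ballI allI impI)
      show "periodic_orbit (\<lambda>z. - F z) \<gamma>" "transverse_section (\<lambda>z. - F z) \<Sigma>" "q \<in> \<gamma> \<inter> \<Sigma>"
        using q periodic_orbit_reverse transverse_section_reverse by auto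
      show "continuous_on V (\<lambda>w. \<tau> (f' w))"
      proof (rule continuous_on_compose2[OF S(3) contf'])
        show "f' ` V \<subseteq> S"
        proof
          fix z assume "z \<in> f' ` V"
          then obtain s where "s \<in> J" "z = \<sigma> s"
            using Vcases by blast
          then show "z \<in> S"
            using JS by blast
        qed
      qed
      show "\<not> flows_to (\<lambda>z. - F z) q t q" if "0 < t \<and> t < \<tau> (f' q)" for t
        using early[of t] that qV flows_to_reverse[of "\<lambda>z. - F z" q t q] by auto
    next
      fix w assume "w \<in> V"
      then obtain s where s: "s \<in> J" "w = f (\<sigma> s)" "f' w = \<sigma> s"
        using Vcases by blast
      then show "\<tau> (f' w) > 0" "f' w \<in> \<Sigma>" "flows_to (\<lambda>z. - F z) w (\<tau> (f' w)) (f' w)"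
        using pos[OF JS] img(1) J(2) flows_to_reverse[OF fl[OF JS]] by auto
    qed (use V qV in auto)
    have "eventually_near \<Sigma> q (\<lambda>z. z \<in> V \<and> \<rho> z \<in> J)"
    proof (intro eventually_near_conj eventually_near_openin V qV)
      have "openin (top_of_set \<Sigma>) (\<Sigma> \<inter> \<rho> -` J)"
        by (rule continuous_openin_preimage_gen[OF cont(2) J(4)])
      then have "eventually_near \<Sigma> q (\<lambda>z. z \<in> \<Sigma> \<inter> \<rho> -` J)"
        by (rule eventually_near_openin) (use q J in auto)
      then show "eventually_near \<Sigma> q (\<lambda>z. \<rho> z \<in> J)"
        by (rule eventually_near_mono) auto
    qed
    then show "eventually_near \<Sigma> q (\<lambda>z. f' (f z) = z \<and> f (f' z) = z)"
    proof (rule eventually_near_mono)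
      fix z assume "z \<in> \<Sigma>" "z \<in> V \<and> \<rho> z \<in> J"
      then show "f' (f z) = z \<and> f (f' z) = z"
        using f'f(2)[of "\<rho> z"] \<rho>\<sigma>(2)[of z] Vcases[of z] by auto
    qed
  qed
qed

section \<open>Orbital equivalence\<close>

text \<open>Derivatives are taken within \<open>J\<close> and \<open>K\<close> so that the ends of a
  closed interval are included, where orbit segments begin and stop.\<close>

lemma has_real_derivative_inverse_within:
  fixes \<theta> \<kappa> :: "real \<Rightarrow> real"
  assumes hom: "homeomorphism J K \<theta> \<kappa>" and "r \<in> J"
    and der: "(\<theta> has_real_derivative d) (at r within J)" and "d \<noteq> 0"
  shows "(\<kappa> has_real_derivative 1 / d) (at (\<theta> r) within K)"
proof -
  have hom': "\<theta> r \<in> K" "\<kappa> (\<theta> r) = r" "\<And>y. y \<in> K \<Longrightarrow> \<theta> (\<kappa> y) = y" "\<And>y. y \<in> K \<Longrightarrow> \<kappa> y \<in> J"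
      "continuous_on K \<kappa>"
    using hom \<open>r \<in> J\<close> by (auto simp: homeomorphism_def)
  have ev: "eventually (\<lambda>y. \<kappa> y \<in> J \<and> \<kappa> y \<noteq> r \<and> \<theta> (\<kappa> y) = y) (at (\<theta> r) within K)"
    unfolding eventually_at_filter using hom' by (intro always_eventually) auto
  have "(\<kappa> \<longlongrightarrow> r) (at (\<theta> r) within K)"
    using hom' by (metis continuous_on)
  then have lim: "filterlim \<kappa> (at r within J) (at (\<theta> r) within K)"
    using ev unfolding filterlim_at by (auto elim: eventually_mono)
  have "((\<lambda>x. (\<theta> x - \<theta> r) / (x - r)) \<longlongrightarrow> d) (at r within J)"
    using der unfolding has_field_derivative_iff .
  from tendsto_inverse[OF filterlim_compose[OF this lim] \<open>d \<noteq> 0\<close>]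
  have "((\<lambda>y. inverse ((\<theta> (\<kappa> y) - \<theta> r) / (\<kappa> y - r))) \<longlongrightarrow> 1 / d) (at (\<theta> r) within K)"
    by (simp add: inverse_eq_divide)
  then show ?thesis
    unfolding has_field_derivative_iff hom'(2)
    by (rule Lim_transform_eventually) (use ev in \<open>auto elim!: eventually_mono\<close>)
qed

lemma increasing_on_interval:
  fixes \<theta> :: "real \<Rightarrow> real"
  assumes "is_interval J" and der: "\<And>r. r \<in> J \<Longrightarrow> (\<theta> has_real_derivative d r) (at r within J)"
    and pos: "\<And>r. r \<in> J \<Longrightarrow> d r > 0" and xy: "x \<in> J" "y \<in> J" "x < y"
  shows "\<theta> x < \<theta> y"
proof (rule DERIV_pos_imp_increasing_open[OF xy(3)])
  have sub: "{x..y} \<subseteq> J"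
    using assms(1) xy by (meson atLeastAtMost_iff mem_is_interval_1_I subsetI)
  have "continuous_on J \<theta>"
    using der by (meson DERIV_continuous continuous_on_eq_continuous_within)
  then show "continuous_on {x..y} \<theta>"
    using sub continuous_on_subset by blast
  fix r assume r: "x < r" "r < y"
  have "at r within {x..y} = at r"
    by (rule at_within_interior) (use r in simp)
  moreover have "(\<theta> has_real_derivative d r) (at r within {x..y})"
    by (rule DERIV_subset[OF der sub]) (use r sub in auto)
  ultimately show "\<exists>d. (\<theta> has_real_derivative d) (at r) \<and> d > 0"
    using pos[OF subsetD[OF sub]] r by force
qed

lemma antiderivative_on_open_interval:
  fixes f :: "real \<Rightarrow> real"
  assumes J: "is_interval J" "open J" "0 \<in> J" and cont: "continuous_on J f"
  obtains \<theta> where "\<theta> 0 = 0" "\<And>r. r \<in> J \<Longrightarrow> (\<theta> has_real_derivative f r) (at r within J)"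
proof (rule that[of "\<lambda>u. LBINT y=0..u. f y"])
  show "(LBINT y=0..(0::real). f y) = 0"
    by (simp add: zero_ereal_def)
  fix r assume r: "r \<in> J"
  \<comment> \<open>The derivative at \<open>r\<close> has to be two-sided, so 0 and
    \<open>r\<close> are placed in the interior of a compact interval \<open>{a..b}\<close> inside
    \<open>J\<close>; \<open>J\<close> itself may be unbounded.\<close>
  define lo hi where "lo = min 0 r" and "hi = max 0 r"
  have "lo \<in> J" "hi \<in> J"
    using r J by (auto simp: lo_def hi_def min_def max_def)
  then obtain d1 d2 where d: "d1 > 0" "cball lo d1 \<subseteq> J" "d2 > 0" "cball hi d2 \<subseteq> J"
    using J(2) open_contains_cball by metis
  define a b where "a = lo - d1" and "b = hi + d2"
  have "a \<in> J" "b \<in> J"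
    using d by (auto simp: a_def b_def dist_real_def subset_iff)
  then have sub: "{a..b} \<subseteq> J"
    using J(1) by (meson atLeastAtMost_iff mem_is_interval_1_I subsetI)
  have ab: "a < 0" "0 < b" "a < r" "r < b"
    using d by (auto simp: a_def b_def lo_def hi_def)
  have "((\<lambda>u. LBINT y=0..u. f y) has_vector_derivative f r) (at r within {a..b})"
    using interval_integral_FTC2[of a 0 b f r] continuous_on_subset[OF cont sub] ab
    by (simp add: zero_ereal_def)
  moreover have "at r within {a..b} = at r"
    by (rule at_within_interior) (use ab in simp)
  ultimately show "((\<lambda>u. LBINT y=0..u. f y) has_real_derivative f r) (at r within J)"
    by (metis has_real_derivative_iff_has_vector_derivative has_field_derivative_at_within)
qed

text \<open>Equality of orbits up to a positive change of speed: \<open>h\<close> has a diagonal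
  derivative with entries \<open>a\<close>, \<open>b\<close>, and carries \<open>F\<close> to
  \<open>s\<close> times \<open>G\<close>. Listing the inverse \<open>g\<close> and its derivative
  among the hypotheses makes the notion symmetric, so every transport from \<open>F\<close> to
  \<open>G\<close> gives its converse through \<open>sym\<close>.\<close>

locale orbit_equivalence =
  fixes F G :: "real \<times> real \<Rightarrow> real \<times> real" and R Q :: "(real \<times> real) set"
    and h g :: "real \<times> real \<Rightarrow> real \<times> real" and a b s :: "real \<times> real \<Rightarrow> real"
  assumes hom: "homeomorphism R Q h g" and openR: "open R" and openQ: "open Q"
    and lipF: "lipschitz_on_balls F" and lipG: "lipschitz_on_balls G"
    and dh: "\<And>z. z \<in> R \<Longrightarrow> (h has_derivative (\<lambda>x. (a z * fst x, b z * snd x))) (at z)"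
    and dg: "\<And>w. w \<in> Q \<Longrightarrow> (g has_derivative (\<lambda>x. (fst x / a (g w), snd x / b (g w)))) (at w)"
    and nonzero: "\<And>z. z \<in> R \<Longrightarrow> a z \<noteq> 0" "\<And>z. z \<in> R \<Longrightarrow> b z \<noteq> 0"
    and cont: "continuous_on R a" "continuous_on R b" "continuous_on R s"
    and pos: "\<And>z. z \<in> R \<Longrightarrow> s z > 0"
    and field: "\<And>z. z \<in> R \<Longrightarrow> (a z * fst (F z), b z * snd (F z)) = s z *\<^sub>R G (h z)"
begin

lemma h_mem: "z \<in> R \<Longrightarrow> h z \<in> Q" and g_mem: "w \<in> Q \<Longrightarrow> g w \<in> R"
  and gh: "z \<in> R \<Longrightarrow> g (h z) = z" and hg: "w \<in> Q \<Longrightarrow> h (g w) = w"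
  and conth: "continuous_on R h" and contg: "continuous_on Q g"
  using hom by (auto simp: homeomorphism_def)

lemma sym: "orbit_equivalence G F Q R g h (\<lambda>w. 1 / a (g w)) (\<lambda>w. 1 / b (g w)) (\<lambda>w. 1 / s (g w))"
proof
  show "homeomorphism Q R g h"
    using hom by (rule homeomorphism_symD)
  show "(g has_derivative (\<lambda>x. (1 / a (g z) * fst x, 1 / b (g z) * snd x))) (at z)" if "z \<in> Q" for z
    using dg[OF that] by simp
  show "(h has_derivative (\<lambda>x. (fst x / (1 / a (g (h w))), snd x / (1 / b (g (h w)))))) (at w)"
    if "w \<in> R" for w
    using dh[OF that] that by (simp add: gh mult.commute)
  have "g ` Q \<subseteq> R"
    using g_mem by blast
  then show "continuous_on Q (\<lambda>w. 1 / a (g w))" "continuous_on Q (\<lambda>w. 1 / b (g w))"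
    "continuous_on Q (\<lambda>w. 1 / s (g w))"
    using nonzero[OF g_mem] pos[OF g_mem, THEN less_imp_neq]
    by (intro continuous_on_divide continuous_on_const ballI continuous_on_compose2[OF cont(1) contg]
        continuous_on_compose2[OF cont(2) contg] continuous_on_compose2[OF cont(3) contg]; fastforce)+
  show "(1 / a (g z) * fst (G z), 1 / b (g z) * snd (G z)) = (1 / s (g z)) *\<^sub>R F (g z)" if "z \<in> Q" for z
  proof (rule prod_eqI)
    have "a (g z) * fst (F (g z)) = s (g z) * fst (G z)" "b (g z) * snd (F (g z)) = s (g z) * snd (G z)"
      using field[OF g_mem[OF that]] hg[OF that] by (auto simp: prod_eq_iff)
    then show "fst (1 / a (g z) * fst (G z), 1 / b (g z) * snd (G z)) = fst ((1 / s (g z)) *\<^sub>R F (g z))"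
      "snd (1 / a (g z) * fst (G z), 1 / b (g z) * snd (G z)) = snd ((1 / s (g z)) *\<^sub>R F (g z))"
      using nonzero[OF g_mem[OF that]] pos[OF g_mem[OF that]] by (simp_all add: field_simps)
  qed
qed (use openR openQ lipF lipG nonzero pos g_mem in simp_all)

lemma image_subset: "A \<subseteq> R \<Longrightarrow> h ` A \<subseteq> Q"
  using h_mem by blast

lemma image_image_inverse: "A \<subseteq> R \<Longrightarrow> g ` h ` A = A"
  using gh by (force simp: image_image)

text \<open>The curve h(\<psi>(r)) has velocity \<open>c * s\<close> times \<open>G\<close>, and
  this factor is the rate of the clock \<theta>; reading the curve by the inverse clock \<kappa>
  removes it. The constant \<open>c\<close> is 1 for orbits and the return time for segments
  rescaled to unit time.\<close>

lemma reparametrize: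
  assumes J: "is_interval J" and "c > 0"
    and sol: "solution_on (\<lambda>z. c *\<^sub>R F z) \<psi> J" and sub: "\<psi> ` J \<subseteq> R"
    and \<theta>: "\<And>r. r \<in> J \<Longrightarrow> (\<theta> has_real_derivative c * s (\<psi> r)) (at r within J)"
  obtains \<kappa> where "\<And>r. r \<in> J \<Longrightarrow> \<kappa> (\<theta> r) = r"
    and "solution_on G (\<lambda>t. h (\<psi> (\<kappa> t))) (\<theta> ` J)"
    and "continuous_on J \<theta>" and "\<And>x y. x \<in> J \<Longrightarrow> y \<in> J \<Longrightarrow> x < y \<Longrightarrow> \<theta> x < \<theta> y"
proof -
  have \<psi>R: "\<psi> r \<in> R" if "r \<in> J" for r
    using sub that by blast
  have cont\<theta>: "continuous_on J \<theta>"
    using \<theta> by (meson DERIV_continuous continuous_on_eq_continuous_within)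
  have d0: "c * s (\<psi> r) > 0" if "r \<in> J" for r
    using pos[OF \<psi>R[OF that]] \<open>c > 0\<close> by simp
  have incr: "\<theta> x < \<theta> y" if "x \<in> J" "y \<in> J" "x < y" for x y
    by (rule increasing_on_interval[OF J \<theta> d0 that])
  then have "inj_on \<theta> J"
    by (intro inj_onI) (metis less_irrefl linorder_neqE)
  then obtain \<kappa> where \<kappa>: "homeomorphism J (\<theta> ` J) \<theta> \<kappa>"
    using injective_into_1d_eq_homeomorphism[OF cont\<theta>] J
    by (meson is_interval_path_connected)
  then have \<kappa>\<theta>: "\<kappa> (\<theta> r) = r" if "r \<in> J" for r
    using that by (auto simp: homeomorphism_def)
  have imJ: "\<kappa> ` \<theta> ` J = J"
    using \<kappa> by (simp add: homeomorphism_def)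
  have "solution_on G (\<lambda>t. h (\<psi> (\<kappa> t))) (\<theta> ` J)"
    unfolding solution_on_def
  proof
    fix t assume "t \<in> \<theta> ` J"
    then obtain r where r: "r \<in> J" "t = \<theta> r" by blast
    define d where "d = c * s (\<psi> r)"
    have "d > 0" using d0[OF r(1)] by (simp add: d_def)
    have "(\<kappa> has_real_derivative 1 / d) (at t within \<theta> ` J)"
      unfolding r(2) by (rule has_real_derivative_inverse_within[OF \<kappa> r(1)])
        (use \<theta>[OF r(1)] \<open>d > 0\<close> in \<open>auto simp: d_def\<close>)
    then have "(\<kappa> has_vector_derivative 1 / d) (at t within \<theta> ` J)"
      by (simp add: has_real_derivative_iff_has_vector_derivative)
    moreover have "(\<psi> has_vector_derivative c *\<^sub>R F (\<psi> r)) (at (\<kappa> t) within \<kappa> ` \<theta> ` J)"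
      using sol r \<kappa>\<theta>[OF r(1)] by (simp add: imJ solution_on_def)
    ultimately have "((\<psi> \<circ> \<kappa>) has_vector_derivative (1 / d) *\<^sub>R (c *\<^sub>R F (\<psi> r))) (at t within \<theta> ` J)"
      by (rule vector_diff_chain_within)
    moreover have "(h has_derivative (\<lambda>x. (a (\<psi> r) * fst x, b (\<psi> r) * snd x)))
        (at ((\<psi> \<circ> \<kappa>) t) within (\<psi> \<circ> \<kappa>) ` \<theta> ` J)"
      using has_derivative_at_withinI[OF dh[OF \<psi>R[OF r(1)]]] r \<kappa>\<theta> by simp
    ultimately have "((h \<circ> (\<psi> \<circ> \<kappa>)) has_vector_derivative
        (a (\<psi> r) * fst ((1 / d) *\<^sub>R (c *\<^sub>R F (\<psi> r))), b (\<psi> r) * snd ((1 / d) *\<^sub>R (c *\<^sub>R F (\<psi> r)))))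
        (at t within \<theta> ` J)"
      by (rule vector_derivative_diff_chain_within)
    also have "(a (\<psi> r) * fst ((1 / d) *\<^sub>R (c *\<^sub>R F (\<psi> r))), b (\<psi> r) * snd ((1 / d) *\<^sub>R (c *\<^sub>R F (\<psi> r)))) =
        (c / d) *\<^sub>R (a (\<psi> r) * fst (F (\<psi> r)), b (\<psi> r) * snd (F (\<psi> r)))"
      by simp
    also have "\<dots> = G (h (\<psi> r))"
      unfolding field[OF \<psi>R[OF r(1)]] using pos[OF \<psi>R[OF r(1)]] \<open>c > 0\<close> by (simp add: d_def)
    finally show "((\<lambda>t. h (\<psi> (\<kappa> t))) has_vector_derivative G (h (\<psi> (\<kappa> t)))) (at t within \<theta> ` J)"
      using r \<kappa>\<theta> by (simp add: o_def)
  qed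
  then show thesis
    using \<kappa>\<theta> cont\<theta> incr that by blast
qed

lemma orbit_in_subset:
  assumes "z \<in> R"
  shows "h ` orbit_in F R z \<subseteq> orbit_in G Q (h z)"
proof
  fix w assume "w \<in> h ` orbit_in F R z"
  then obtain \<psi> t J where J: "open J" "is_interval J" "0 \<in> J" "t \<in> J" and sol: "solution_on F \<psi> J"
      and \<psi>: "\<psi> ` J \<subseteq> R" "\<psi> 0 = z" "w = h (\<psi> t)"
    unfolding orbit_in_def by blast
  have "continuous_on J (\<lambda>r. s (\<psi> r))"
    by (rule continuous_on_compose2[OF cont(3) solution_on_continuous[OF sol] \<psi>(1)])
  then obtain \<theta> where \<theta>: "\<theta> 0 = 0" "\<And>r. r \<in> J \<Longrightarrow> (\<theta> has_real_derivative s (\<psi> r)) (at r within J)"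
    using antiderivative_on_open_interval[OF J(2,1,3)] by blast
  obtain \<kappa> where \<kappa>: "\<And>r. r \<in> J \<Longrightarrow> \<kappa> (\<theta> r) = r"
      "solution_on G (\<lambda>t. h (\<psi> (\<kappa> t))) (\<theta> ` J)" "continuous_on J \<theta>"
      "\<And>x y. x \<in> J \<Longrightarrow> y \<in> J \<Longrightarrow> x < y \<Longrightarrow> \<theta> x < \<theta> y"
    by (rule reparametrize[OF J(2) zero_less_one, of \<psi> \<theta>, unfolded scaleR_one mult_1, OF sol \<psi>(1) \<theta>(2)]) blast+
  have "inj_on \<theta> J"
    using \<kappa>(1) by (metis inj_onI)
  then have "open (\<theta> ` J)"
    by (rule invariance_of_domain[OF \<kappa>(3) J(1)])
  moreover have "is_interval (\<theta> ` J)"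
    using J(2) \<kappa>(3) by (simp add: is_interval_connected_1 connected_continuous_image)
  moreover have "0 \<in> \<theta> ` J"
    using J(3) \<theta>(1) by (metis imageI)
  moreover have "(\<lambda>t. h (\<psi> (\<kappa> t))) ` \<theta> ` J \<subseteq> Q"
  proof -
    have "(\<lambda>t. h (\<psi> (\<kappa> t))) ` \<theta> ` J = h ` \<psi> ` J"
      unfolding image_image by (rule image_cong) (simp_all add: \<kappa>(1))
    then show ?thesis
      using image_subset[OF \<psi>(1)] by simp
  qed
  ultimately show "w \<in> orbit_in G Q (h z)"
    using \<kappa>(1)[OF J(3)] \<kappa>(1)[OF J(4)] \<kappa>(2) \<psi> \<theta>(1) J(4) unfolding orbit_in_def
    by (intro CollectI exI[of _ "\<lambda>t. h (\<psi> (\<kappa> t))"] exI[of _ "\<theta> t"] exI[of _ "\<theta> ` J"]) auto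
qed

lemma orbit_in_image:
  assumes "z \<in> R"
  shows "h ` orbit_in F R z = orbit_in G Q (h z)"
proof
  show "h ` orbit_in F R z \<subseteq> orbit_in G Q (h z)"
    using assms by (rule orbit_in_subset)
  interpret inverse: orbit_equivalence G F Q R g h "\<lambda>w. 1 / a (g w)" "\<lambda>w. 1 / b (g w)" "\<lambda>w. 1 / s (g w)"
    by (rule sym)
  have "g ` orbit_in G Q (h z) \<subseteq> orbit_in F R z"
    using inverse.orbit_in_subset[OF h_mem[OF assms]] gh[OF assms] by simp
  moreover have "orbit_in G Q (h z) \<subseteq> Q"
    unfolding orbit_in_def by blast
  ultimately show "orbit_in G Q (h z) \<subseteq> h ` orbit_in F R z"
    using hg by (metis image_mono inverse.image_image_inverse)
qed

lemma periodic_orbit_image: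
  assumes "periodic_orbit F \<delta>" "\<delta> \<subseteq> R"
  shows "periodic_orbit G (h ` \<delta>)"
proof -
  obtain \<psi> T where sol: "solution_on F \<psi> UNIV" and T: "T > 0" "\<And>t. \<psi> (t + T) = \<psi> t"
      and \<delta>: "\<delta> = range \<psi>" and nz: "\<And>z. z \<in> \<delta> \<Longrightarrow> F z \<noteq> 0"
    using assms(1) unfolding periodic_orbit_def by blast
  have sub: "range \<psi> \<subseteq> R"
    using assms(2) \<delta> by simp
  have "continuous_on UNIV (\<lambda>r. s (\<psi> r))"
    by (rule continuous_on_compose2[OF cont(3) solution_on_continuous[OF sol] sub])
  then obtain \<theta> where \<theta>: "\<theta> 0 = 0" "\<And>r. (\<theta> has_real_derivative s (\<psi> r)) (at r)"
    using antiderivative_on_open_interval[of UNIV] by auto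
  obtain \<kappa> where \<kappa>: "\<And>r. \<kappa> (\<theta> r) = r"
      "solution_on G (\<lambda>t. h (\<psi> (\<kappa> t))) (range \<theta>)" "continuous_on UNIV \<theta>"
      "\<And>x y. x < y \<Longrightarrow> \<theta> x < \<theta> y"
    by (rule reparametrize[OF is_interval_univ zero_less_one, of \<psi> \<theta>, unfolded scaleR_one mult_1, OF sol sub \<theta>(2)]) blast+
  \<comment> \<open>The speed along the orbit has period \<open>T\<close>, so the clock gains the
    same amount over every period; this gain \<open>\<theta> T\<close> becomes the period of the
    image.\<close>
  have "((\<lambda>r. \<theta> (r + T) - \<theta> r) has_real_derivative 0) (at r)" for r
    using DERIV_diff[OF \<theta>(2)[of "r + T", unfolded DERIV_shift] \<theta>(2)[of r]] T(2) by simp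
  then have const: "\<theta> (r + T) - \<theta> r = \<theta> (0 + T) - \<theta> 0" for r
    using DERIV_isconst_all by blast
  have shift: "\<theta> (r + T) = \<theta> r + \<theta> T" for r
    using const[of r] \<theta>(1) by simp
  have \<theta>T: "\<theta> T > 0"
    using \<kappa>(4)[OF T(1)] \<theta>(1) by simp
  have mult: "\<theta> (r + real n * T) = \<theta> r + real n * \<theta> T" for n r
  proof (induction n)
    case (Suc n)
    then show ?case
      using shift[of "r + real n * T"] by (simp add: algebra_simps)
  qed simp
  \<comment> \<open>The image solution must live on the whole line. The clock gains the positive
    amount \<open>\<theta> T\<close> with each period, so it runs through all real values.\<close>
  have "\<exists>x. y = \<theta> x" for y
  proof -
    obtain n where n: "\<bar>y\<bar> < real n * \<theta> T"
      using reals_Archimedean3[OF \<theta>T] by blast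
    have "\<theta> (- (real n * T)) \<le> y" "y \<le> \<theta> (real n * T)"
      using mult[of "- (real n * T)" n] mult[of 0 n] \<theta>(1) n by auto
    then show ?thesis
      using IVT'[of \<theta> "- (real n * T)" y "real n * T"] T(1) continuous_on_subset[OF \<kappa>(3)]
      by (auto simp: mult_nonneg_nonneg)
  qed
  then have surj: "range \<theta> = UNIV"
    by auto
  have "h (\<psi> (\<kappa> (t + \<theta> T))) = h (\<psi> (\<kappa> t))" for t
  proof -
    obtain r where "t = \<theta> r" using surj by blast
    then show ?thesis
      using shift[of r] \<kappa>(1) T(2) by metis
  qed
  moreover have "range (\<lambda>t. h (\<psi> (\<kappa> t))) = h ` \<delta>"
  proof -
    have "(\<lambda>t. h (\<psi> (\<kappa> t))) ` range \<theta> = h ` range \<psi>"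
      unfolding image_image \<kappa>(1) ..
    then show ?thesis
      by (simp add: surj \<delta>)
  qed
  moreover have "G w \<noteq> 0" if w: "w \<in> h ` \<delta>" for w
  proof
    assume "G w = 0"
    obtain z where z: "z \<in> \<delta>" "w = h z" using w by blast
    then have "z \<in> R" using assms(2) by blast
    then have "a z * fst (F z) = 0" "b z * snd (F z) = 0"
      using field[of z] \<open>G w = 0\<close> z(2) by (simp_all add: zero_prod_def)
    then have "F z = 0"
      using nonzero \<open>z \<in> R\<close> by (simp add: prod_eq_iff)
    then show False
      using nz z(1) by blast
  qed
  ultimately show ?thesis
    using \<kappa>(2) \<theta>T unfolding periodic_orbit_def surj
    by (intro conjI exI[of _ "\<lambda>t. h (\<psi> (\<kappa> t))"] exI[of _ "\<theta> T"]) simp_all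
qed

text \<open>The determinant of tangent and field is multiplied by a b / s, which is not
  zero.\<close>

lemma transverse_section_image:
  assumes "transverse_section F \<Sigma>" "\<Sigma> \<subseteq> R"
  shows "transverse_section G (h ` \<Sigma>)"
proof -
  obtain \<sigma> \<sigma>' \<rho> where \<sigma>: "homeomorphism {-1<..<1} \<Sigma> \<sigma> \<rho>" "continuous_on {-1<..<1::real} \<sigma>'"
    and der: "\<And>t. t \<in> {-1<..<1} \<Longrightarrow> (\<sigma> has_vector_derivative \<sigma>' t) (at t)"
    and det: "\<And>t. t \<in> {-1<..<1} \<Longrightarrow> fst (\<sigma>' t) * snd (F (\<sigma> t)) - snd (\<sigma>' t) * fst (F (\<sigma> t)) \<noteq> 0"
    using assms(1) unfolding transverse_section_def by blast
  have "homeomorphism \<Sigma> (h ` \<Sigma>) h g"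
    by (rule homeomorphism_of_subsets[OF hom assms(2)]) (use hom assms(2) in \<open>auto simp: homeomorphism_def\<close>)
  from homeomorphism_compose[OF \<sigma>(1) this]
  have "homeomorphism {-1<..<1} (h ` \<Sigma>) (h \<circ> \<sigma>) (\<rho> \<circ> g)" .
  moreover have mem: "\<sigma> t \<in> R" if "t \<in> {-1<..<1}" for t
    using \<sigma>(1) assms(2) that unfolding homeomorphism_def by blast
  define \<eta> where "\<eta> t = (a (\<sigma> t) * fst (\<sigma>' t), b (\<sigma> t) * snd (\<sigma>' t))" for t
  have "continuous_on {-1<..<1} \<sigma>"
    using \<sigma>(1) by (simp add: homeomorphism_def)
  then have "continuous_on {-1<..<1} \<eta>"
    unfolding \<eta>_def[abs_def]
    by (intro continuous_intros continuous_on_compose2[OF cont(1)] continuous_on_compose2[OF cont(2)] \<sigma>(2))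
       (use mem in blast)+
  moreover have "((h \<circ> \<sigma>) has_vector_derivative \<eta> t) (at t)" if "t \<in> {-1<..<1}" for t
    unfolding \<eta>_def
    by (rule vector_derivative_diff_chain_within[OF der[OF that] has_derivative_at_withinI[OF dh[OF mem[OF that]]]])
  moreover have "fst (\<eta> t) * snd (G ((h \<circ> \<sigma>) t)) - snd (\<eta> t) * fst (G ((h \<circ> \<sigma>) t)) \<noteq> 0"
    if t: "t \<in> {-1<..<1}" for t
  proof
    assume zero: "fst (\<eta> t) * snd (G ((h \<circ> \<sigma>) t)) - snd (\<eta> t) * fst (G ((h \<circ> \<sigma>) t)) = 0"
    let ?a = "a (\<sigma> t)" and ?b = "b (\<sigma> t)" and ?s = "s (\<sigma> t)"
    have f: "?a * fst (F (\<sigma> t)) = ?s * fst (G (h (\<sigma> t)))" "?b * snd (F (\<sigma> t)) = ?s * snd (G (h (\<sigma> t)))"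
      using field[OF mem[OF t]] by (auto simp: prod_eq_iff)
    have "?a * ?b * (fst (\<sigma>' t) * snd (F (\<sigma> t)) - snd (\<sigma>' t) * fst (F (\<sigma> t))) =
        ?a * fst (\<sigma>' t) * (?b * snd (F (\<sigma> t))) - ?b * snd (\<sigma>' t) * (?a * fst (F (\<sigma> t)))"
      by (simp add: algebra_simps)
    also have "\<dots> = ?s * (fst (\<eta> t) * snd (G ((h \<circ> \<sigma>) t)) - snd (\<eta> t) * fst (G ((h \<circ> \<sigma>) t)))"
      unfolding f by (simp add: \<eta>_def algebra_simps)
    finally show False
      using zero det[OF t] nonzero[OF mem[OF t]] by simp
  qed
  ultimately show ?thesis
    unfolding transverse_section_def by blast
qed

text \<open>The last claim carries over minimality of return times: at every time strictly before
  \<open>T\<close> the image trajectory sits at the image of an inner point of the segment.\<close>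

lemma flows_to_image:
  assumes "c > 0" and sol: "solution_on (\<lambda>z. c *\<^sub>R F z) \<psi> {0..1}" and sub: "\<psi> ` {0..1} \<subseteq> R"
  defines "T \<equiv> integral {0..1} (\<lambda>t. c * s (\<psi> t))"
  shows "T > 0" and "flows_to G (h (\<psi> 0)) T (h (\<psi> 1))"
    and "\<And>t. 0 < t \<Longrightarrow> t < T \<Longrightarrow> \<exists>r\<in>{0<..<1}. flows_to G (h (\<psi> 0)) t (h (\<psi> r))"
proof -
  define \<theta> where "\<theta> r = integral {0..r} (\<lambda>t. c * s (\<psi> t))" for r
  have conts: "continuous_on {0..1} (\<lambda>t. c * s (\<psi> t))"
    by (intro continuous_intros continuous_on_compose2[OF cont(3) solution_on_continuous[OF sol] sub])
  have d\<theta>: "(\<theta> has_real_derivative c * s (\<psi> r)) (at r within {0..1})" if "r \<in> {0..1}" for r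
    unfolding \<theta>_def[abs_def] by (rule integral_has_real_derivative[OF conts that])
  have "is_interval {0..1::real}"
    by (rule is_interval_cc)
  then obtain \<kappa> where \<kappa>: "\<And>r. r \<in> {0..1} \<Longrightarrow> \<kappa> (\<theta> r) = r"
      "solution_on G (\<lambda>t. h (\<psi> (\<kappa> t))) (\<theta> ` {0..1})" "continuous_on {0..1} \<theta>"
      "\<And>x y. x \<in> {0..1} \<Longrightarrow> y \<in> {0..1} \<Longrightarrow> x < y \<Longrightarrow> \<theta> x < \<theta> y"
    using reparametrize[OF _ \<open>c > 0\<close> sol sub d\<theta>] by blast
  have \<theta>01: "\<theta> 0 = 0" "\<theta> 1 = T"
    by (simp_all add: \<theta>_def T_def)
  have ivt: "\<exists>x\<in>{0..r}. \<theta> x = t" if r: "r \<in> {0..1}" and t: "t \<in> {0..\<theta> r}" for r t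
    using IVT'[of \<theta> 0 t r] continuous_on_subset[OF \<kappa>(3), of "{0..r}"] r t \<theta>01 by auto
  have flow: "flows_to G (h (\<psi> 0)) (\<theta> r) (h (\<psi> r))" if r: "r \<in> {0..1}" for r
  proof -
    have "{0..\<theta> r} \<subseteq> \<theta> ` {0..1}"
      using ivt[OF r] r by fastforce
    then have "solution_on G (\<lambda>t. h (\<psi> (\<kappa> t))) {0..\<theta> r}"
      using \<kappa>(2) by (rule solution_on_subset[rotated])
    moreover have "\<kappa> 0 = 0"
      using \<kappa>(1)[of 0] \<theta>01 by simp
    moreover have "0 \<le> \<theta> r"
      using \<kappa>(4)[of 0 r] r \<theta>01 by (cases "r = 0") auto
    ultimately show ?thesis
      unfolding flows_to_def using \<kappa>(1)[OF r]
      by (intro conjI exI[of _ "\<lambda>t. h (\<psi> (\<kappa> t))"]) simp_all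
  qed
  show "T > 0"
    using \<kappa>(4)[of 0 1] \<theta>01 by simp
  show "flows_to G (h (\<psi> 0)) T (h (\<psi> 1))"
    using flow[of 1] \<theta>01 by simp
  show "\<exists>r\<in>{0<..<1}. flows_to G (h (\<psi> 0)) t (h (\<psi> r))" if t: "0 < t" "t < T" for t
  proof -
    obtain r where r: "r \<in> {0..1}" "\<theta> r = t"
      using ivt[of 1 t] t \<theta>01 by auto
    then have "r \<noteq> 0" "r \<noteq> 1"
      using t \<theta>01 by auto
    then show ?thesis
      using r flow[OF r(1)] by (intro bexI[of _ r]) auto
  qed
qed

text \<open>The new return time is the integral of \<open>s\<close> along the old orbit segment. The
  hypotheses on \<open>h\<close> hold on \<open>R\<close> only, so the domain is cut down to points
  whose whole segment stays in \<open>R\<close>; that this leaves a neighbourhood of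
  \<open>q\<close> is part of the claim.\<close>

lemma local_return_map_image:
  assumes ret: "local_return_map F \<delta> \<Sigma> q f" and sub: "\<delta> \<subseteq> R" "\<Sigma> \<subseteq> R"
  shows "local_return_map G (h ` \<delta>) (h ` \<Sigma>) (h q) (\<lambda>w. h (f (g w)))"
proof -
  obtain S \<tau> where S: "openin (top_of_set \<Sigma>) S" "q \<in> S" "continuous_on S \<tau>" and fq: "f q = q"
      and early: "\<And>t. 0 < t \<Longrightarrow> t < \<tau> q \<Longrightarrow> \<not> flows_to F q t q"
      and \<tau>: "\<And>z. z \<in> S \<Longrightarrow> \<tau> z > 0" and f\<Sigma>: "\<And>z. z \<in> S \<Longrightarrow> f z \<in> \<Sigma>"
      and fl: "\<And>z. z \<in> S \<Longrightarrow> flows_to F z (\<tau> z) (f z)"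
    using ret unfolding local_return_map_def by blast
  have q: "q \<in> \<Sigma>" "q \<in> \<delta>" and per: "periodic_orbit F \<delta>" and trans: "transverse_section F \<Sigma>"
    using ret by (auto simp: local_return_map_def)
  have "\<exists>\<phi>. solution_on F \<phi> {0..\<tau> z} \<and> \<phi> 0 = z \<and> \<phi> (\<tau> z) = f z" if "z \<in> S" for z
    using fl[OF that] unfolding flows_to_def by blast
  then obtain \<phi> where \<phi>: "\<And>z. z \<in> S \<Longrightarrow> solution_on F (\<phi> z) {0..\<tau> z}"
      "\<And>z. z \<in> S \<Longrightarrow> \<phi> z 0 = z" "\<And>z. z \<in> S \<Longrightarrow> \<phi> z (\<tau> z) = f z"
    by metis
  define \<Psi> where "\<Psi> z r = \<phi> z (\<tau> z * r)" for z r
  have \<Psi>: "solution_on (\<lambda>x. \<tau> z *\<^sub>R F x) (\<Psi> z) {0..1}" "\<Psi> z 0 = z" "\<Psi> z 1 = f z" if "z \<in> S" for z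
    using solution_on_rescale[OF \<phi>(1)[OF that]] \<phi>(2,3)[OF that] \<tau>[OF that]
    by (simp_all add: \<Psi>_def[abs_def])
  define S0 where "S0 = {z \<in> S. \<Psi> z ` {0..1} \<subseteq> R}"
  have S0S: "z \<in> S" and S0R: "\<Psi> z ` {0..1} \<subseteq> R" if "z \<in> S0" for z
    using that by (auto simp: S0_def)
  have S\<Sigma>: "S \<subseteq> \<Sigma>"
    using S(1) by (rule openin_imp_subset)
  \<comment> \<open>By uniqueness the segment from \<open>q\<close> runs along \<delta>, which lies
    in \<open>R\<close>.\<close>
  have "q \<in> S0"
  proof -
    obtain \<omega> where \<omega>: "solution_on F \<omega> UNIV" "\<delta> = range \<omega>"
      using per unfolding periodic_orbit_def by blast
    then obtain t0 where t0: "q = \<omega> t0"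
      using q(2) by blast
    have "solution_on F (\<lambda>t. \<omega> (t0 + t)) {0..\<tau> q}"
      using solution_on_affine[OF \<omega>(1), of "{0..\<tau> q}" t0 1] by simp
    then have eq: "\<phi> q t = \<omega> (t0 + t)" if "t \<in> {0..\<tau> q}" for t
      by (rule solution_on_unique[OF lipF \<phi>(1)[OF S(2)] _ _ that]) (use \<phi>(2)[OF S(2)] t0 in simp)
    have "\<Psi> q r \<in> R" if "r \<in> {0..1}" for r
    proof -
      have "\<tau> q * r \<in> {0..\<tau> q}"
        using that \<tau>[OF S(2)] by (simp add: mult_left_le)
      from eq[OF this] have "\<Psi> q r \<in> \<delta>"
        by (simp add: \<Psi>_def \<omega>(2))
      with sub(1) show ?thesis by blast
    qed
    then show ?thesis
      using S(2) by (auto simp: S0_def)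
  qed
  have openS0: "openin (top_of_set \<Sigma>) S0"
    unfolding openin_euclidean_subtopology_iff
  proof (intro conjI ballI)
    show "S0 \<subseteq> \<Sigma>"
      using S\<Sigma> S0S by blast
    fix z0 assume z0: "z0 \<in> S0"
    \<comment> \<open>A compact segment in the open set \<open>R\<close> has a margin \<epsilon>,
      and the segments of nearby points are within \<epsilon> of it for all \<open>r\<close> at
      once.\<close>
    have "compact (\<Psi> z0 ` {0..1})"
      by (intro compact_continuous_image solution_on_continuous[OF \<Psi>(1)[OF S0S[OF z0]]] compact_Icc)
    then obtain \<epsilon> where \<epsilon>: "\<epsilon> > 0" "(\<Union>x\<in>\<Psi> z0 ` {0..1}. ball x \<epsilon>) \<subseteq> R"
      using compact_subset_open_imp_ball_epsilon_subset[OF _ openR S0R[OF z0]] by metis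
    obtain d where d: "d > 0"
      "\<And>z r. z \<in> S \<Longrightarrow> dist z z0 < d \<Longrightarrow> r \<in> {0..1} \<Longrightarrow> dist (\<Psi> z r) (\<Psi> z0 r) < \<epsilon>"
      by (rule flow_family_close[OF lipF S(3) \<Psi>(1,2) S0S[OF z0] \<epsilon>(1)]) blast+
    obtain e where e: "e > 0" "\<And>z. z \<in> \<Sigma> \<Longrightarrow> dist z z0 < e \<Longrightarrow> z \<in> S"
      using S(1) S0S[OF z0] unfolding openin_euclidean_subtopology_iff by blast
    have "z \<in> S0" if z: "z \<in> \<Sigma>" "dist z z0 < min d e" for z
    proof -
      have "z \<in> S"
        using e(2) z by simp
      moreover have "\<Psi> z r \<in> R" if "r \<in> {0..1}" for r
      proof -
        have "\<Psi> z r \<in> ball (\<Psi> z0 r) \<epsilon>"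
          using d(2)[OF \<open>z \<in> S\<close> _ that] z(2) by (simp add: dist_commute)
        then show ?thesis
          using \<epsilon>(2) that by blast
      qed
      ultimately show ?thesis
        by (auto simp: S0_def)
    qed
    then show "\<exists>e>0. \<forall>z\<in>\<Sigma>. dist z z0 < e \<longrightarrow> z \<in> S0"
      using d(1) e(1) by (intro exI[of _ "min d e"]) simp
  qed
  define T where "T z = integral {0..1} (\<lambda>r. \<tau> z * s (\<Psi> z r))" for z
  have T: "T z > 0" "flows_to G (h z) (T z) (h (f z))"
    "\<And>t. 0 < t \<Longrightarrow> t < T z \<Longrightarrow> \<exists>r\<in>{0<..<1}. flows_to G (h z) t (h (\<Psi> z r))" if z: "z \<in> S0" for z
    using flows_to_image[OF \<tau>[OF S0S[OF z]] \<Psi>(1)[OF S0S[OF z]] S0R[OF z]]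
    unfolding T_def \<Psi>(2,3)[OF S0S[OF z]] by blast+
  have S0sub: "S0 \<subseteq> S" "S0 \<subseteq> R"
    using S0S S\<Sigma> sub(2) by blast+
  have "continuous_on S0 T"
  proof -
    have joint: "continuous_on (S0 \<times> {0..1}) (\<lambda>(z, r). \<Psi> z r)"
      by (rule flow_family_jointly_continuous[OF lipF continuous_on_subset[OF S(3) S0sub(1)] \<Psi>(1,2)])
         (use S0S in blast)+
    have "continuous_on (S0 \<times> {0..1}) (\<lambda>p. \<tau> (fst p) * s (case p of (z, r) \<Rightarrow> \<Psi> z r))"
      by (intro continuous_intros continuous_on_compose2[OF S(3)] continuous_on_compose2[OF cont(3) joint])
         (use S0S S0R in fastforce)+
    then have "continuous_on (S0 \<times> cbox 0 1) (\<lambda>(z, r). \<tau> z * s (\<Psi> z r))"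
      by (simp add: case_prod_unfold)
    \<comment> \<open>The integrand is jointly continuous in the point and the rescaled time, so its
      integral is continuous in the point.\<close>
    from integral_continuous_on_param[OF this] show ?thesis
      by (simp add: T_def[abs_def])
  qed
  have hom\<Sigma>: "homeomorphism \<Sigma> (h ` \<Sigma>) h g"
    by (rule homeomorphism_of_subsets[OF hom sub(2)]) (use hom sub(2) in \<open>auto simp: homeomorphism_def\<close>)
  show ?thesis
    unfolding local_return_map_def
  proof (intro conjI exI[of _ "h ` S0"] exI[of _ "\<lambda>w. T (g w)"] ballI allI impI)
    show "periodic_orbit G (h ` \<delta>)"
      by (rule periodic_orbit_image[OF per sub(1)])
    show "transverse_section G (h ` \<Sigma>)"
      by (rule transverse_section_image[OF trans sub(2)])
    show "h q \<in> h ` \<delta> \<inter> h ` \<Sigma>" "h q \<in> h ` S0"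
      using q \<open>q \<in> S0\<close> by auto
    show "openin (top_of_set (h ` \<Sigma>)) (h ` S0)"
      by (rule homeomorphism_imp_open_map[OF hom\<Sigma> openS0])
    have "g ` h ` S0 \<subseteq> S0" "h ` S0 \<subseteq> Q"
      using image_image_inverse[OF S0sub(2)] image_subset[OF S0sub(2)] by simp_all
    then show "continuous_on (h ` S0) (\<lambda>w. T (g w))"
      using continuous_on_compose2[OF \<open>continuous_on S0 T\<close> continuous_on_subset[OF contg]] by blast
    have "q \<in> R"
      using q sub by blast
    then have ghq: "g (h q) = q"
      by (rule gh)
    then show "h (f (g (h q))) = h q"
      by (simp add: fq)
    show "\<not> flows_to G (h q) t (h q)" if t: "0 < t \<and> t < T (g (h q))" for t
    proof
      assume flow: "flows_to G (h q) t (h q)"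
      obtain r where r: "r \<in> {0<..<1}" "flows_to G (h q) t (h (\<Psi> q r))"
        using T(3)[OF \<open>q \<in> S0\<close>, of t] t ghq by auto
      have "h (\<Psi> q r) = h q"
        by (rule flows_to_unique[OF lipG r(2) flow])
      moreover have "\<Psi> q r \<in> R"
        using S0R[OF \<open>q \<in> S0\<close>] r(1) by (meson greaterThanLessThan_iff image_subset_iff atLeastAtMost_iff less_imp_le)
      \<comment> \<open>A premature return of the image would, by injectivity of \<open>h\<close>,
        be a return of \<open>q\<close> itself at time \<open>\<tau> q * r\<close>, which is less
        than \<open>\<tau> q\<close>.\<close>
      ultimately have "\<Psi> q r = q"
        using gh \<open>q \<in> R\<close> by metis
      have lt: "0 < \<tau> q * r" "\<tau> q * r < \<tau> q"
        using r(1) \<tau>[OF S(2)] by auto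
      have "solution_on F (\<phi> q) {0..\<tau> q * r}"
        by (rule solution_on_subset[OF \<phi>(1)[OF S(2)]]) (simp only: atLeastatMost_subset_iff less_imp_le[OF lt(2)], simp)
      then have "flows_to F q (\<tau> q * r) q"
        using lt \<phi>(2)[OF S(2)] \<open>\<Psi> q r = q\<close> unfolding flows_to_def \<Psi>_def by (meson less_imp_le)
      then show False
        using early lt by blast
    qed
  next
    fix w assume "w \<in> h ` S0"
    then obtain z where z: "z \<in> S0" "w = h z" by blast
    then have "g w = z"
      using gh S0sub(2) by blast
    then show "T (g w) > 0" "h (f (g w)) \<in> h ` \<Sigma>" "flows_to G w (T (g w)) (h (f (g w)))"
      using T[OF z(1)] f\<Sigma>[OF S0S[OF z(1)]] z(2) by simp_all
  qed
qed

end

section \<open>Two-sided transport of orbits, sections, germs and limit cycles\<close>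

lemma periodic_orbit_reverse_iff: "periodic_orbit (\<lambda>z. - F z) \<gamma> \<longleftrightarrow> periodic_orbit F \<gamma>"
  using periodic_orbit_reverse[of F \<gamma>] periodic_orbit_reverse[of "\<lambda>z. - F z" \<gamma>] by auto

lemma transverse_section_reverse_iff: "transverse_section (\<lambda>z. - F z) \<Sigma> \<longleftrightarrow> transverse_section F \<Sigma>"
  using transverse_section_reverse[of F \<Sigma>] transverse_section_reverse[of "\<lambda>z. - F z" \<Sigma>] by auto

lemma limit_cycle_reverse_iff: "limit_cycle (\<lambda>z. - F z) \<gamma> \<longleftrightarrow> limit_cycle F \<gamma>"
  unfolding limit_cycle_def periodic_orbit_reverse_iff ..

lemma local_return_map_reverse_iff:
  assumes "lipschitz_on_balls F"
  shows "(\<exists>f. local_return_map (\<lambda>z. - F z) \<gamma> \<Sigma> q f) \<longleftrightarrow> (\<exists>f. local_return_map F \<gamma> \<Sigma> q f)"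
proof -
  have *: "\<exists>f. local_return_map (\<lambda>z. - F z) \<gamma> \<Sigma> q f"
    if "lipschitz_on_balls F" "local_return_map F \<gamma> \<Sigma> q f" for F f
    using local_return_map_reverse[OF that] by blast
  show ?thesis
    using *[OF assms] *[OF lipschitz_on_balls_minus[OF assms]] by auto
qed

context orbit_equivalence
begin

lemma periodic_orbit_iff: "\<delta> \<subseteq> R \<Longrightarrow> periodic_orbit F \<delta> \<longleftrightarrow> periodic_orbit G (h ` \<delta>)"
  using periodic_orbit_image orbit_equivalence.periodic_orbit_image[OF sym]
  by (metis image_subset image_image_inverse)

lemma transverse_section_iff: "\<Sigma> \<subseteq> R \<Longrightarrow> transverse_section F \<Sigma> \<longleftrightarrow> transverse_section G (h ` \<Sigma>)"
  using transverse_section_image orbit_equivalence.transverse_section_image[OF sym]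
  by (metis image_subset image_image_inverse)

lemma local_return_map_iff:
  assumes "\<delta> \<subseteq> R" "\<Sigma> \<subseteq> R" "q \<in> R"
  shows "(\<exists>f. local_return_map F \<delta> \<Sigma> q f) \<longleftrightarrow>
    (\<exists>k. local_return_map G (h ` \<delta>) (h ` \<Sigma>) (h q) k)"
  using local_return_map_image[OF _ assms(1,2)]
    orbit_equivalence.local_return_map_image[OF sym _ image_subset[OF assms(1)] image_subset[OF assms(2)], of "h q"]
  unfolding image_image_inverse[OF assms(1)] image_image_inverse[OF assms(2)] gh[OF assms(3)] by blast

lemma eventually_near_image:
  assumes "\<Sigma> \<subseteq> R" "q \<in> \<Sigma>"
  shows "eventually_near (h ` \<Sigma>) (h q) P \<longleftrightarrow> eventually_near \<Sigma> q (\<lambda>z. P (h z))"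
proof
  assume "eventually_near (h ` \<Sigma>) (h q) P"
  then show "eventually_near \<Sigma> q (\<lambda>z. P (h z))"
    by (intro eventually_near_continuous[OF continuous_on_subset[OF conth assms(1)]]) (use assms in auto)
next
  assume ev: "eventually_near \<Sigma> q (\<lambda>z. P (h z))"
  have q: "g (h q) = q"
    using assms gh by blast
  have "eventually_near (h ` \<Sigma>) (h q) (\<lambda>w. P (h (g w)))"
  proof (rule eventually_near_continuous[OF continuous_on_subset[OF contg image_subset[OF assms(1)]]])
    show "eventually_near \<Sigma> (g (h q)) (\<lambda>z. P (h z))"
      unfolding q by (rule ev)
    show "g w \<in> \<Sigma>" if "w \<in> h ` \<Sigma>" for w
      using image_image_inverse[OF assms(1)] that by blast
  qed (use assms in auto)
  then show "eventually_near (h ` \<Sigma>) (h q) P"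
    by (rule eventually_near_mono) (use image_subset[OF assms(1)] hg in \<open>metis subsetD\<close>)
qed

text \<open>The map h f g is itself a return map of the image section, so uniqueness of germs
  identifies it with \<open>k\<close> near \<open>h q\<close>.\<close>

lemma germ_conjugate_local_return_map:
  assumes "local_return_map F \<delta> \<Sigma> q f" "local_return_map G (h ` \<delta>) (h ` \<Sigma>) (h q) k"
    and sub: "\<delta> \<subseteq> R" "\<Sigma> \<subseteq> R"
  shows "germ_conjugate h \<Sigma> q f k"
proof -
  have "q \<in> \<Sigma>"
    using assms(1) by (auto simp: local_return_map_def)
  have "eventually_near (h ` \<Sigma>) (h q) (\<lambda>w. h (f (g w)) = k w)"
    by (rule local_return_map_unique[OF lipG local_return_map_image[OF assms(1) sub] assms(2)])
  then show ?thesis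
    unfolding eventually_near_image[OF sub(2) \<open>q \<in> \<Sigma>\<close>] germ_conjugate_def
    by (rule eventually_near_mono) (use gh sub(2) in \<open>metis subsetD\<close>)
qed

text \<open>The isolating neighbourhood is pulled back by \<open>h\<close> and cut with
  \<open>R\<close>. A periodic orbit inside it lies in \<open>R\<close>, so its image is a periodic
  orbit in \<open>U\<close> and must be \<gamma>.\<close>

lemma limit_cycle_lift:
  assumes "limit_cycle G \<gamma>" "\<gamma> \<subseteq> Q"
  shows "limit_cycle F (g ` \<gamma>)"
proof -
  interpret inverse: orbit_equivalence G F Q R g h "\<lambda>w. 1 / a (g w)" "\<lambda>w. 1 / b (g w)" "\<lambda>w. 1 / s (g w)"
    by (rule sym)
  obtain U where U: "open U" "\<gamma> \<subseteq> U" "\<And>\<gamma>'. periodic_orbit G \<gamma>' \<Longrightarrow> \<gamma>' \<subseteq> U \<Longrightarrow> \<gamma>' = \<gamma>"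
    using assms(1) unfolding limit_cycle_def by blast
  have "periodic_orbit F (g ` \<gamma>)"
    using inverse.periodic_orbit_image assms unfolding limit_cycle_def by blast
  moreover have "open (R \<inter> h -` U)"
    by (rule continuous_open_preimage[OF conth openR U(1)])
  moreover have "g ` \<gamma> \<subseteq> R \<inter> h -` U"
    using inverse.image_subset[OF assms(2)] inverse.image_image_inverse[OF assms(2)] U(2) by blast
  moreover have "\<delta> = g ` \<gamma>" if "periodic_orbit F \<delta>" "\<delta> \<subseteq> R \<inter> h -` U" for \<delta>
  proof -
    have "\<delta> \<subseteq> R" "h ` \<delta> \<subseteq> U"
      using that(2) by auto
    then show ?thesis
      using U(3) periodic_orbit_image[OF that(1)] image_image_inverse by metis
  qed
  ultimately show ?thesis
    unfolding limit_cycle_def by blast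
qed

end

text \<open>The equivalence concerns the reversed field, whose return map is the germ
  \<open>f'\<close> inverse to \<open>f\<close>. Thus \<open>h\<close> conjugates \<open>f'\<close>,
  not \<open>f\<close>, to \<open>k\<close>.\<close>

lemma germ_conjugate_inverse_local_return_map:
  assumes "orbit_equivalence (\<lambda>z. - F z) G R Q h g a b s" and lip: "lipschitz_on_balls F"
    and ret: "local_return_map F \<delta> \<Sigma> q f" "local_return_map G (h ` \<delta>) (h ` \<Sigma>) (h q) k"
    and sub: "\<delta> \<subseteq> R" "\<Sigma> \<subseteq> R"
  shows "germ_conjugate_inverse h R \<Sigma> q f k"
proof -
  interpret orbit_equivalence "\<lambda>z. - F z" G R Q h g a b s
    by fact
  have q: "q \<in> \<Sigma>"
    using ret(1) by (auto simp: local_return_map_def)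
  obtain f' where f': "local_return_map (\<lambda>z. - F z) \<delta> \<Sigma> q f'"
      and inv: "eventually_near \<Sigma> q (\<lambda>z. f' (f z) = z \<and> f (f' z) = z)"
    by (rule local_return_map_reverse[OF lip ret(1)])
  have conj: "eventually_near \<Sigma> q (\<lambda>z. h (f' z) = k (h z))"
    using germ_conjugate_local_return_map[OF f' ret(2) sub] unfolding germ_conjugate_def .
  have "eventually_near \<Sigma> q (\<lambda>z. z \<in> \<Sigma>)"
    unfolding eventually_near_iff by (intro exI[of _ 1]) simp
  then have mem: "eventually_near \<Sigma> q (\<lambda>z. f' z \<in> \<Sigma>)"
    by (rule local_return_map_eventually[OF lipF f'])
  have inv_into: "the_inv_into R h (h z) = z" if "z \<in> \<Sigma>" for z
    using the_inv_into_f_f[of h R z] that sub(2) gh by (metis inj_onI subsetD)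
  \<comment> \<open>The conjugacy is needed at \<open>f z\<close> for one composition and at
    \<open>z\<close> for the other; \<open>f' z \<in> \<Sigma>\<close> allows
    \<open>the_inv_into\<close> to cancel \<open>h\<close> there.\<close>
  have "eventually_near \<Sigma> q (\<lambda>z. (f' (f z) = z \<and> f (f' z) = z) \<and> h (f' (f z)) = k (h (f z)) \<and>
      h (f' z) = k (h z) \<and> f' z \<in> \<Sigma>)"
    by (intro eventually_near_conj[OF inv] eventually_near_conj[OF _ eventually_near_conj[OF conj mem]]
        local_return_map_eventually[OF lip ret(1) conj])
  then have "eventually_near \<Sigma> q (\<lambda>z. k (h (f (the_inv_into R h (h z)))) = h z \<and>
      h (f (the_inv_into R h (k (h z)))) = h z)"
    by (rule eventually_near_mono) (metis inv_into)
  then show ?thesis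
    unfolding germ_conjugate_inverse_def Let_def eventually_near_image[OF sub(2) q] by simp
qed

section \<open>Polynomial vector fields\<close>

lemma lipschitz_on_balls_const: "lipschitz_on_balls (\<lambda>_. c)"
  unfolding lipschitz_on_balls_def by (metis lipschitz_on_constant)

lemma lipschitz_on_balls_fst: "lipschitz_on_balls fst"
  unfolding lipschitz_on_balls_def by (metis lipschitz_onI dist_fst_le mult_1 zero_le_one)

lemma lipschitz_on_balls_snd: "lipschitz_on_balls snd"
  unfolding lipschitz_on_balls_def by (metis lipschitz_onI dist_snd_le mult_1 zero_le_one)

lemma lipschitz_on_balls_add:
  assumes "lipschitz_on_balls f" "lipschitz_on_balls g"
  shows "lipschitz_on_balls (\<lambda>x. f x + g x)"
  using assms unfolding lipschitz_on_balls_def by (metis lipschitz_on_add)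

lemma lipschitz_on_balls_scaleR:
  assumes "lipschitz_on_balls f"
  shows "lipschitz_on_balls (\<lambda>x. c *\<^sub>R f x)"
  using assms unfolding lipschitz_on_balls_def by (metis lipschitz_on_cmult)

lemma lipschitz_on_balls_Pair:
  assumes "lipschitz_on_balls f" "lipschitz_on_balls g"
  shows "lipschitz_on_balls (\<lambda>x. (f x, g x))"
  using assms unfolding lipschitz_on_balls_def by (metis lipschitz_on_Pair)

text \<open>A Lipschitz function on a ball around 0 is bounded by |f 0| + L |r|, so both factors are
  bounded and the difference of products splits into two controlled terms.\<close>

lemma lipschitz_on_balls_mult:
  fixes f g :: "'a::real_normed_vector \<Rightarrow> real"
  assumes "lipschitz_on_balls f" "lipschitz_on_balls g"
  shows "lipschitz_on_balls (\<lambda>x. f x * g x)"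
  unfolding lipschitz_on_balls_def
proof
  fix r :: real
  have bound: "\<exists>L M. L-lipschitz_on (cball 0 r) f \<and> 0 \<le> L \<and> 0 \<le> M \<and> (\<forall>x\<in>cball 0 r. \<bar>f x\<bar> \<le> M)"
    if f: "lipschitz_on_balls f" for f :: "'a \<Rightarrow> real"
  proof -
    obtain L where L: "L-lipschitz_on (cball 0 r) f"
      using f unfolding lipschitz_on_balls_def by blast
    then have L0: "0 \<le> L"
      by (rule lipschitz_on_nonneg)
    have "\<bar>f x\<bar> \<le> \<bar>f 0\<bar> + L * \<bar>r\<bar>" if x: "x \<in> cball 0 r" for x
    proof -
      have "dist (f x) (f 0) \<le> L * dist x 0"
        by (rule lipschitz_onD[OF L x]) (use x norm_ge_zero[of x] in \<open>simp del: norm_ge_zero\<close>)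
      also have "\<dots> \<le> L * \<bar>r\<bar>"
        using x L0 by (intro mult_left_mono) auto
      finally show ?thesis
        by (simp add: dist_real_def)
    qed
    then show ?thesis
      using L L0 by (intro exI[of _ L] exI[of _ "\<bar>f 0\<bar> + L * \<bar>r\<bar>"]) simp
  qed
  obtain L1 M1 where f: "L1-lipschitz_on (cball 0 r) f" "0 \<le> L1" "0 \<le> M1" "\<And>x. x \<in> cball 0 r \<Longrightarrow> \<bar>f x\<bar> \<le> M1"
    using bound[OF assms(1)] by blast
  obtain L2 M2 where g: "L2-lipschitz_on (cball 0 r) g" "0 \<le> L2" "0 \<le> M2" "\<And>x. x \<in> cball 0 r \<Longrightarrow> \<bar>g x\<bar> \<le> M2"
    using bound[OF assms(2)] by blast
  have "(M1 * L2 + M2 * L1)-lipschitz_on (cball 0 r) (\<lambda>x. f x * g x)"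
  proof (rule lipschitz_onI)
    fix x y :: 'a assume xy: "x \<in> cball 0 r" "y \<in> cball 0 r"
    have "f x * g x - f y * g y = f x * (g x - g y) + g y * (f x - f y)"
      by (simp add: algebra_simps)
    then have "\<bar>f x * g x - f y * g y\<bar> \<le> \<bar>f x\<bar> * \<bar>g x - g y\<bar> + \<bar>g y\<bar> * \<bar>f x - f y\<bar>"
      by (metis abs_mult abs_triangle_ineq)
    also have "\<dots> \<le> M1 * (L2 * dist x y) + M2 * (L1 * dist x y)"
      using lipschitz_onD[OF f(1) xy] lipschitz_onD[OF g(1) xy] f g xy
      by (intro add_mono mult_mono) (auto simp: dist_real_def)
    finally show "dist (f x * g x) (f y * g y) \<le> (M1 * L2 + M2 * L1) * dist x y"
      by (simp add: dist_real_def algebra_simps)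
  qed (use f g in simp)
  then show "\<exists>L. L-lipschitz_on (cball 0 r) (\<lambda>x. f x * g x)" ..
qed

lemma eval_xy_pCons: "eval_xy (pCons c P) x y = poly c x + y * eval_xy P x y"
  by (simp add: eval_xy_def)

lemma lipschitz_on_balls_vf: "lipschitz_on_balls (vf X)"
proof -
  have "lipschitz_on_balls (\<lambda>z :: real \<times> real. poly c (fst z))" for c
    by (induction c)
       (simp_all add: lipschitz_on_balls_const lipschitz_on_balls_add lipschitz_on_balls_mult lipschitz_on_balls_fst)
  then have "lipschitz_on_balls (\<lambda>z. eval_xy P (fst z) (snd z))" for P
    by (induction P)
       (simp_all add: eval_xy_def[of 0] lipschitz_on_balls_const eval_xy_pCons lipschitz_on_balls_add
         lipschitz_on_balls_mult lipschitz_on_balls_snd)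
  then show ?thesis
    unfolding vf_def case_prod_unfold by (intro lipschitz_on_balls_Pair)
qed

section \<open>Total degree of products and substitutions\<close>

lemma total_degree_le_iff:
  "total_degree P \<le> d \<longleftrightarrow> (\<forall>i j. coeff (coeff P j) i \<noteq> 0 \<longrightarrow> i + j \<le> d)"
proof -
  let ?A = "{i + j | i j. coeff (coeff P j) i \<noteq> 0}"
  \<comment> \<open>A common bound for the degrees in x of all coefficients. It makes the set of
    exponent sums finite, without which \<open>Max\<close> carries no information.\<close>
  define N where "N = Max ((\<lambda>j. degree (coeff P j)) ` {..degree P})"
  have "?A \<subseteq> {..N + degree P}"
  proof
    fix x assume "x \<in> ?A"
    then obtain i j where x: "x = i + j" and nz: "coeff (coeff P j) i \<noteq> 0"
      by blast
    have "j \<le> degree P"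
      using nz by (intro le_degree) (metis coeff_0)
    moreover have "i \<le> degree (coeff P j)"
      using nz by (rule le_degree)
    moreover have "degree (coeff P j) \<le> N"
      unfolding N_def using \<open>j \<le> degree P\<close> by (intro Max_ge) auto
    ultimately show "x \<in> {..N + degree P}"
      by (simp add: x)
  qed
  then have "finite ?A"
    using finite_subset by blast
  then show ?thesis
    unfolding total_degree_def using Max_le_iff[of "insert 0 ?A" d] by auto
qed

lemma total_degree_le_coeff:
  "coeff (coeff P j) i \<noteq> 0 \<Longrightarrow> i + j \<le> total_degree P"
  using total_degree_le_iff by blast

lemma total_degree_add_le:
  assumes "total_degree P \<le> d" "total_degree Q \<le> d"
  shows "total_degree (P + Q) \<le> d"
  using assms unfolding total_degree_le_iff by (metis add.right_neutral coeff_add)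

lemma total_degree_mult_le: "total_degree (P * Q) \<le> total_degree P + total_degree Q"
  unfolding total_degree_le_iff
proof (intro allI impI)
  fix i j assume "coeff (coeff (P * Q) j) i \<noteq> 0"
  then have "(\<Sum>j1\<le>j. \<Sum>i1\<le>i. coeff (coeff P j1) i1 * coeff (coeff Q (j - j1)) (i - i1)) \<noteq> 0"
    by (simp add: coeff_mult coeff_sum)
  then obtain j1 where j1: "j1 \<le> j"
      "(\<Sum>i1\<le>i. coeff (coeff P j1) i1 * coeff (coeff Q (j - j1)) (i - i1)) \<noteq> 0"
    by (meson atMost_iff sum.not_neutral_contains_not_neutral)
  then obtain i1 where i1: "i1 \<le> i" "coeff (coeff P j1) i1 * coeff (coeff Q (j - j1)) (i - i1) \<noteq> 0"
    by (meson atMost_iff sum.not_neutral_contains_not_neutral)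
  then show "i + j \<le> total_degree P + total_degree Q"
    using total_degree_le_coeff[of P j1 i1] total_degree_le_coeff[of Q "j - j1" "i - i1"] j1(1) by simp
qed

lemma total_degree_in_x_le: "total_degree (in_x p) \<le> degree p"
  unfolding total_degree_le_iff in_x_def by (auto simp: coeff_pCons le_degree split: nat.splits)

lemma total_degree_in_y_le: "total_degree (in_y p) \<le> degree p"
  unfolding total_degree_le_iff in_y_def
  by (auto simp: coeff_map_poly coeff_pCons le_degree split: nat.splits)

lemma subst_xy_0: "subst_xy 0 p = 0"
  by (simp add: subst_xy_def)

lemma subst_xy_pCons: "subst_xy (pCons c P) p = in_x (pcompose c p) + in_y p * subst_xy P p"
  by (simp add: subst_xy_def map_poly_pCons pcompose_pCons in_x_def)

text \<open>Writing the polynomial as c + y P lowers the bound for P to d - 1, while the factor p(y)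
  that replaces y costs \<open>degree p\<close>; the two balance. Hence \<open>d\<close> varies in
  the induction.\<close>

lemma total_degree_subst_xy_le:
  assumes "total_degree P \<le> d"
  shows "total_degree (subst_xy P p) \<le> degree p * d"
  using assms
proof (induction P arbitrary: d)
  case 0
  then show ?case
    by (simp add: subst_xy_0 total_degree_def)
next
  case (pCons c P)
  have deg: "i + j \<le> d" if "coeff (coeff (pCons c P) j) i \<noteq> 0" for i j
    using pCons.prems that unfolding total_degree_le_iff by blast
  have "degree c \<le> d"
    using deg[where j = 0 and i = "degree c"] by (cases "c = 0") auto
  then have "total_degree (in_x (pcompose c p)) \<le> degree p * d"
    by (metis degree_pcompose le_trans mult.commute mult_le_mono1 total_degree_in_x_le)
  moreover have "total_degree (in_y p * subst_xy P p) \<le> degree p * d"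
  proof (cases "P = 0")
    case True
    then show ?thesis
      by (simp add: subst_xy_0 total_degree_def)
  next
    case False
    have *: "i + Suc j \<le> d" if "coeff (coeff P j) i \<noteq> 0" for i j
      using deg[where j = "Suc j" and i = i] that by simp
    \<comment> \<open>Some monomial of \<open>P\<close> is nonzero, and after multiplication by y it
      has positive total degree; so \<open>d\<close> is positive and has a predecessor.\<close>
    have "lead_coeff (lead_coeff P) \<noteq> 0"
      using False by simp
    from *[OF this] obtain d' where d: "d = Suc d'"
      by (cases d) auto
    have "total_degree P \<le> d'"
      using * unfolding total_degree_le_iff d by fastforce
    then have "total_degree (subst_xy P p) \<le> degree p * d'"
      by (rule pCons.IH)
    then show ?thesis
      using total_degree_mult_le[of "in_y p" "subst_xy P p"] total_degree_in_y_le[of p] by (simp add: d)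
  qed
  ultimately show ?case
    unfolding subst_xy_pCons by (rule total_degree_add_le)
qed

lemma vf_degree_lift_vf_le: "vf_degree (lift_vf p X) \<le> degree p * vf_degree X + (degree p - 1)"
proof -
  have "total_degree (in_y (pderiv p) * subst_xy P p) \<le> degree p * vf_degree X + (degree p - 1)"
    "total_degree (in_x (pderiv p) * subst_xy P p) \<le> degree p * vf_degree X + (degree p - 1)"
    if P: "total_degree P \<le> vf_degree X" for P
    using total_degree_subst_xy_le[OF P, of p]
      total_degree_mult_le[of "in_y (pderiv p)" "subst_xy P p"] total_degree_in_y_le[of "pderiv p"]
      total_degree_mult_le[of "in_x (pderiv p)" "subst_xy P p"] total_degree_in_x_le[of "pderiv p"]
    by (simp_all add: degree_pderiv)
  then show ?thesis
    by (simp add: vf_degree_def lift_vf_def)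
qed

section \<open>Branches of polynomials\<close>

text \<open>Agreement on an open set passes to the derivatives and so to every order. It is needed
  because \<open>frechet_derivative\<close> and \<open>the_inv_into\<close> have a known form only
  on the set in question.\<close>

lemma Ck_on_cong:
  fixes f g :: "'a::real_normed_vector \<Rightarrow> 'b::real_normed_vector"
  assumes "open S" "\<And>x. x \<in> S \<Longrightarrow> f x = g x" "Ck_on k f S"
  shows "Ck_on k g S"
  using assms(2,3)
proof (induction k arbitrary: f g)
  case 0
  then show ?case
    by (auto cong: continuous_on_cong)
next
  case (Suc k)
  have der: "(g has_derivative frechet_derivative f (at x)) (at x)" if x: "x \<in> S" for x
  proof (rule has_derivative_transform_within_open[OF _ \<open>open S\<close> x])
    show "(f has_derivative frechet_derivative f (at x)) (at x)"
      using Suc.prems(2) x by (simp add: frechet_derivative_works)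
  qed (use Suc.prems(1) in auto)
  have eq: "frechet_derivative f (at x) v = frechet_derivative g (at x) v" if "x \<in> S" for x v
    using frechet_derivative_at[OF der[OF that]] by simp
  have "Ck_on k (\<lambda>x. frechet_derivative g (at x) v) S" for v
    using Suc.prems(2) by (intro Suc.IH[OF eq]) auto
  then show ?case
    using der unfolding Ck_on.simps differentiable_def by blast
qed

section \<open>Product maps of class C^k\<close>

lemma has_derivative_product_map:
  fixes \<alpha> \<beta> :: "real \<Rightarrow> real"
  assumes "(\<alpha> has_real_derivative \<alpha>') (at (fst z))" "(\<beta> has_real_derivative \<beta>') (at (snd z))"
  shows "((\<lambda>(x, y). (\<alpha> x, \<beta> y)) has_derivative (\<lambda>v. (\<alpha>' * fst v, \<beta>' * snd v))) (at z)"
  unfolding case_prod_unfold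
proof (rule has_derivative_Pair)
  show "((\<lambda>x. \<alpha> (fst x)) has_derivative (\<lambda>v. \<alpha>' * fst v)) (at z)"
    using has_derivative_compose[OF has_derivative_fst[OF has_derivative_ident]
        assms(1)[unfolded has_field_derivative_def]] by simp
  show "((\<lambda>x. \<beta> (snd x)) has_derivative (\<lambda>v. \<beta>' * snd v)) (at z)"
    using has_derivative_compose[OF has_derivative_snd[OF has_derivative_ident]
        assms(2)[unfolded has_field_derivative_def]] by simp
qed

text \<open>
  The directional derivatives of a product map \<open>(\<alpha> x, \<beta> y)\<close> are again product maps, so it suffices
  that the components range over families that are closed under derivatives and scaling.
\<close>

lemma Ck_on_product_map:
  fixes \<A> \<B> :: "(real \<Rightarrow> real) set"
  assumes "open S" "open T"
    and "\<And>\<alpha>. \<alpha> \<in> \<A> \<Longrightarrow> \<exists>\<alpha>'\<in>\<A>. \<forall>x\<in>S. (\<alpha> has_real_derivative \<alpha>' x) (at x)"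
    and "\<And>\<beta>. \<beta> \<in> \<B> \<Longrightarrow> \<exists>\<beta>'\<in>\<B>. \<forall>x\<in>T. (\<beta> has_real_derivative \<beta>' x) (at x)"
    and "\<And>\<alpha> c. \<alpha> \<in> \<A> \<Longrightarrow> (\<lambda>x. \<alpha> x * c) \<in> \<A>" "\<And>\<beta> c. \<beta> \<in> \<B> \<Longrightarrow> (\<lambda>x. \<beta> x * c) \<in> \<B>"
    and "\<alpha> \<in> \<A>" "\<beta> \<in> \<B>"
  shows "Ck_on k (\<lambda>(x, y). (\<alpha> x, \<beta> y)) (S \<times> T)"
  using assms(7,8)
proof (induction k arbitrary: \<alpha> \<beta>)
  case 0
  obtain \<alpha>' \<beta>' where der: "\<And>x. x \<in> S \<Longrightarrow> (\<alpha> has_real_derivative \<alpha>' x) (at x)"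
      "\<And>x. x \<in> T \<Longrightarrow> (\<beta> has_real_derivative \<beta>' x) (at x)"
    using assms(3)[OF 0(1)] assms(4)[OF 0(2)] by blast
  have "isCont (\<lambda>(x, y). (\<alpha> x, \<beta> y)) z" if "z \<in> S \<times> T" for z
    using has_derivative_product_map[of \<alpha> "\<alpha>' (fst z)" z \<beta> "\<beta>' (snd z)"] der that
    by (intro has_derivative_continuous) (auto simp: mem_Times_iff)
  then show ?case
    by (simp add: continuous_at_imp_continuous_on)
next
  case (Suc k)
  obtain \<alpha>' where \<alpha>': "\<alpha>' \<in> \<A>" "\<And>x. x \<in> S \<Longrightarrow> (\<alpha> has_real_derivative \<alpha>' x) (at x)"
    using assms(3)[OF Suc.prems(1)] by blast
  obtain \<beta>' where \<beta>': "\<beta>' \<in> \<B>" "\<And>x. x \<in> T \<Longrightarrow> (\<beta> has_real_derivative \<beta>' x) (at x)"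
    using assms(4)[OF Suc.prems(2)] by blast
  let ?f = "\<lambda>(x, y). (\<alpha> x, \<beta> y)"
  have der: "(?f has_derivative (\<lambda>v. (\<alpha>' (fst z) * fst v, \<beta>' (snd z) * snd v))) (at z)"
    if "z \<in> S \<times> T" for z
    using that \<alpha>'(2) \<beta>'(2) by (intro has_derivative_product_map) (auto simp: mem_Times_iff)
  have "Ck_on k (\<lambda>z. frechet_derivative ?f (at z) v) (S \<times> T)" for v
  proof (rule Ck_on_cong)
    show "open (S \<times> T)"
      using assms(1,2) by (rule open_Times)
    show "Ck_on k (\<lambda>(x, y). (\<alpha>' x * fst v, \<beta>' y * snd v)) (S \<times> T)"
      by (rule Suc.IH) (use \<alpha>'(1) \<beta>'(1) assms(5,6) in auto)
    show "(case z of (x, y) \<Rightarrow> (\<alpha>' x * fst v, \<beta>' y * snd v)) = frechet_derivative ?f (at z) v"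
      if "z \<in> S \<times> T" for z
      using frechet_derivative_at[OF der[OF that], symmetric] by (simp add: case_prod_unfold)
  qed
  then show ?case
    using der unfolding Ck_on.simps differentiable_def by blast
qed

text \<open>The target \<open>J\<close> is left open so that the same facts serve \<open>p\<close>
  over (-1,1) and its multiple by \<open>r\<close> over (-r,r). Having no critical point replaces
  the C^1 condition on the inverse.\<close>

locale poly_branch =
  fixes p :: "real poly" and I J :: "real set"
  assumes interval: "is_interval I" and open_I: "open I" and open_J: "open J"
    and bij: "bij_betw (poly p) I J" and pderiv_nonzero: "\<And>x. x \<in> I \<Longrightarrow> poly (pderiv p) x \<noteq> 0"
begin

definition branch_inv :: "real \<Rightarrow> real" where
  "branch_inv = the_inv_into I (poly p)"

lemma branch_inv_poly: "x \<in> I \<Longrightarrow> branch_inv (poly p x) = x"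
  unfolding branch_inv_def using bij by (simp add: bij_betw_def the_inv_into_f_f)

lemma poly_branch_inv: "y \<in> J \<Longrightarrow> poly p (branch_inv y) = y"
  unfolding branch_inv_def using bij by (simp add: bij_betw_def f_the_inv_into_f)

lemma poly_mem: "x \<in> I \<Longrightarrow> poly p x \<in> J"
  using bij by (auto simp: bij_betw_def)

lemma branch_inv_mem: "y \<in> J \<Longrightarrow> branch_inv y \<in> I"
  unfolding branch_inv_def using bij by (simp add: bij_betw_def the_inv_into_into)

lemma branch_inv_deriv:
  assumes "y \<in> J"
  shows "(branch_inv has_real_derivative 1 / poly (pderiv p) (branch_inv y)) (at y)"
proof -
  have "continuous_on (poly p ` I) branch_inv"
    by (rule continuous_on_inverse_open[OF open_I continuous_on_poly[OF continuous_on_id] _ branch_inv_poly]) simp_all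
  then have "continuous_on J branch_inv"
    using bij by (simp add: bij_betw_def)
  then have "isCont branch_inv y"
    using open_J assms by (simp add: continuous_on_eq_continuous_at)
  then show ?thesis
    using has_field_derivative_inverse_basic[OF poly_DERIV pderiv_nonzero[OF branch_inv_mem[OF assms]] _ open_J assms poly_branch_inv]
    by (simp add: inverse_eq_divide)
qed

lemma pderiv_sign: "(\<forall>x\<in>I. poly (pderiv p) x > 0) \<or> (\<forall>x\<in>I. poly (pderiv p) x < 0)"
proof (rule ccontr)
  assume "\<not> ?thesis"
  then obtain x y where xy: "x \<in> I" "poly (pderiv p) x \<le> 0" "y \<in> I" "0 \<le> poly (pderiv p) y"
    by (meson not_le)
  have "connected (poly (pderiv p) ` I)"
    using interval by (intro connected_continuous_image continuous_intros) (simp add: is_interval_connected)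
  then have "0 \<in> poly (pderiv p) ` I"
    using connectedD_interval[OF _ imageI[OF xy(1)] imageI[OF xy(3)] xy(2,4)] by blast
  then obtain z where "z \<in> I" "poly (pderiv p) z = 0"
    by (metis imageE)
  then show False
    using pderiv_nonzero by blast
qed

text \<open>
  Every derivative of the inverse \<open>h\<close> of \<open>p\<close> has the form $q(h) (1 / p'(h))^n$ with a polynomial \<open>q\<close>.
\<close>

definition inv_family :: "(real \<Rightarrow> real) set" where
  "inv_family = {\<lambda>y. poly q (branch_inv y) * (1 / poly (pderiv p) (branch_inv y)) ^ n | q n. True}"

lemma inv_familyI:
  "(\<lambda>y. poly q (branch_inv y) * (1 / poly (pderiv p) (branch_inv y)) ^ n) \<in> inv_family"
  unfolding inv_family_def by (intro CollectI exI[of _ q] exI[of _ n] conjI refl TrueI)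

lemma inv_family_deriv:
  assumes "\<alpha> \<in> inv_family"
  shows "\<exists>\<alpha>'\<in>inv_family. \<forall>y\<in>J. (\<alpha> has_real_derivative \<alpha>' y) (at y)"
proof -
  obtain q n where \<alpha>: "\<alpha> = (\<lambda>y. poly q (branch_inv y) * (1 / poly (pderiv p) (branch_inv y)) ^ n)"
    using assms unfolding inv_family_def by blast
  define p1 where "p1 = pderiv p"
  define w where "w y = 1 / poly p1 (branch_inv y)" for y
  \<comment> \<open>With h' = w and w' = - p1'(h) w^3, the derivative of q(h) w^n is q'(h) w^(n+1) -
    n q(h) p1'(h) w^(n+2). Since p1(h) w = 1, the first term may be multiplied by p1(h) w, and
    \<open>r\<close> is the resulting common numerator over w^(n+2).\<close>
  define r where "r = pderiv q * p1 - smult (of_nat n) (q * pderiv p1)"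
  have der: "(\<alpha> has_real_derivative poly r (branch_inv y) * w y ^ (n + 2)) (at y)"
    if y: "y \<in> J" for y
  proof -
    let ?h = "branch_inv y"
    have nz: "poly p1 ?h \<noteq> 0"
      using pderiv_nonzero[OF branch_inv_mem[OF y]] by (simp add: p1_def)
    then have pw: "poly p1 ?h * w y = 1"
      by (simp add: w_def)
    have d: "((\<lambda>y. poly f (branch_inv y)) has_real_derivative poly (pderiv f) ?h * w y) (at y)" for f
      unfolding p1_def w_def by (rule DERIV_chain2[OF poly_DERIV branch_inv_deriv[OF y]])
    have "(w has_real_derivative - (poly (pderiv p1) ?h * w y ^ 3)) (at y)"
      unfolding w_def[abs_def] using DERIV_inverse_fun[OF d nz]
      by (simp add: w_def inverse_eq_divide power2_eq_square power3_eq_cube mult.assoc)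
    note d\<alpha> = DERIV_mult[OF d[of q] DERIV_power[OF this, of n]]
    have alg: "A * (P * v) * v * v ^ k + - (m * B * C * v ^ (k + 2)) = (A * P - m * (B * C)) * v ^ (k + 2)"
      for A B C P v m :: real and k
      by (simp add: power_add power2_eq_square algebra_simps)
    have pr: "poly r ?h = poly (pderiv q) ?h * poly p1 ?h - of_nat n * (poly q ?h * poly (pderiv p1) ?h)"
      by (simp add: r_def)
    \<comment> \<open>For n = 0 the exponent \<open>n - Suc 0\<close> is truncated to 0, but the
      factor n annihilates both sides.\<close>
    have e1: "of_nat n * (- (poly (pderiv p1) ?h * w y ^ 3) * w y ^ (n - Suc 0)) * poly q ?h =
        - (of_nat n * poly q ?h * poly (pderiv p1) ?h * w y ^ (n + 2))"
      by (cases n) (simp_all add: power_add numeral_eq_Suc algebra_simps)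
    have e2: "poly (pderiv q) ?h * w y * w y ^ n = poly (pderiv q) ?h * (poly p1 ?h * w y) * w y * w y ^ n"
      unfolding pw by simp
    have "poly (pderiv q) ?h * w y * w y ^ n +
        of_nat n * (- (poly (pderiv p1) ?h * w y ^ 3) * w y ^ (n - Suc 0)) * poly q ?h =
        poly r ?h * w y ^ (n + 2)"
      unfolding e1 e2 pr by (rule alg)
    from DERIV_cong[OF d\<alpha> this] show ?thesis
      unfolding \<alpha> p1_def[symmetric] w_def[symmetric] .
  qed
  show ?thesis
    by (rule bexI[OF _ inv_familyI[of r "n + 2", folded p1_def, folded w_def]]) (intro ballI der)
qed

lemma inv_family_scale: "\<alpha> \<in> inv_family \<Longrightarrow> (\<lambda>y. \<alpha> y * c) \<in> inv_family"
proof -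
  assume "\<alpha> \<in> inv_family"
  then obtain q n where "\<alpha> = (\<lambda>y. poly q (branch_inv y) * (1 / poly (pderiv p) (branch_inv y)) ^ n)"
    unfolding inv_family_def by blast
  then have "(\<lambda>y. \<alpha> y * c) =
      (\<lambda>y. poly (smult c q) (branch_inv y) * (1 / poly (pderiv p) (branch_inv y)) ^ n)"
    by (simp add: mult_ac)
  then show ?thesis
    by (simp only: inv_familyI)
qed

lemma branch_inv_in_inv_family: "branch_inv \<in> inv_family"
  using inv_familyI[of "[:0, 1:]" 0] by simp

end

text \<open>At a critical point the chain rule for the inverse composed with \<open>p\<close> would
  give 0 = 1. It is the differentiability of the inverse that excludes examples such as x^3 on
  (-1,1), which is bijective with a critical point.\<close>

lemma full_branch_interval_poly_branch:
  assumes "full_branch_interval p I"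
  shows "poly_branch p I {-1<..<1}"
proof
  have diffeo: "Ck_diffeo 1 (poly p) I {-1<..<1}"
    using assms by (simp add: full_branch_interval_def)
  then show "is_interval I" "open I" "open {-1<..<1::real}" and bij: "bij_betw (poly p) I {-1<..<1}"
    using assms by (auto simp: full_branch_interval_def Ck_diffeo_def)
  show "poly (pderiv p) x \<noteq> 0" if x: "x \<in> I" for x
  proof
    assume zero: "poly (pderiv p) x = 0"
    let ?g = "the_inv_into I (poly p)"
    have "poly p x \<in> {-1<..<1}"
      using bij x by (auto simp: bij_betw_def)
    then have "?g differentiable (at (poly p x))"
      using diffeo by (simp add: Ck_diffeo_def)
    then obtain D where "(?g has_real_derivative D) (at (poly p x))"
      using real_differentiableE by blast
    from DERIV_chain2[OF this poly_DERIV] zero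
    have "((\<lambda>x. ?g (poly p x)) has_real_derivative 0) (at x)"
      by simp
    moreover have "((\<lambda>x. ?g (poly p x)) has_real_derivative 1) (at x)"
      by (rule has_field_derivative_transform_within_open[OF DERIV_ident \<open>open I\<close> x])
         (use bij in \<open>simp add: bij_betw_def the_inv_into_f_f\<close>)
    ultimately show False
      using DERIV_unique zero_neq_one by blast
  qed
qed

lemma poly_branch_smult:
  assumes "full_branch_interval p I" "r > 0"
  shows "poly_branch (smult r p) I {-r<..<r}"
proof -
  interpret poly_branch p I "{-1<..<1}"
    using assms(1) by (rule full_branch_interval_poly_branch)
  show ?thesis
  proof
    have "- r < x * r" if "-1 < x" for x
      using mult_strict_right_mono[OF that \<open>r > 0\<close>] by simp
    then have "bij_betw ((*) r) {-1<..<1} {-r<..<r}"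
      using \<open>r > 0\<close> by (intro bij_betw_byWitness[where f' = "\<lambda>x. x / r"]) (auto simp: field_simps)
    moreover have "poly (smult r p) = (*) r \<circ> poly p"
      by (simp add: fun_eq_iff)
    ultimately show "bij_betw (poly (smult r p)) I {-r<..<r}"
      using bij_betw_trans[OF bij] by simp
    show "poly (pderiv (smult r p)) x \<noteq> 0" if "x \<in> I" for x
      using pderiv_nonzero[OF that] \<open>r > 0\<close> by (simp add: pderiv_smult)
  qed (use interval open_I in auto)
qed

text \<open>Two overlapping branches unite to an interval without critical points, on which
  \<open>p\<close> is injective by the mean value theorem. Both branches attain all values of
  \<open>J\<close>, so neither can contain a point outside the other.\<close>

lemma poly_branch_disjoint:
  assumes "poly_branch p I J" "poly_branch p I' J" "I \<inter> I' \<noteq> {}"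
  shows "I = I'"
proof -
  interpret A: poly_branch p I J by fact
  interpret B: poly_branch p I' J by fact
  have "connected (I \<union> I')"
    using A.interval B.interval assms(3) by (intro connected_Un) (auto simp: is_interval_connected)
  then have int: "is_interval (I \<union> I')"
    by (simp add: is_interval_connected_1)
  have neq: "poly p x \<noteq> poly p y" if xy: "x \<in> I \<union> I'" "y \<in> I \<union> I'" "x < y" for x y
  proof
    assume "poly p x = poly p y"
    then obtain z where z: "x < z" "z < y" "poly (pderiv p) z = 0"
      using poly_MVT[OF xy(3), of p] xy(3) by auto
    then have "z \<in> I \<union> I'"
      using int xy(1,2) by (meson less_imp_le mem_is_interval_1_I)
    then show False
      using z(3) A.pderiv_nonzero B.pderiv_nonzero by blast
  qed
  have inj: "x = y" if "x \<in> I \<union> I'" "y \<in> I \<union> I'" "poly p x = poly p y" for x y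
    using neq[OF that(1,2)] neq[OF that(2,1)] that(3) by (cases x y rule: linorder_cases) simp_all
  show ?thesis
  proof (intro equalityI subsetI)
    fix x assume x: "x \<in> I"
    have "B.branch_inv (poly p x) = x"
      by (rule inj) (use B.branch_inv_mem[OF A.poly_mem[OF x]] B.poly_branch_inv[OF A.poly_mem[OF x]] x in simp_all)
    then show "x \<in> I'"
      using B.branch_inv_mem[OF A.poly_mem[OF x]] by simp
  next
    fix x assume x: "x \<in> I'"
    have "A.branch_inv (poly p x) = x"
      by (rule inj) (use A.branch_inv_mem[OF B.poly_mem[OF x]] A.poly_branch_inv[OF B.poly_mem[OF x]] x in simp_all)
    then show "x \<in> I"
      using A.branch_inv_mem[OF B.poly_mem[OF x]] by simp
  qed
qed

section \<open>The map of a rectangle of branches\<close>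

lemma Phi_has_derivative:
  "(Phi p has_derivative (\<lambda>x. (poly (pderiv p) (fst z) * fst x, poly (pderiv p) (snd z) * snd x))) (at z)"
  unfolding Phi_def by (rule has_derivative_product_map) (rule poly_DERIV)+

text \<open>Each component of the lifted field carries the derivative of \<open>p\<close> in the
  other variable; the diagonal derivative of \<open>Phi p\<close> supplies the missing one, so both
  components end up with the same factor.\<close>

lemma Phi_lift_vf:
  "(poly (pderiv p) (fst z) * fst (vf (lift_vf p X) z), poly (pderiv p) (snd z) * snd (vf (lift_vf p X) z)) =
     (poly (pderiv p) (fst z) * poly (pderiv p) (snd z)) *\<^sub>R vf X (Phi p z)"
proof (cases z)
  case (Pair u v)
  have "vf X (Phi p (u, v)) = (eval_xy (fst X) (poly p u) (poly p v), eval_xy (snd X) (poly p u) (poly p v))"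
    by (simp add: vf_def Phi_def)
  then show ?thesis
    unfolding Pair by (simp add: vf_lift_vf)
qed

locale poly_branch_pair = A: poly_branch p I J + B: poly_branch p I' J' for p I J I' J'
begin

definition Phi_inv :: "real \<times> real \<Rightarrow> real \<times> real" where
  "Phi_inv = (\<lambda>(x, y). (A.branch_inv x, B.branch_inv y))"

lemma homeomorphism_Phi: "homeomorphism (I \<times> I') (J \<times> J') (Phi p) Phi_inv"
proof (rule homeomorphismI)
  show "continuous_on (I \<times> I') (Phi p)"
    by (intro continuous_at_imp_continuous_on ballI has_derivative_continuous[OF Phi_has_derivative])
  have cont: "continuous_on J A.branch_inv" "continuous_on J' B.branch_inv"
    by (meson A.branch_inv_deriv B.branch_inv_deriv DERIV_isCont continuous_at_imp_continuous_on)+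
  have "continuous_on (J \<times> J') (\<lambda>w. A.branch_inv (fst w))" "continuous_on (J \<times> J') (\<lambda>w. B.branch_inv (snd w))"
    using continuous_on_compose2[OF cont(1) continuous_on_fst[OF continuous_on_id], of "J \<times> J'"]
      continuous_on_compose2[OF cont(2) continuous_on_snd[OF continuous_on_id], of "J \<times> J'"] by auto
  then show "continuous_on (J \<times> J') Phi_inv"
    unfolding Phi_inv_def case_prod_unfold by (rule continuous_on_Pair)
qed (auto simp: Phi_def Phi_inv_def A.poly_mem B.poly_mem A.branch_inv_mem B.branch_inv_mem
      A.branch_inv_poly B.branch_inv_poly A.poly_branch_inv B.poly_branch_inv)

lemma Phi_inv_has_derivative:
  assumes "w \<in> J \<times> J'"
  shows "(Phi_inv has_derivative (\<lambda>x. (fst x / poly (pderiv p) (fst (Phi_inv w)),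
      snd x / poly (pderiv p) (snd (Phi_inv w))))) (at w)"
proof -
  have "fst w \<in> J" "snd w \<in> J'"
    using assms by auto
  from has_derivative_product_map[OF A.branch_inv_deriv[OF this(1)] B.branch_inv_deriv[OF this(2)]]
  show ?thesis
    by (simp add: Phi_inv_def case_prod_unfold)
qed

text \<open>Both directions are product maps whose components range over families closed under
  derivatives and scaling: the polynomials for \<open>Phi p\<close>, and \<open>inv_family\<close>
  for the inverse. This gives all orders k at once.\<close>

lemma smooth_diffeo_Phi: "smooth_diffeo (Phi p) (I \<times> I') (J \<times> J')"
  unfolding smooth_diffeo_def Ck_diffeo_def
proof (intro allI conjI)
  fix k
  show open_rect: "open (I \<times> I')" "open (J \<times> J')"
    by (simp_all add: open_Times A.open_I A.open_J B.open_I B.open_J)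
  have inj: "inj_on (Phi p) (I \<times> I')" and img: "Phi p ` (I \<times> I') = J \<times> J'"
    using homeomorphism_Phi unfolding homeomorphism_def by (metis inj_onI, blast)
  then show "bij_betw (Phi p) (I \<times> I') (J \<times> J')"
    by (simp add: bij_betw_def)
  have poly_deriv: "\<exists>\<alpha>'\<in>range poly. \<forall>x\<in>S. (\<alpha> has_real_derivative \<alpha>' x) (at x)"
    if "\<alpha> \<in> range poly" for \<alpha> :: "real \<Rightarrow> real" and S
    using that poly_DERIV by blast
  have poly_scale: "(\<lambda>x. \<alpha> x * c) \<in> range poly" if \<alpha>: "\<alpha> \<in> range poly" for \<alpha> :: "real \<Rightarrow> real" and c
  proof -
    obtain q where "\<alpha> = poly q"
      using \<alpha> by blast
    then have "(\<lambda>x. \<alpha> x * c) = poly (smult c q)"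
      by (simp add: fun_eq_iff)
    then show ?thesis
      by (rule range_eqI)
  qed
  show "Ck_on k (Phi p) (I \<times> I')"
    unfolding Phi_def
    by (rule Ck_on_product_map[OF A.open_I B.open_I poly_deriv poly_deriv poly_scale poly_scale rangeI rangeI])
  have "Ck_on k Phi_inv (J \<times> J')"
    unfolding Phi_inv_def
    by (rule Ck_on_product_map[OF A.open_J B.open_J A.inv_family_deriv B.inv_family_deriv
          A.inv_family_scale B.inv_family_scale A.branch_inv_in_inv_family B.branch_inv_in_inv_family])
  then show "Ck_on k (the_inv_into (I \<times> I') (Phi p)) (J \<times> J')"
  proof (rule Ck_on_cong[OF open_rect(2), rotated])
    fix w assume w: "w \<in> J \<times> J'"
    then have "Phi_inv w \<in> I \<times> I'" "Phi p (Phi_inv w) = w"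
      using homeomorphism_Phi unfolding homeomorphism_def by blast+
    then show "Phi_inv w = the_inv_into (I \<times> I') (Phi p) w"
      using the_inv_into_f_f[OF inj] by metis
  qed
qed

lemma pderiv_product_sign:
  "(\<forall>z\<in>I \<times> I'. poly (pderiv p) (fst z) * poly (pderiv p) (snd z) > 0) \<or>
   (\<forall>z\<in>I \<times> I'. poly (pderiv p) (fst z) * poly (pderiv p) (snd z) < 0)"
  using A.pderiv_sign B.pderiv_sign
  by (auto simp: mult_pos_pos mult_neg_neg mult_pos_neg mult_neg_pos)

text \<open>The constant \<open>c\<close> is the sign: it is used with 1 and with -1, so as to make
  the change of speed positive on the rectangle.\<close>

lemma orbit_equivalence_lift_vf:
  assumes "\<And>z. z \<in> I \<times> I' \<Longrightarrow> c * (poly (pderiv p) (fst z) * poly (pderiv p) (snd z)) > 0"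
  shows "orbit_equivalence (\<lambda>z. c *\<^sub>R vf (lift_vf p X) z) (vf X) (I \<times> I') (J \<times> J') (Phi p) Phi_inv
    (\<lambda>z. poly (pderiv p) (fst z)) (\<lambda>z. poly (pderiv p) (snd z))
    (\<lambda>z. c * (poly (pderiv p) (fst z) * poly (pderiv p) (snd z)))"
proof
  show "open (I \<times> I')" "open (J \<times> J')"
    by (simp_all add: open_Times A.open_I A.open_J B.open_I B.open_J)
  show "(poly (pderiv p) (fst z) * fst (c *\<^sub>R vf (lift_vf p X) z),
      poly (pderiv p) (snd z) * snd (c *\<^sub>R vf (lift_vf p X) z)) =
      (c * (poly (pderiv p) (fst z) * poly (pderiv p) (snd z))) *\<^sub>R vf X (Phi p z)" for z
  proof -
    have "(poly (pderiv p) (fst z) * fst (c *\<^sub>R vf (lift_vf p X) z),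
        poly (pderiv p) (snd z) * snd (c *\<^sub>R vf (lift_vf p X) z)) =
        c *\<^sub>R (poly (pderiv p) (fst z) * fst (vf (lift_vf p X) z), poly (pderiv p) (snd z) * snd (vf (lift_vf p X) z))"
      by (simp add: mult.left_commute)
    then show ?thesis
      by (simp only: Phi_lift_vf scaleR_scaleR)
  qed
  show "continuous_on (I \<times> I') (\<lambda>z. poly (pderiv p) (fst z))"
    "continuous_on (I \<times> I') (\<lambda>z. poly (pderiv p) (snd z))"
    "continuous_on (I \<times> I') (\<lambda>z. c * (poly (pderiv p) (fst z) * poly (pderiv p) (snd z)))"
    by (intro continuous_intros)+
  show "lipschitz_on_balls (\<lambda>z. c *\<^sub>R vf (lift_vf p X) z)"
    by (intro lipschitz_on_balls_scaleR lipschitz_on_balls_vf)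
qed (use assms homeomorphism_Phi Phi_has_derivative Phi_inv_has_derivative lipschitz_on_balls_vf
      A.pderiv_nonzero B.pderiv_nonzero in auto)

text \<open>
  Where $p'(u) p'(v) < 0$, the field \<open>Y\<close> is replaced by \<open>-Y\<close>, which has the same orbits, periodic
  orbits, limit cycles and sections, and inverse return maps.
\<close>

lemma lift_vf_cases:
  obtains (pos) "\<And>z. z \<in> I \<times> I' \<Longrightarrow> poly (pderiv p) (fst z) * poly (pderiv p) (snd z) > 0"
      "\<And>X. \<exists>a b s. orbit_equivalence (vf (lift_vf p X)) (vf X) (I \<times> I') (J \<times> J') (Phi p) Phi_inv a b s"
  | (neg) "\<And>z. z \<in> I \<times> I' \<Longrightarrow> poly (pderiv p) (fst z) * poly (pderiv p) (snd z) < 0"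
      "\<And>X. \<exists>a b s. orbit_equivalence (\<lambda>z. - vf (lift_vf p X) z) (vf X) (I \<times> I') (J \<times> J') (Phi p) Phi_inv a b s"
proof -
  consider "\<forall>z\<in>I \<times> I'. poly (pderiv p) (fst z) * poly (pderiv p) (snd z) > 0"
    | "\<forall>z\<in>I \<times> I'. poly (pderiv p) (fst z) * poly (pderiv p) (snd z) < 0"
    using pderiv_product_sign by blast
  then show thesis
  proof cases
    case 1
    have "\<exists>a b s. orbit_equivalence (vf (lift_vf p X)) (vf X) (I \<times> I') (J \<times> J') (Phi p) Phi_inv a b s" for X
      using orbit_equivalence_lift_vf[of 1 X] 1 unfolding scaleR_one mult_1 by blast
    with 1 show thesis
      by (intro pos) blast+
  next
    case 2
    have "\<exists>a b s. orbit_equivalence (\<lambda>z. - vf (lift_vf p X) z) (vf X) (I \<times> I') (J \<times> J') (Phi p) Phi_inv a b s" for X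
      using orbit_equivalence_lift_vf[of "-1" X] 2 unfolding scaleR_minus1_left mult_minus1 neg_0_less_iff_less
      by blast
    with 2 show thesis
      by (intro neg) blast+
  qed
qed

lemma orbit_in_lift:
  assumes "z \<in> I \<times> I'"
  shows "Phi p ` orbit_in (vf (lift_vf p X)) (I \<times> I') z = orbit_in (vf X) (J \<times> J') (Phi p z)"
proof (cases rule: lift_vf_cases)
  case pos
  then show ?thesis
    using orbit_equivalence.orbit_in_image[OF _ assms] by metis
next
  case neg
  then show ?thesis
    using orbit_equivalence.orbit_in_image[OF _ assms] orbit_in_reverse by metis
qed

lemma periodic_orbit_lift:
  assumes "\<delta> \<subseteq> I \<times> I'"
  shows "periodic_orbit (vf (lift_vf p X)) \<delta> \<longleftrightarrow> periodic_orbit (vf X) (Phi p ` \<delta>)"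
proof (cases rule: lift_vf_cases)
  case pos
  then show ?thesis
    using orbit_equivalence.periodic_orbit_iff[OF _ assms] by metis
next
  case neg
  then show ?thesis
    using orbit_equivalence.periodic_orbit_iff[OF _ assms] periodic_orbit_reverse_iff by metis
qed

lemma transverse_section_lift:
  assumes "\<Sigma> \<subseteq> I \<times> I'"
  shows "transverse_section (vf (lift_vf p X)) \<Sigma> \<longleftrightarrow> transverse_section (vf X) (Phi p ` \<Sigma>)"
proof (cases rule: lift_vf_cases)
  case pos
  then show ?thesis
    using orbit_equivalence.transverse_section_iff[OF _ assms] by metis
next
  case neg
  then show ?thesis
    using orbit_equivalence.transverse_section_iff[OF _ assms] transverse_section_reverse_iff by metis
qed

lemma local_return_map_lift_iff:
  assumes "\<delta> \<subseteq> I \<times> I'" "\<Sigma> \<subseteq> I \<times> I'" "q \<in> I \<times> I'"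
  shows "(\<exists>f. local_return_map (vf (lift_vf p X)) \<delta> \<Sigma> q f) \<longleftrightarrow>
    (\<exists>g. local_return_map (vf X) (Phi p ` \<delta>) (Phi p ` \<Sigma>) (Phi p q) g)"
proof (cases rule: lift_vf_cases)
  case pos
  then show ?thesis
    using orbit_equivalence.local_return_map_iff[OF _ assms] by metis
next
  case neg
  then show ?thesis
    using orbit_equivalence.local_return_map_iff[OF _ assms]
      local_return_map_reverse_iff[OF lipschitz_on_balls_vf] by metis
qed

text \<open>A single point \<open>z\<close> decides between the two cases, because the sign of the
  factor is constant on the rectangle.\<close>

lemma germ_conjugate_lift:
  assumes "local_return_map (vf (lift_vf p X)) \<delta> \<Sigma> q f"
    and "local_return_map (vf X) (Phi p ` \<delta>) (Phi p ` \<Sigma>) (Phi p q) g"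
    and "\<delta> \<subseteq> I \<times> I'" "\<Sigma> \<subseteq> I \<times> I'" "z \<in> I \<times> I'"
  shows "poly (pderiv p) (fst z) * poly (pderiv p) (snd z) > 0 \<Longrightarrow> germ_conjugate (Phi p) \<Sigma> q f g"
    and "poly (pderiv p) (fst z) * poly (pderiv p) (snd z) < 0 \<Longrightarrow>
      germ_conjugate_inverse (Phi p) (I \<times> I') \<Sigma> q f g"
proof -
  show "germ_conjugate (Phi p) \<Sigma> q f g" if s: "poly (pderiv p) (fst z) * poly (pderiv p) (snd z) > 0"
  proof (cases rule: lift_vf_cases)
    case pos
    then show ?thesis
      using orbit_equivalence.germ_conjugate_local_return_map[OF _ assms(1-4)] by metis
  next
    case neg
    then show ?thesis
      using s neg(1)[OF assms(5)] by simp
  qed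
  show "germ_conjugate_inverse (Phi p) (I \<times> I') \<Sigma> q f g"
    if s: "poly (pderiv p) (fst z) * poly (pderiv p) (snd z) < 0"
  proof (cases rule: lift_vf_cases)
    case neg
    then show ?thesis
      using germ_conjugate_inverse_local_return_map[OF _ lipschitz_on_balls_vf assms(1-4)] by metis
  next
    case pos
    then show ?thesis
      using s pos(1)[OF assms(5)] by simp
  qed
qed

lemma limit_cycle_lift:
  assumes "limit_cycle (vf X) \<gamma>" "\<gamma> \<subseteq> J \<times> J'"
  shows "limit_cycle (vf (lift_vf p X)) (Phi_inv ` \<gamma>)"
proof (cases rule: lift_vf_cases)
  case pos
  then show ?thesis
    using orbit_equivalence.limit_cycle_lift[OF _ assms] by metis
next
  case neg
  then show ?thesis
    using orbit_equivalence.limit_cycle_lift[OF _ assms] limit_cycle_reverse_iff by metis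
qed

lemma Phi_image_Phi_inv:
  assumes "\<gamma> \<subseteq> J \<times> J'"
  shows "Phi p ` Phi_inv ` \<gamma> = \<gamma>" and "Phi_inv ` \<gamma> \<subseteq> I \<times> I'"
proof -
  have "Phi p (Phi_inv w) = w" "Phi_inv w \<in> I \<times> I'" if "w \<in> \<gamma>" for w
    using homeomorphism_Phi subsetD[OF assms that] unfolding homeomorphism_def by blast+
  then show "Phi p ` Phi_inv ` \<gamma> = \<gamma>" "Phi_inv ` \<gamma> \<subseteq> I \<times> I'"
    by (simp_all add: image_image image_subset_iff)
qed

end

section \<open>Counting limit cycles\<close>

text \<open>There is one lift in each product of two branches, and different products are disjoint
  because different branches are.\<close>

lemma limit_cycle_lifts:
  assumes "finite \<I>" and branch: "\<And>I. I \<in> \<I> \<Longrightarrow> poly_branch p I J"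
    and \<gamma>: "limit_cycle (vf X) \<gamma>" "\<gamma> \<subseteq> J \<times> J"
  obtains \<C> where "finite \<C>" "card \<C> = card \<I> ^ 2" "pairwise disjnt \<C>"
    and "\<And>\<delta>. \<delta> \<in> \<C> \<Longrightarrow> limit_cycle (vf (lift_vf p X)) \<delta> \<and> Phi p ` \<delta> = \<gamma>"
proof -
  have "\<exists>\<delta>. \<delta> \<subseteq> fst k \<times> snd k \<and> limit_cycle (vf (lift_vf p X)) \<delta> \<and> Phi p ` \<delta> = \<gamma>" if k: "k \<in> \<I> \<times> \<I>" for k
  proof -
    interpret poly_branch_pair p "fst k" J "snd k" J
      using k branch by (intro poly_branch_pair.intro) auto
    show ?thesis
      using limit_cycle_lift[OF \<gamma>] Phi_image_Phi_inv[OF \<gamma>(2)] by blast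
  qed
  then obtain L where L: "\<And>k. k \<in> \<I> \<times> \<I> \<Longrightarrow> L k \<subseteq> fst k \<times> snd k"
      "\<And>k. k \<in> \<I> \<times> \<I> \<Longrightarrow> limit_cycle (vf (lift_vf p X)) (L k) \<and> Phi p ` L k = \<gamma>"
    by metis
  \<comment> \<open>Disjointness makes lifts distinct, and thereby countable by their rectangles,
    only if they are nonempty.\<close>
  have "\<gamma> \<noteq> {}"
    using \<gamma>(1) unfolding limit_cycle_def periodic_orbit_def by blast
  then have nonempty: "L k \<noteq> {}" if "k \<in> \<I> \<times> \<I>" for k
    using L(2)[OF that] by auto
  have meet: "k = k'" if k: "k \<in> \<I> \<times> \<I>" "k' \<in> \<I> \<times> \<I>" and "L k \<inter> L k' \<noteq> {}" for k k'
  proof -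
    obtain z where z: "z \<in> L k" "z \<in> L k'"
      using \<open>L k \<inter> L k' \<noteq> {}\<close> by blast
    have mem: "fst k \<in> \<I>" "snd k \<in> \<I>" "fst k' \<in> \<I>" "snd k' \<in> \<I>"
      using k by auto
    have "fst z \<in> fst k \<inter> fst k'" "snd z \<in> snd k \<inter> snd k'"
      using subsetD[OF L(1)[OF k(1)] z(1)] subsetD[OF L(1)[OF k(2)] z(2)] by (auto simp: mem_Times_iff)
    then have "fst k = fst k'" "snd k = snd k'"
      using poly_branch_disjoint[OF branch[OF mem(1)] branch[OF mem(3)]]
        poly_branch_disjoint[OF branch[OF mem(2)] branch[OF mem(4)]] by blast+
    then show ?thesis
      by (rule prod_eqI)
  qed
  have "inj_on L (\<I> \<times> \<I>)"
  proof (rule inj_onI)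
    fix k k' assume k: "k \<in> \<I> \<times> \<I>" "k' \<in> \<I> \<times> \<I>" "L k = L k'"
    then show "k = k'"
      using meet[OF k(1,2)] nonempty[OF k(1)] by simp
  qed
  then have "card (L ` (\<I> \<times> \<I>)) = card \<I> ^ 2"
    by (simp add: card_image card_cartesian_product power2_eq_square)
  moreover have "pairwise disjnt (L ` (\<I> \<times> \<I>))"
    unfolding pairwise_def disjnt_def using meet by blast
  moreover have "finite (L ` (\<I> \<times> \<I>))"
    using \<open>finite \<I>\<close> by simp
  moreover have "limit_cycle (vf (lift_vf p X)) \<delta> \<and> Phi p ` \<delta> = \<gamma>" if "\<delta> \<in> L ` (\<I> \<times> \<I>)" for \<delta>
    using that L(2) by blast
  ultimately show thesis
    by (intro that) blast+
qed

lemma bounded_periodic_orbit: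
  assumes "periodic_orbit F \<gamma>"
  shows "bounded \<gamma>"
proof -
  obtain \<phi> T where \<phi>: "solution_on F \<phi> UNIV" and T: "T > 0" "\<And>t. \<phi> (t + T) = \<phi> t" and \<gamma>: "\<gamma> = range \<phi>"
    using assms unfolding periodic_orbit_def by blast
  have nat: "\<phi> (t + real n * T) = \<phi> t" for t n
  proof (induction n)
    case (Suc n)
    then show ?case
      using T(2)[of "t + real n * T"] by (simp add: algebra_simps)
  qed simp
  have "\<phi> t \<in> \<phi> ` {0..T}" for t
  proof -
    define k where "k = \<lfloor>t / T\<rfloor>"
    define u where "u = t - of_int k * T"
    have "of_int k \<le> t / T" "t / T < of_int k + 1"
      unfolding k_def by linarith+
    then have "u \<in> {0..T}"
      using T(1) by (simp add: u_def field_simps)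
    moreover have "\<phi> t = \<phi> u"
    \<comment> \<open>Periodicity is available for natural multiples of \<open>T\<close> only; for
      negative \<open>k\<close> the shift is therefore made from \<open>t\<close> to
      \<open>u\<close> instead of from \<open>u\<close> to \<open>t\<close>.\<close>
    proof (cases "k \<ge> 0")
      case True
      then show ?thesis
        using nat[of u "nat k"] by (simp add: u_def)
    next
      case False
      then show ?thesis
        using nat[of t "nat (- k)"] by (simp add: u_def)
    qed
    ultimately show ?thesis
      by (metis imageI)
  qed
  then have "\<gamma> \<subseteq> \<phi> ` {0..T}"
    unfolding \<gamma> by blast
  moreover have "compact (\<phi> ` {0..T})"
    by (intro compact_continuous_image solution_on_continuous[OF solution_on_subset[OF \<phi>]]) auto
  ultimately show ?thesis
    using bounded_subset compact_imp_bounded by blast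
qed

text \<open>Lower bounds by natural numbers are witnessed by finite families, which treats finite
  and infinite counts alike.\<close>

lemma le_num_limit_cycles_iff:
  "enat k \<le> num_limit_cycles X \<longleftrightarrow> (\<exists>L. L \<subseteq> {\<gamma>. limit_cycle (vf X) \<gamma>} \<and> finite L \<and> card L = k)"
proof -
  define A where "A = {\<gamma>. limit_cycle (vf X) \<gamma>}"
  have "enat k \<le> (if finite A then enat (card A) else \<infinity>) \<longleftrightarrow> (\<exists>L. L \<subseteq> A \<and> finite L \<and> card L = k)"
  proof (cases "finite A")
    case True
    have "k \<le> card A \<longleftrightarrow> (\<exists>L. L \<subseteq> A \<and> finite L \<and> card L = k)"
      using obtain_subset_with_card_n[of k A] card_mono[OF True] by metis
    with True show ?thesis
      by simp
  next
    case False
    then show ?thesis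
      using infinite_arbitrarily_large[OF False, of k] by auto
  qed
  then show ?thesis
    unfolding num_limit_cycles_def A_def .
qed

text \<open>
  The limit cycles of \<open>X\<close> need not lie in $(-1,1)^2$, but finitely many of them lie in some
  $(-r,r)^2$, onto which \<open>r p\<close> maps the products of full branch intervals of \<open>p\<close>.
\<close>

lemma num_limit_cycles_lift:
  assumes deg: "vf_degree X \<le> n" "degree p = m" and k: "enat k \<le> num_limit_cycles X"
  shows "enat (num_branches p ^ 2 * k) \<le> hilbert_number (n * m + (m - 1))"
proof (cases "finite {I. full_branch_interval p I}")
  \<comment> \<open>\<open>card\<close> of an infinite set is 0, so the left-hand side
    vanishes.\<close>
  case False
  then show ?thesis
    by (simp add: num_branches_def flip: zero_enat_def)
next
  case True
  obtain L where L: "\<And>\<gamma>. \<gamma> \<in> L \<Longrightarrow> limit_cycle (vf X) \<gamma>" "finite L" "card L = k"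
    using k unfolding le_num_limit_cycles_iff by blast
  have "bounded (\<Union>L)"
    using L(1,2) bounded_periodic_orbit unfolding limit_cycle_def by (intro bounded_Union ballI) blast+
  then obtain r where r: "r > 0" "\<And>z. z \<in> \<Union>L \<Longrightarrow> norm z < r"
    unfolding bounded_pos_less by blast
  have sub: "\<gamma> \<subseteq> {-r<..<r} \<times> {-r<..<r}" if "\<gamma> \<in> L" for \<gamma>
  proof
    fix z assume "z \<in> \<gamma>"
    then have "norm z < r"
      using r(2) that by blast
    then have "\<bar>fst z\<bar> < r" "\<bar>snd z\<bar> < r"
      using norm_fst_le[of "fst z" "snd z"] norm_snd_le[of "snd z" "fst z"] by simp_all
    then show "z \<in> {-r<..<r} \<times> {-r<..<r}"
      by (auto simp: mem_Times_iff abs_less_iff)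
  qed
  define Y where "Y = lift_vf (smult r p) X"
  have "\<exists>\<C>. finite \<C> \<and> card \<C> = num_branches p ^ 2 \<and>
      (\<forall>\<delta>\<in>\<C>. limit_cycle (vf Y) \<delta> \<and> Phi (smult r p) ` \<delta> = \<gamma>)" if "\<gamma> \<in> L" for \<gamma>
    using limit_cycle_lifts[OF True _ L(1)[OF that] sub[OF that], of "smult r p"]
      poly_branch_smult[OF _ r(1)] unfolding Y_def num_branches_def by (metis mem_Collect_eq)
  then obtain \<C> where \<C>: "\<And>\<gamma>. \<gamma> \<in> L \<Longrightarrow> finite (\<C> \<gamma>)" "\<And>\<gamma>. \<gamma> \<in> L \<Longrightarrow> card (\<C> \<gamma>) = num_branches p ^ 2"
      "\<And>\<gamma> \<delta>. \<gamma> \<in> L \<Longrightarrow> \<delta> \<in> \<C> \<gamma> \<Longrightarrow> limit_cycle (vf Y) \<delta>"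
      "\<And>\<gamma> \<delta>. \<gamma> \<in> L \<Longrightarrow> \<delta> \<in> \<C> \<gamma> \<Longrightarrow> Phi (smult r p) ` \<delta> = \<gamma>"
    by metis
  \<comment> \<open>Lifts of different limit cycles differ because \<open>Phi\<close> sends each to
    the cycle it comes from; so the families are disjoint and their cardinalities add up.\<close>
  have "card (\<Union>\<gamma>\<in>L. \<C> \<gamma>) = (\<Sum>\<gamma>\<in>L. card (\<C> \<gamma>))"
  proof (rule card_UN_disjoint)
    show "\<forall>\<gamma>\<in>L. \<forall>\<gamma>'\<in>L. \<gamma> \<noteq> \<gamma>' \<longrightarrow> \<C> \<gamma> \<inter> \<C> \<gamma>' = {}"
    proof (intro ballI impI equals0I)
      fix \<gamma> \<gamma>' \<delta> assume "\<gamma> \<in> L" "\<gamma>' \<in> L" "\<gamma> \<noteq> \<gamma>'" "\<delta> \<in> \<C> \<gamma> \<inter> \<C> \<gamma>'"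
      then show False
        using \<C>(4)[of \<gamma> \<delta>] \<C>(4)[of \<gamma>' \<delta>] by simp
    qed
  qed (use L \<C> in auto)
  then have "card (\<Union>\<gamma>\<in>L. \<C> \<gamma>) = num_branches p ^ 2 * k"
    using \<C>(2) L(3) by simp
  moreover have "(\<Union>\<gamma>\<in>L. \<C> \<gamma>) \<subseteq> {\<delta>. limit_cycle (vf Y) \<delta>}" "finite (\<Union>\<gamma>\<in>L. \<C> \<gamma>)"
    using \<C>(1,3) L(2) by auto
  ultimately have "enat (num_branches p ^ 2 * k) \<le> num_limit_cycles Y"
    unfolding le_num_limit_cycles_iff by blast
  also have "num_limit_cycles Y \<le> hilbert_number (n * m + (m - 1))"
    unfolding hilbert_number_def
  proof (rule SUP_upper)
    have "vf_degree Y \<le> m * vf_degree X + (m - 1)"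
      using vf_degree_lift_vf_le[of "smult r p" X] r(1) deg(2) by (simp add: Y_def)
    also have "\<dots> \<le> n * m + (m - 1)"
      using mult_le_mono2[OF deg(1), of m] by (simp add: mult.commute)
    finally show "Y \<in> {X. vf_degree X \<le> n * m + (m - 1)}"
      by simp
  qed
  finally show ?thesis .
qed

lemma enat_mult_leI:
  assumes "\<And>k. enat k \<le> a \<Longrightarrow> enat (c * k) \<le> b"
  shows "enat c * a \<le> b"
proof (cases a)
  case (enat k)
  then show ?thesis
    using assms[of k] by simp
next
  case infinity
  show ?thesis
  proof (cases b)
    case (enat l)
    \<comment> \<open>If \<open>a\<close> is infinite and \<open>b\<close> is a finite
      \<open>l\<close>, testing with l + 1 forces c = 0, and then the convention that 0 times
      infinity is 0 closes the case.\<close>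
    then have "c * Suc l \<le> l"
      using assms[of "Suc l"] infinity by simp
    then have "c = 0"
      by (cases c) auto
    then show ?thesis
      by (simp flip: zero_enat_def)
  qed simp
qed

lemma hilbert_number_lift:
  assumes "degree p = m"
  shows "enat (num_branches p ^ 2) * hilbert_number n \<le> hilbert_number (n * m + (m - 1))"
proof (rule enat_mult_leI)
  fix k assume k: "enat k \<le> hilbert_number n"
  have "\<exists>X. vf_degree X \<le> n \<and> enat k \<le> num_limit_cycles X"
  proof (cases k)
    case 0
    \<comment> \<open>For the bound 0 any field of admissible degree will do, such as the zero
      field.\<close>
    have "vf_degree (0, 0) \<le> n"
      by (simp add: vf_degree_def total_degree_def)
    with 0 show ?thesis
      by (intro exI[of _ "(0, 0)"]) (simp flip: zero_enat_def)
  next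
    case (Suc l)
    \<comment> \<open>A supremum need not be attained. Passing to the strict bound by the
      predecessor \<open>l\<close> yields a field with more than \<open>l\<close>, hence at least
      \<open>k\<close>, limit cycles.\<close>
    then have "enat l < hilbert_number n"
      using k by (meson enat_ord_simps(2) less_le_trans lessI)
    then obtain X where "vf_degree X \<le> n" "enat l < num_limit_cycles X"
      unfolding hilbert_number_def less_SUP_iff by blast
    then show ?thesis
      using Suc by (metis Suc_ile_eq)
  qed
  then show "enat (num_branches p ^ 2 * k) \<le> hilbert_number (n * m + (m - 1))"
    using num_limit_cycles_lift assms by blast
qed

section \<open>Assembly over the full branch intervals\<close>

lemma full_branch_rectangles:
  "\<forall>Ia Ib. full_branch_interval p Ia \<and> full_branch_interval p Ib \<longrightarrow>
    (let R = Ia \<times> Ib; s = (\<lambda>(u, v). poly (pderiv p) u * poly (pderiv p) v);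
         Y = lift_vf p X; Q = {-1<..<1} \<times> {-1<..<1} in
      smooth_diffeo (Phi p) R Q \<and>
      (\<forall>z\<in>R. frechet_derivative (Phi p) (at z) (vf Y z) = s z *\<^sub>R vf X (Phi p z) \<and>
             s z \<noteq> 0) \<and>
      ((\<forall>z\<in>R. s z > 0) \<or> (\<forall>z\<in>R. s z < 0)) \<and>
      (\<forall>z\<in>R. Phi p ` orbit_in (vf Y) R z = orbit_in (vf X) Q (Phi p z)) \<and>
      (\<forall>\<delta>\<subseteq>R. periodic_orbit (vf Y) \<delta> \<longleftrightarrow> periodic_orbit (vf X) (Phi p ` \<delta>)) \<and>
      (\<forall>\<Sigma>\<subseteq>R. transverse_section (vf Y) \<Sigma> \<longleftrightarrow> transverse_section (vf X) (Phi p ` \<Sigma>)) \<and>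
      (\<forall>\<delta>\<subseteq>R. \<forall>\<Sigma>\<subseteq>R. \<forall>q\<in>\<delta> \<inter> \<Sigma>.
        ((\<exists>f. local_return_map (vf Y) \<delta> \<Sigma> q f) \<longleftrightarrow>
         (\<exists>g. local_return_map (vf X) (Phi p ` \<delta>) (Phi p ` \<Sigma>) (Phi p q) g)) \<and>
        (\<forall>f g. local_return_map (vf Y) \<delta> \<Sigma> q f \<and>
               local_return_map (vf X) (Phi p ` \<delta>) (Phi p ` \<Sigma>) (Phi p q) g \<longrightarrow>
          ((\<forall>z\<in>R. s z > 0) \<longrightarrow> germ_conjugate (Phi p) \<Sigma> q f g) \<and>
          ((\<forall>z\<in>R. s z < 0) \<longrightarrow> germ_conjugate_inverse (Phi p) R \<Sigma> q f g))))"
proof (intro allI impI)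
  fix Ia Ib assume "full_branch_interval p Ia \<and> full_branch_interval p Ib"
  then interpret poly_branch_pair p Ia "{-1<..<1}" Ib "{-1<..<1}"
    by (intro poly_branch_pair.intro full_branch_interval_poly_branch) simp_all
  define Q where "Q = {-1<..<1::real} \<times> {-1<..<1::real}"
  define s where "s = (\<lambda>(u, v). poly (pderiv p) u * poly (pderiv p) v)"
  have s: "s z = poly (pderiv p) (fst z) * poly (pderiv p) (snd z)" for z
    by (simp add: s_def case_prod_unfold)
  have 1: "smooth_diffeo (Phi p) (Ia \<times> Ib) Q"
    unfolding Q_def by (rule smooth_diffeo_Phi)
  have 2: "\<forall>z\<in>Ia \<times> Ib. frechet_derivative (Phi p) (at z) (vf (lift_vf p X) z) = s z *\<^sub>R vf X (Phi p z) \<and> s z \<noteq> 0"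
  proof (intro ballI conjI)
    fix z assume z: "z \<in> Ia \<times> Ib"
    show "frechet_derivative (Phi p) (at z) (vf (lift_vf p X) z) = s z *\<^sub>R vf X (Phi p z)"
      unfolding frechet_derivative_at[OF Phi_has_derivative, symmetric] s by (rule Phi_lift_vf)
    show "s z \<noteq> 0"
      using z A.pderiv_nonzero B.pderiv_nonzero unfolding s by (simp add: mem_Times_iff)
  qed
  have 3: "(\<forall>z\<in>Ia \<times> Ib. s z > 0) \<or> (\<forall>z\<in>Ia \<times> Ib. s z < 0)"
    unfolding s by (rule pderiv_product_sign)
  have 4: "\<forall>z\<in>Ia \<times> Ib. Phi p ` orbit_in (vf (lift_vf p X)) (Ia \<times> Ib) z = orbit_in (vf X) Q (Phi p z)"
    unfolding Q_def by (intro ballI orbit_in_lift)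
  have 5: "\<forall>\<delta>\<subseteq>Ia \<times> Ib. periodic_orbit (vf (lift_vf p X)) \<delta> \<longleftrightarrow> periodic_orbit (vf X) (Phi p ` \<delta>)"
    by (intro allI impI periodic_orbit_lift)
  have 6: "\<forall>\<Sigma>\<subseteq>Ia \<times> Ib. transverse_section (vf (lift_vf p X)) \<Sigma> \<longleftrightarrow> transverse_section (vf X) (Phi p ` \<Sigma>)"
    by (intro allI impI transverse_section_lift)
  have 7: "\<forall>\<delta>\<subseteq>Ia \<times> Ib. \<forall>\<Sigma>\<subseteq>Ia \<times> Ib. \<forall>q\<in>\<delta> \<inter> \<Sigma>.
      ((\<exists>f. local_return_map (vf (lift_vf p X)) \<delta> \<Sigma> q f) \<longleftrightarrow>
       (\<exists>g. local_return_map (vf X) (Phi p ` \<delta>) (Phi p ` \<Sigma>) (Phi p q) g)) \<and>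
      (\<forall>f g. local_return_map (vf (lift_vf p X)) \<delta> \<Sigma> q f \<and>
             local_return_map (vf X) (Phi p ` \<delta>) (Phi p ` \<Sigma>) (Phi p q) g \<longrightarrow>
        ((\<forall>z\<in>Ia \<times> Ib. s z > 0) \<longrightarrow> germ_conjugate (Phi p) \<Sigma> q f g) \<and>
        ((\<forall>z\<in>Ia \<times> Ib. s z < 0) \<longrightarrow> germ_conjugate_inverse (Phi p) (Ia \<times> Ib) \<Sigma> q f g))"
  proof (intro allI impI ballI conjI)
    fix \<delta> \<Sigma> q assume sub: "\<delta> \<subseteq> Ia \<times> Ib" "\<Sigma> \<subseteq> Ia \<times> Ib" and "q \<in> \<delta> \<inter> \<Sigma>"
    then have q: "q \<in> Ia \<times> Ib"
      by blast
    then show "(\<exists>f. local_return_map (vf (lift_vf p X)) \<delta> \<Sigma> q f) \<longleftrightarrow>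
       (\<exists>g. local_return_map (vf X) (Phi p ` \<delta>) (Phi p ` \<Sigma>) (Phi p q) g)"
      by (rule local_return_map_lift_iff[OF sub])
    fix f g assume ret: "local_return_map (vf (lift_vf p X)) \<delta> \<Sigma> q f \<and>
             local_return_map (vf X) (Phi p ` \<delta>) (Phi p ` \<Sigma>) (Phi p q) g"
    show "germ_conjugate (Phi p) \<Sigma> q f g" if pos: "\<forall>z\<in>Ia \<times> Ib. s z > 0"
      by (rule germ_conjugate_lift(1)[OF conjunct1[OF ret] conjunct2[OF ret] sub q
            bspec[OF pos q, unfolded s]])
    show "germ_conjugate_inverse (Phi p) (Ia \<times> Ib) \<Sigma> q f g" if neg: "\<forall>z\<in>Ia \<times> Ib. s z < 0"
      by (rule germ_conjugate_lift(2)[OF conjunct1[OF ret] conjunct2[OF ret] sub q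
            bspec[OF neg q, unfolded s]])
  qed
  show "let R = Ia \<times> Ib; s = (\<lambda>(u, v). poly (pderiv p) u * poly (pderiv p) v);
         Y = lift_vf p X; Q = {-1<..<1} \<times> {-1<..<1} in
      smooth_diffeo (Phi p) R Q \<and>
      (\<forall>z\<in>R. frechet_derivative (Phi p) (at z) (vf Y z) = s z *\<^sub>R vf X (Phi p z) \<and>
             s z \<noteq> 0) \<and>
      ((\<forall>z\<in>R. s z > 0) \<or> (\<forall>z\<in>R. s z < 0)) \<and>
      (\<forall>z\<in>R. Phi p ` orbit_in (vf Y) R z = orbit_in (vf X) Q (Phi p z)) \<and>
      (\<forall>\<delta>\<subseteq>R. periodic_orbit (vf Y) \<delta> \<longleftrightarrow> periodic_orbit (vf X) (Phi p ` \<delta>)) \<and>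
      (\<forall>\<Sigma>\<subseteq>R. transverse_section (vf Y) \<Sigma> \<longleftrightarrow> transverse_section (vf X) (Phi p ` \<Sigma>)) \<and>
      (\<forall>\<delta>\<subseteq>R. \<forall>\<Sigma>\<subseteq>R. \<forall>q\<in>\<delta> \<inter> \<Sigma>.
        ((\<exists>f. local_return_map (vf Y) \<delta> \<Sigma> q f) \<longleftrightarrow>
         (\<exists>g. local_return_map (vf X) (Phi p ` \<delta>) (Phi p ` \<Sigma>) (Phi p q) g)) \<and>
        (\<forall>f g. local_return_map (vf Y) \<delta> \<Sigma> q f \<and>
               local_return_map (vf X) (Phi p ` \<delta>) (Phi p ` \<Sigma>) (Phi p q) g \<longrightarrow>
          ((\<forall>z\<in>R. s z > 0) \<longrightarrow> germ_conjugate (Phi p) \<Sigma> q f g) \<and>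
          ((\<forall>z\<in>R. s z < 0) \<longrightarrow> germ_conjugate_inverse (Phi p) R \<Sigma> q f g)))"
    unfolding Let_def s_def[symmetric] Q_def[symmetric]
    by (rule conjI[OF 1 conjI[OF 2 conjI[OF 3 conjI[OF 4 conjI[OF 5 conjI[OF 6 7]]]]]])
qed

lemma limit_cycle_lifts_full_branches:
  assumes "limit_cycle (vf X) \<gamma>" "\<gamma> \<subseteq> {-1<..<1} \<times> {-1<..<1}"
  shows "\<exists>\<C>. finite \<C> \<and> card \<C> \<ge> num_branches p ^ 2 \<and> pairwise disjnt \<C> \<and>
    (\<forall>\<delta>\<in>\<C>. limit_cycle (vf (lift_vf p X)) \<delta> \<and> Phi p ` \<delta> = \<gamma>)"
proof (cases "finite {I. full_branch_interval p I}")
  case True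
  have "poly_branch p I {-1<..<1}" if "I \<in> {I. full_branch_interval p I}" for I
    using that full_branch_interval_poly_branch by blast
  from limit_cycle_lifts[OF True this assms] obtain \<C> where "finite \<C>"
      "card \<C> = num_branches p ^ 2" "pairwise disjnt \<C>"
      "\<And>\<delta>. \<delta> \<in> \<C> \<Longrightarrow> limit_cycle (vf (lift_vf p X)) \<delta> \<and> Phi p ` \<delta> = \<gamma>"
    unfolding num_branches_def by metis
  then show ?thesis
    by (intro exI[of _ \<C>]) simp
next
  case False
  then show ?thesis
    by (intro exI[of _ "{}"]) (simp add: num_branches_def)
qed

theorem proposition3:
  shows
    "(\<forall>(X :: poly_vf) (p :: real poly) (m :: nat) K.
        compact K \<and> K \<subseteq> {-1<..<1} \<times> {-1<..<1} \<and> (\<forall>\<gamma>. limit_cycle (vf X) \<gamma> \<longrightarrow> \<gamma> \<subseteq> K) \<and>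
        degree p = m \<and> 2 \<le> m \<longrightarrow>
        (let Y = lift_vf p X; Q = {-1<..<1} \<times> {-1<..<1} in
          vf_degree Y \<le> m * vf_degree X + (m - 1) \<and>
          (\<forall>Ia Ib. full_branch_interval p Ia \<and> full_branch_interval p Ib \<longrightarrow>
            (let R = Ia \<times> Ib; s = (\<lambda>(u, v). poly (pderiv p) u * poly (pderiv p) v) in
              smooth_diffeo (Phi p) R Q \<and>
              (\<forall>z\<in>R. frechet_derivative (Phi p) (at z) (vf Y z) = s z *\<^sub>R vf X (Phi p z) \<and>
                     s z \<noteq> 0) \<and>
              ((\<forall>z\<in>R. s z > 0) \<or> (\<forall>z\<in>R. s z < 0)) \<and>
              (\<forall>z\<in>R. Phi p ` orbit_in (vf Y) R z = orbit_in (vf X) Q (Phi p z)) \<and>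
              (\<forall>\<delta>\<subseteq>R. periodic_orbit (vf Y) \<delta> \<longleftrightarrow> periodic_orbit (vf X) (Phi p ` \<delta>)) \<and>
              (\<forall>\<Sigma>\<subseteq>R. transverse_section (vf Y) \<Sigma> \<longleftrightarrow> transverse_section (vf X) (Phi p ` \<Sigma>)) \<and>
              (\<forall>\<delta>\<subseteq>R. \<forall>\<Sigma>\<subseteq>R. \<forall>q\<in>\<delta> \<inter> \<Sigma>.
                ((\<exists>f. local_return_map (vf Y) \<delta> \<Sigma> q f) \<longleftrightarrow>
                 (\<exists>g. local_return_map (vf X) (Phi p ` \<delta>) (Phi p ` \<Sigma>) (Phi p q) g)) \<and>
                (\<forall>f g. local_return_map (vf Y) \<delta> \<Sigma> q f \<and>
                       local_return_map (vf X) (Phi p ` \<delta>) (Phi p ` \<Sigma>) (Phi p q) g \<longrightarrow>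
                  ((\<forall>z\<in>R. s z > 0) \<longrightarrow> germ_conjugate (Phi p) \<Sigma> q f g) \<and>
                  ((\<forall>z\<in>R. s z < 0) \<longrightarrow> germ_conjugate_inverse (Phi p) R \<Sigma> q f g))))) \<and>
          (\<forall>\<gamma>. limit_cycle (vf X) \<gamma> \<longrightarrow>
            (\<exists>\<C>. finite \<C> \<and> card \<C> \<ge> num_branches p ^ 2 \<and> pairwise disjnt \<C> \<and>
              (\<forall>\<delta>\<in>\<C>. limit_cycle (vf Y) \<delta> \<and> Phi p ` \<delta> = \<gamma>))))) \<and>
     (\<forall>(n :: nat) (p :: real poly) (m :: nat). 1 \<le> n \<and> degree p = m \<and> 2 \<le> m \<longrightarrow>
        hilbert_number (n * m + m - 1) \<ge> enat (num_branches p ^ 2) * hilbert_number n)"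
proof (intro conjI allI impI)
  fix X :: poly_vf and p :: "real poly" and m :: nat and K
  assume "compact K \<and> K \<subseteq> {-1<..<1} \<times> {-1<..<1} \<and> (\<forall>\<gamma>. limit_cycle (vf X) \<gamma> \<longrightarrow> \<gamma> \<subseteq> K) \<and>
    degree p = m \<and> 2 \<le> m"
  then have m: "degree p = m" and K: "\<And>\<gamma>. limit_cycle (vf X) \<gamma> \<Longrightarrow> \<gamma> \<subseteq> {-1<..<1} \<times> {-1<..<1}"
    by blast+
  have degree: "vf_degree (lift_vf p X) \<le> m * vf_degree X + (m - 1)"
    using vf_degree_lift_vf_le[of p X] m by simp
  have lifts: "\<forall>\<gamma>. limit_cycle (vf X) \<gamma> \<longrightarrow> (\<exists>\<C>. finite \<C> \<and> card \<C> \<ge> num_branches p ^ 2 \<and> pairwise disjnt \<C> \<and>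
      (\<forall>\<delta>\<in>\<C>. limit_cycle (vf (lift_vf p X)) \<delta> \<and> Phi p ` \<delta> = \<gamma>))"
    by (intro allI impI limit_cycle_lifts_full_branches K)
  show "(let Y = lift_vf p X; Q = {-1<..<1} \<times> {-1<..<1} in
          vf_degree Y \<le> m * vf_degree X + (m - 1) \<and>
          (\<forall>Ia Ib. full_branch_interval p Ia \<and> full_branch_interval p Ib \<longrightarrow>
            (let R = Ia \<times> Ib; s = (\<lambda>(u, v). poly (pderiv p) u * poly (pderiv p) v) in
              smooth_diffeo (Phi p) R Q \<and>
              (\<forall>z\<in>R. frechet_derivative (Phi p) (at z) (vf Y z) = s z *\<^sub>R vf X (Phi p z) \<and>
                     s z \<noteq> 0) \<and>
              ((\<forall>z\<in>R. s z > 0) \<or> (\<forall>z\<in>R. s z < 0)) \<and>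
              (\<forall>z\<in>R. Phi p ` orbit_in (vf Y) R z = orbit_in (vf X) Q (Phi p z)) \<and>
              (\<forall>\<delta>\<subseteq>R. periodic_orbit (vf Y) \<delta> \<longleftrightarrow> periodic_orbit (vf X) (Phi p ` \<delta>)) \<and>
              (\<forall>\<Sigma>\<subseteq>R. transverse_section (vf Y) \<Sigma> \<longleftrightarrow> transverse_section (vf X) (Phi p ` \<Sigma>)) \<and>
              (\<forall>\<delta>\<subseteq>R. \<forall>\<Sigma>\<subseteq>R. \<forall>q\<in>\<delta> \<inter> \<Sigma>.
                ((\<exists>f. local_return_map (vf Y) \<delta> \<Sigma> q f) \<longleftrightarrow>
                 (\<exists>g. local_return_map (vf X) (Phi p ` \<delta>) (Phi p ` \<Sigma>) (Phi p q) g)) \<and>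
                (\<forall>f g. local_return_map (vf Y) \<delta> \<Sigma> q f \<and>
                       local_return_map (vf X) (Phi p ` \<delta>) (Phi p ` \<Sigma>) (Phi p q) g \<longrightarrow>
                  ((\<forall>z\<in>R. s z > 0) \<longrightarrow> germ_conjugate (Phi p) \<Sigma> q f g) \<and>
                  ((\<forall>z\<in>R. s z < 0) \<longrightarrow> germ_conjugate_inverse (Phi p) R \<Sigma> q f g))))) \<and>
          (\<forall>\<gamma>. limit_cycle (vf X) \<gamma> \<longrightarrow>
            (\<exists>\<C>. finite \<C> \<and> card \<C> \<ge> num_branches p ^ 2 \<and> pairwise disjnt \<C> \<and>
              (\<forall>\<delta>\<in>\<C>. limit_cycle (vf Y) \<delta> \<and> Phi p ` \<delta> = \<gamma>))))"
    unfolding Let_def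
    by (rule conjI[OF degree conjI[OF full_branch_rectangles[unfolded Let_def] lifts]])
next
  fix n m :: nat and p :: "real poly"
  assume "1 \<le> n \<and> degree p = m \<and> 2 \<le> m"
  \<comment> \<open>The truncated differences \<open>n * m + m - 1\<close> and
    \<open>n * m + (m - 1)\<close> agree since m is positive.\<close>
  then show "enat (num_branches p ^ 2) * hilbert_number n \<le> hilbert_number (n * m + m - 1)"
    using hilbert_number_lift[of p m n] by simp
qed

end
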